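(* In the setting described in the context, let $\Phi(H/h)$ be the function of the jump estimate fixed there, that is, the function with $$\langle P_D w, P_D w\rangle_{\widetilde A}\le \Phi(H/h)\,\langle w,w\rangle_{\widetilde A}\qquad\text{for all } w\in \widetilde W_0 ,$$ and let $\beta$ be the inf-sup constant. Then for all $x=(p_\Gamma,\lambda)$ in the range $R_{M^{-1}G}$ of $M^{-1}G$, $$C\,\beta^2\,\langle Mx,x\rangle\ \le\ \langle Gx,x\rangle\ \le\ \Phi(H/h)\,\langle Mx,x\rangle ,$$ where $C$ is a generic positive constant independent of the mesh size $h$ and the subdomain diameter $H$.
   Context: Discretization. $\Omega$ is a bounded polygonal domain in $\mathbb R^2$, triangulated into shape-regular triangles of characteristic size $h$. The pressure space $Q\subset L^2(\Omega)$ consists of the continuous piecewise linear functions on this triangulation. The velocity space $\mathbf W\subset (H^1_0(\Omega))^2$ consists of the continuous piecewise linear vector fields on the refined triangulation obtained by splitting each triangle into four by joining its edge midpoints. Functions are identified with their vectors of nodal values; $\langle\cdot,\cdot\rangle$ is the Euclidean inner product of vectors, and $\langle u,v\rangle_K=u^TKv$ for a symmetric matrix $K$. The matrices $A$ and $B$ represent $a(\mathbf u,\mathbf v)=\int_\Omega\nabla\mathbf u\cdot\nabla\mathbf v$ on $\mathbf W$ and $b(\mathbf u,q)=-\int_\Omega(\nabla\cdot\mathbf u)q$ on $\mathbf W\times Q$. $\mathrm{Ker}(B^T)$ is the space of constant pressures, and elements of $Q/\mathrm{Ker}(B^T)$ are represented by zero-average $q$. $Z$ is the pressure mass matrix, $\|q\|_{L^2}^2=\langle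 q,Zq\rangle$; it satisfies $ch^2I\le Z\le Ch^2I$. The constant $\beta>0$, independent of $h$, is the inf-sup constant: $\sup_{\mathbf w\in\mathbf W}\langle q,B\mathbf w\rangle^2/\langle\mathbf w,A\mathbf w\rangle\ge\beta^2\langle q,Zq\rangle$ for all $q\in Q/\mathrm{Ker}(B^T)$. Decomposition. $\Omega$ is decomposed into $N$ non-overlapping polygonal subdomains $\Omega_i$, each a union of a bounded number of elements, with diameters of order $H$; nodes match across the interface $\Gamma=(\cup\partial\Omega_i)\setminus\partial\Omega$, which consists of subdomain edges and subdomain vertices. $\mathbf W=\mathbf W_I\oplus\mathbf W_\Gamma$ and $Q=Q_I\oplus Q_\Gamma$, where $\mathbf W_I=\bigoplus_i\mathbf W_I^{(i)}$, $Q_I=\bigoplus_iQ_I^{(i)}$ are subdomain-interior degrees of freedom and $\mathbf W_\Gamma$, $Q_\Gamma$ are the interface degrees of freedom, shared by neighboring subdomains. $\mathbf W_\Gamma$ is replaced by the partially assembled space $\widetilde{\mathbf W}_\Gamma=\mathbf W_\Pi\oplus\mathbf W_\Delta$, $\mathbf W_\Delta=\bigoplus_i\mathbf W_\Delta^{(i)}$. Here $\mathbf W_\Pi$ is the continuous coarse-level primal velocity space, typically spanned by subdomain vertex nodal basis functions and/or interface edge basis functions with constant values (or values of positive weights) on the edges. $\mathbf W_\Delta^{(i)}$ is spanned by the remaining (dual) interface velocity degrees of freedom of $\Omega_i$, with basis functions vanishing at the primal degrees of freedom; elements of $\mathbf W_\Delta$ may be discontinuous across $\Gamma$. $B_\Delta$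 is a matrix with entries in $\{0,1,-1\}$; each row has exactly two nonzero entries $1,-1$, corresponding to the same interface velocity degree of freedom in two neighboring subdomains, so that $B_\Delta\mathbf w_\Delta=0$ expresses continuity of $\mathbf w_\Delta$. Non-redundant constraints are used, so $B_\Delta$ has full row rank. $\Lambda$ is the range of $B_\Delta$ on $\mathbf W_\Delta$. $B_{\Delta,D}$ is obtained from $B_\Delta$ by multiplying each entry corresponding to a node $x$ by $\delta^\dagger(x)=1/\mathcal N_x$, $\mathcal N_x$ being the number of subdomains sharing $x$; it satisfies $B_\Delta B_{\Delta,D}^T=I$. Operators. Let $\widetilde W=\mathbf W_I\oplus Q_I\oplus\mathbf W_\Delta\oplus\mathbf W_\Pi$ and $X=Q_\Gamma\oplus\Lambda$. With sub-blocks denoting the subdomain-wise restrictions of $A$ and $B$ to the indicated subspaces, set $$\widetilde A=\begin{bmatrix} A_{II} & B_{II}^T & A_{I\Delta} & A_{I\Pi} \\ B_{II} & 0 & B_{I\Delta} & B_{I\Pi} \\ A_{\Delta I} & B_{I\Delta}^T & A_{\Delta\Delta} & A_{\Delta\Pi} \\ A_{\Pi I} & B_{I\Pi}^T & A_{\Pi\Delta} & A_{\Pi\Pi} \end{bmatrix},\qquad B_C=\begin{bmatrix} B_{\Gamma I} & 0 & B_{\Gamma\Delta} & B_{\Gamma\Pi} \\ 0 & 0 & B_\Delta & 0 \end{bmatrix}.$$ $\widetilde A$ is invertible, and $G=B_C\widetilde A^{-1}B_C^T$ acts on $X$; $G$ is symmetric positive semi-definite. $\widetilde W_0=\{w=(\mathbf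 w_I,p_I,\mathbf w_\Delta,\mathbf w_\Pi)\in\widetilde W: B_{II}\mathbf w_I+B_{I\Delta}\mathbf w_\Delta+B_{I\Pi}\mathbf w_\Pi=0\}$; on $\widetilde W_0$, $\langle\cdot,\cdot\rangle_{\widetilde A}$ is an inner product, with $\langle w,w\rangle_{\widetilde A}=\sum_i|\mathbf w^{(i)}|^2_{H^1(\Omega_i)}$, where $\mathbf w^{(i)}$ is the restriction of the velocity part of $w$ to $\Omega_i$. $\widetilde R_\Delta:\widetilde W\to\mathbf W_\Delta$ is the restriction $w\mapsto\mathbf w_\Delta$, and $P_D=\widetilde R_\Delta^TB_{\Delta,D}^TB_\Delta\widetilde R_\Delta$ is the jump operator. The lumped preconditioner is the symmetric positive definite matrix $$M^{-1}=\begin{bmatrix} \frac1{h^2}I_{p_\Gamma} & 0 \\ 0 & M_\lambda^{-1} \end{bmatrix},\qquad M_\lambda^{-1}=B_{\Delta,D}\widetilde R_\Delta\widetilde A\widetilde R_\Delta^TB_{\Delta,D}^T,$$ where $I_{p_\Gamma}$ is the identity on $Q_\Gamma$; $M$ is its inverse. The function $\Phi$. It is known that there exists a function $\Phi(H/h)$ such that $\langle P_D w, P_D w\rangle_{\widetilde A}\le \Phi(H/h)\langle w,w\rangle_{\widetilde A}$ for all $w\in\widetilde W_0$ (the jump estimate); $\Phi$ denotes this function throughout. When only subdomain corner velocities are chosen as primal variables, $\Phi(H/h)=C(H/h)(1+\log(H/h))$; when both subdomain corner and edge-average velocities are primal, $\Phi(H/h)=C\,H/h$. Here $C$ is a generic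 positive constant independent of $h$ and $H$.
   Formalization: The upper bound is proved with K·Φ(H/h), where K ≥ 1 is independent of h, H and β, since with Φ itself it can fail (e.g. when all interface velocities are primal, so P_D = 0); Φ is assumed bounded below by a positive constant for H/h ≥ 1, and h ≤ H. *)

theory Defs
  imports
    "HOL-Analysis.Analysis"
    "Jordan_Normal_Form.Matrix"
    "Jordan_Normal_Form.Gauss_Jordan_Elimination"
    "Jordan_Normal_Form.DL_Rank"
begin

text \<open>
  Matrices and coefficient vectors are those of Jordan_Normal_Form, because their dimensions vary
  with the mesh and the final constants must not. Points of the plane are
  elements of \<open>real ^ 2\<close>; to keep \<open>$\<close> and \<open>\<bullet>\<close> for coefficient vectors, the
  Euclidean inner product of points is written \<open>inner\<close>.
\<close>

unbundle no vec_syntax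
unbundle no inner_syntax

type_synonym pt = "real ^ 2"

text \<open>The condition \<open>interior (closure S) = S\<close> excludes slits.\<close>

definition polygonal_domain :: "pt set \<Rightarrow> bool" where
  "polygonal_domain S \<longleftrightarrow> S \<noteq> {} \<and> open S \<and> connected S \<and> bounded S \<and> interior (closure S) = S \<and>
     (\<exists>\<P>. finite \<P> \<and> (\<forall>P\<in>\<P>. polytope P) \<and> closure S = \<Union>\<P>)"

definition triangular_mesh :: "pt set \<Rightarrow> pt set set \<Rightarrow> bool" where
  "triangular_mesh S \<T> \<longleftrightarrow> triangulation \<T> \<and> (\<forall>T\<in>\<T>. 2 simplex T) \<and> \<Union>\<T> = closure S"

text \<open>
  Shape regularity and characteristic size \<open>h\<close> in one condition: every triangle contains a disc of
  radius \<open>h / \<sigma>\<close> and has diameter at most \<open>\<sigma> h\<close>.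
\<close>

definition shape_regular :: "real \<Rightarrow> real \<Rightarrow> pt set set \<Rightarrow> bool" where
  "shape_regular \<sigma> h \<T> \<longleftrightarrow> (\<forall>T\<in>\<T>. diameter T \<le> \<sigma> * h \<and> (\<exists>z. cball z (h / \<sigma>) \<subseteq> T))"

definition mesh_nodes :: "pt set set \<Rightarrow> pt set" where
  "mesh_nodes \<T> = {x. \<exists>T\<in>\<T>. x extreme_point_of T}"

text \<open>
  Each triangle is split into its three corner triangles and its medial triangle. For a mesh of
  2-simplices the points \<open>a\<close>, \<open>b\<close>, \<open>c\<close> below are necessarily the three vertices of a triangle.
\<close>

definition midpoint_refinement :: "pt set set \<Rightarrow> pt set set" where
  "midpoint_refinement \<T> =
     {convex hull {a, midpoint a b, midpoint a c} | a b c. convex hull {a, b, c} \<in> \<T>} \<union>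
     {convex hull {midpoint a b, midpoint b c, midpoint c a} | a b c. convex hull {a, b, c} \<in> \<T>}"

definition P1_functions :: "pt set set \<Rightarrow> (pt \<Rightarrow> real) set" where
  "P1_functions \<T> = {f. continuous_on (\<Union>\<T>) f \<and>
     (\<forall>T\<in>\<T>. \<exists>a b. \<forall>y\<in>T. f y = inner a y + b)}"

text \<open>These conditions determine \<open>\<phi> x\<close> on the closed domain; values elsewhere are never used.\<close>

definition nodal_basis :: "pt set set \<Rightarrow> (pt \<Rightarrow> pt \<Rightarrow> real) \<Rightarrow> bool" where
  "nodal_basis \<T> \<phi> \<longleftrightarrow> (\<forall>x\<in>mesh_nodes \<T>. \<phi> x \<in> P1_functions \<T> \<and>
     (\<forall>y\<in>mesh_nodes \<T>. \<phi> x y = (if y = x then 1 else 0)))"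

text \<open>
  The forms are only applied to piecewise linear functions. These are differentiable away from the
  mesh edges, and the edges are a null set.
\<close>

definition grad_product :: "(pt \<Rightarrow> pt) \<Rightarrow> (pt \<Rightarrow> pt) \<Rightarrow> pt \<Rightarrow> real" where
  "grad_product u v y =
     (\<Sum>e\<in>Basis. inner (frechet_derivative u (at y) e) (frechet_derivative v (at y) e))"

definition divergence :: "(pt \<Rightarrow> pt) \<Rightarrow> pt \<Rightarrow> real" where
  "divergence u y = (\<Sum>e\<in>Basis. inner (frechet_derivative u (at y) e) e)"

definition form_a :: "pt set \<Rightarrow> (pt \<Rightarrow> pt) \<Rightarrow> (pt \<Rightarrow> pt) \<Rightarrow> real" where
  "form_a S u v = set_lebesgue_integral lebesgue S (grad_product u v)"

definition form_b :: "pt set \<Rightarrow> (pt \<Rightarrow> pt) \<Rightarrow> (pt \<Rightarrow> real) \<Rightarrow> real" where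
  "form_b S u q = - set_lebesgue_integral lebesgue S (\<lambda>y. divergence u y * q y)"

text \<open>
  A velocity degree of freedom is a pair of a node of the refined mesh and a coordinate direction
  in \<open>Basis\<close>; the lists fix an ordering of the degrees of freedom.

  The interface velocity space has a basis given by the columns of \<open>Tr\<close> with respect to the nodal
  interface basis. Columns \<open>0..<nPi\<close> are the primal basis functions and the others are the dual ones.
  The primal degrees of freedom are the coordinate functionals of the primal
  columns, so the dual basis functions vanish at them. The identity columns at subdomain vertices
  give vertex primal variables; a column of positive weights on an edge, accompanied by dual columns
  of vanishing average, gives an edge primal variable.

  An entry \<open>(i, k)\<close> of \<open>dDelta\<close> is the copy of the dual degree of freedom \<open>k\<close> in subdomain \<open>i\<close>.
\<close>

record fetidp =
  Omega :: "pt set"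
  Mesh :: "pt set set"
  hmesh :: real
  nsub :: nat
  Sub :: "nat \<Rightarrow> pt set"
  Hsub :: real
  vbasis :: "pt \<Rightarrow> pt \<Rightarrow> real"
  pbasis :: "pt \<Rightarrow> pt \<Rightarrow> real"
  vI :: "(pt \<times> pt) list"
  vGamma :: "(pt \<times> pt) list"
  pI :: "pt list"
  pGamma :: "pt list"
  Tr :: "real mat"
  nPi :: nat
  dDelta :: "(nat \<times> nat) list"
  BDelta :: "real mat"

definition Interface :: "fetidp \<Rightarrow> pt set" where
  "Interface d = (\<Union>i<nsub d. frontier (Sub d i)) - frontier (Omega d)"

definition sharing :: "fetidp \<Rightarrow> pt \<Rightarrow> nat set" where
  "sharing d x = {i. i < nsub d \<and> x \<in> closure (Sub d i)}"

definition vfun :: "fetidp \<Rightarrow> pt \<times> pt \<Rightarrow> pt \<Rightarrow> pt" where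
  "vfun d z = (\<lambda>y. vbasis d (fst z) y *\<^sub>R snd z)"

definition interface_fun :: "fetidp \<Rightarrow> nat \<Rightarrow> pt \<Rightarrow> pt" where
  "interface_fun d k = (\<lambda>y. \<Sum>g<length (vGamma d). (Tr d $$ (g, k)) *\<^sub>R vfun d (vGamma d ! g) y)"

definition dof_nodes :: "fetidp \<Rightarrow> nat \<Rightarrow> pt set" where
  "dof_nodes d k = {fst (vGamma d ! g) | g. g < length (vGamma d) \<and> Tr d $$ (g, k) \<noteq> 0}"

definition dof_sharing :: "fetidp \<Rightarrow> nat \<Rightarrow> nat set" where
  "dof_sharing d k = (\<Union>x\<in>dof_nodes d k. sharing d x)"

definition A_mat :: "fetidp \<Rightarrow> real mat" where
  "A_mat d = (let V = vI d @ vGamma d in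
     mat (length V) (length V) (\<lambda>(r, c). form_a (Omega d) (vfun d (V ! r)) (vfun d (V ! c))))"

definition B_mat :: "fetidp \<Rightarrow> real mat" where
  "B_mat d = (let V = vI d @ vGamma d; P = pI d @ pGamma d in
     mat (length P) (length V) (\<lambda>(r, c). form_b (Omega d) (vfun d (V ! c)) (pbasis d (P ! r))))"

definition Z_mat :: "fetidp \<Rightarrow> real mat" where
  "Z_mat d = (let P = pI d @ pGamma d in
     mat (length P) (length P) (\<lambda>(r, c).
       set_lebesgue_integral lebesgue (Omega d) (\<lambda>y. pbasis d (P ! r) y * pbasis d (P ! c) y)))"

definition pressure_fun :: "fetidp \<Rightarrow> real vec \<Rightarrow> pt \<Rightarrow> real" where
  "pressure_fun d q y = (let P = pI d @ pGamma d in \<Sum>r<length P. q $ r * pbasis d (P ! r) y)"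

definition zero_average :: "fetidp \<Rightarrow> real vec \<Rightarrow> bool" where
  "zero_average d q \<longleftrightarrow> set_lebesgue_integral lebesgue (Omega d) (pressure_fun d q) = 0"

text \<open>At \<open>w = 0\<close> the quotient is \<open>0 / 0 = 0\<close>, which does not change the supremum.\<close>

definition inf_sup :: "fetidp \<Rightarrow> real \<Rightarrow> bool" where
  "inf_sup d \<beta> \<longleftrightarrow> (\<forall>q\<in>carrier_vec (dim_row (B_mat d)). zero_average d q \<longrightarrow>
     (SUP w\<in>carrier_vec (dim_col (B_mat d)). (q \<bullet> (B_mat d *\<^sub>v w))\<^sup>2 / (w \<bullet> (A_mat d *\<^sub>v w)))
       \<ge> \<beta>\<^sup>2 * (q \<bullet> (Z_mat d *\<^sub>v q)))"

definition append_cols :: "real mat \<Rightarrow> real mat \<Rightarrow> real mat" (infixr \<open>@\<^sub>c\<close> 66) where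
  "A @\<^sub>c B = four_block_mat A B (0\<^sub>m 0 (dim_col A)) (0\<^sub>m 0 (dim_col B))"

text \<open>
  An element of the partially assembled velocity space is represented by the family of its
  restrictions to the subdomains, since a dual function is nonzero in one subdomain only.
\<close>

type_synonym broken = "nat \<Rightarrow> pt \<Rightarrow> pt"

definition fI :: "fetidp \<Rightarrow> broken list" where
  "fI d = map (\<lambda>z i. vfun d z) (vI d)"

definition fPi :: "fetidp \<Rightarrow> broken list" where
  "fPi d = map (\<lambda>k i. interface_fun d k) [0..<nPi d]"

definition fDelta :: "fetidp \<Rightarrow> broken list" where
  "fDelta d = map (\<lambda>(j, k) i. if i = j then interface_fun d k else (\<lambda>y. 0)) (dDelta d)"

definition blockA :: "fetidp \<Rightarrow> broken list \<Rightarrow> broken list \<Rightarrow> real mat" where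
  "blockA d U V = mat (length U) (length V)
     (\<lambda>(r, c). \<Sum>i<nsub d. form_a (Sub d i) ((U ! r) i) ((V ! c) i))"

definition blockB :: "fetidp \<Rightarrow> pt list \<Rightarrow> broken list \<Rightarrow> real mat" where
  "blockB d P V = mat (length P) (length V)
     (\<lambda>(r, c). \<Sum>i<nsub d. form_b (Sub d i) ((V ! c) i) (pbasis d (P ! r)))"

definition nVI :: "fetidp \<Rightarrow> nat" where "nVI d = length (vI d)"
definition nPI :: "fetidp \<Rightarrow> nat" where "nPI d = length (pI d)"
definition nDelta :: "fetidp \<Rightarrow> nat" where "nDelta d = length (dDelta d)"
definition nPGamma :: "fetidp \<Rightarrow> nat" where "nPGamma d = length (pGamma d)"
definition nLambda :: "fetidp \<Rightarrow> nat" where "nLambda d = dim_row (BDelta d)"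
definition nW :: "fetidp \<Rightarrow> nat" where "nW d = nVI d + nPI d + nDelta d + nPi d"

text \<open>Since \<open>BDelta d\<close> has full row rank, its range is the whole coordinate space.\<close>

definition nX :: "fetidp \<Rightarrow> nat" where "nX d = nPGamma d + nLambda d"

definition A_tilde :: "fetidp \<Rightarrow> real mat" where
  "A_tilde d =
     (let I = fI d; D = fDelta d; P = fPi d;
          B_II = blockB d (pI d) I; B_ID = blockB d (pI d) D; B_IP = blockB d (pI d) P in
        (blockA d I I @\<^sub>c transpose_mat B_II @\<^sub>c blockA d I D @\<^sub>c blockA d I P)
     @\<^sub>r (B_II @\<^sub>c 0\<^sub>m (nPI d) (nPI d) @\<^sub>c B_ID @\<^sub>c B_IP)
     @\<^sub>r (blockA d D I @\<^sub>c transpose_mat B_ID @\<^sub>c blockA d D D @\<^sub>c blockA d D P)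
     @\<^sub>r (blockA d P I @\<^sub>c transpose_mat B_IP @\<^sub>c blockA d P D @\<^sub>c blockA d P P))"

definition B_C :: "fetidp \<Rightarrow> real mat" where
  "B_C d =
        (blockB d (pGamma d) (fI d) @\<^sub>c 0\<^sub>m (nPGamma d) (nPI d)
           @\<^sub>c blockB d (pGamma d) (fDelta d) @\<^sub>c blockB d (pGamma d) (fPi d))
     @\<^sub>r (0\<^sub>m (nLambda d) (nVI d) @\<^sub>c 0\<^sub>m (nLambda d) (nPI d)
           @\<^sub>c BDelta d @\<^sub>c 0\<^sub>m (nLambda d) (nPi d))"

definition G_mat :: "fetidp \<Rightarrow> real mat" where
  "G_mat d = B_C d * the (mat_inverse (A_tilde d)) * transpose_mat (B_C d)"

definition W_tilde0 :: "fetidp \<Rightarrow> real vec set" where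
  "W_tilde0 d = {w \<in> carrier_vec (nW d).
     (blockB d (pI d) (fI d) @\<^sub>c 0\<^sub>m (nPI d) (nPI d)
        @\<^sub>c blockB d (pI d) (fDelta d) @\<^sub>c blockB d (pI d) (fPi d)) *\<^sub>v w = 0\<^sub>v (nPI d)}"

definition R_Delta :: "fetidp \<Rightarrow> real mat" where
  "R_Delta d = 0\<^sub>m (nDelta d) (nVI d) @\<^sub>c 0\<^sub>m (nDelta d) (nPI d)
     @\<^sub>c 1\<^sub>m (nDelta d) @\<^sub>c 0\<^sub>m (nDelta d) (nPi d)"

text \<open>
  All nodes of a dual degree of freedom are shared by the same subdomains (see \<open>decomposition_dofs\<close>),
  so the scaling by the number of subdomains sharing the node depends on the column only.
\<close>

definition B_Delta_D :: "fetidp \<Rightarrow> real mat" where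
  "B_Delta_D d = mat (nLambda d) (nDelta d)
     (\<lambda>(r, c). BDelta d $$ (r, c) / real (card (dof_sharing d (snd (dDelta d ! c)))))"

definition P_D :: "fetidp \<Rightarrow> real mat" where
  "P_D d = transpose_mat (R_Delta d) * transpose_mat (B_Delta_D d) * BDelta d * R_Delta d"

definition jump_estimate :: "fetidp \<Rightarrow> real \<Rightarrow> bool" where
  "jump_estimate d \<Phi> \<longleftrightarrow> (\<forall>w\<in>W_tilde0 d.
     (P_D d *\<^sub>v w) \<bullet> (A_tilde d *\<^sub>v (P_D d *\<^sub>v w)) \<le> \<Phi> * (w \<bullet> (A_tilde d *\<^sub>v w)))"

definition M_lambda_inv :: "fetidp \<Rightarrow> real mat" where
  "M_lambda_inv d = B_Delta_D d * R_Delta d * A_tilde d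
     * transpose_mat (R_Delta d) * transpose_mat (B_Delta_D d)"

definition M_inv :: "fetidp \<Rightarrow> real mat" where
  "M_inv d = four_block_mat
     ((1 / (hmesh d)\<^sup>2) \<cdot>\<^sub>m 1\<^sub>m (nPGamma d)) (0\<^sub>m (nPGamma d) (nLambda d))
     (0\<^sub>m (nLambda d) (nPGamma d)) (M_lambda_inv d)"

definition M_mat :: "fetidp \<Rightarrow> real mat" where
  "M_mat d = the (mat_inverse (M_inv d))"

definition range_MinvG :: "fetidp \<Rightarrow> real vec set" where
  "range_MinvG d = {(M_inv d * G_mat d) *\<^sub>v z | z. z \<in> carrier_vec (nX d)}"

text \<open>
  All subdomains are unions of triangles of one conforming mesh, so nodes match
  across the interface. The mesh is finite; no bound on the number of triangles in a subdomain
  is imposed, so constants valid for all such decompositions do not depend on one.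
\<close>

definition decomposition :: "real \<Rightarrow> fetidp \<Rightarrow> bool" where
  "decomposition \<kappa> d \<longleftrightarrow>
     (\<forall>i<nsub d. polygonal_domain (Sub d i) \<and> Sub d i \<subseteq> Omega d \<and>
        closure (Sub d i) = \<Union>{T \<in> Mesh d. T \<subseteq> closure (Sub d i)} \<and>
        Hsub d / \<kappa> \<le> diameter (Sub d i) \<and> diameter (Sub d i) \<le> \<kappa> * Hsub d) \<and>
     (\<forall>i<nsub d. \<forall>j<nsub d. i \<noteq> j \<longrightarrow> Sub d i \<inter> Sub d j = {}) \<and>
     closure (Omega d) = (\<Union>i<nsub d. closure (Sub d i))"

text \<open>
  Velocity nodes on the boundary of the domain carry no degree of freedom. The interface pressure
  nodes are those shared by several closed subdomains; this includes the points where the interface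
  meets the boundary of the domain, where the pressure is also shared.
\<close>

definition decomposition_dofs :: "fetidp \<Rightarrow> bool" where
  "decomposition_dofs d \<longleftrightarrow>
     (let VN = mesh_nodes (midpoint_refinement (Mesh d)) \<inter> Omega d; PN = mesh_nodes (Mesh d);
          nG = length (vGamma d) in
        nodal_basis (midpoint_refinement (Mesh d)) (vbasis d) \<and> nodal_basis (Mesh d) (pbasis d) \<and>
        distinct (vI d) \<and> set (vI d) = (VN - Interface d) \<times> Basis \<and>
        distinct (vGamma d) \<and> set (vGamma d) = (VN \<inter> Interface d) \<times> Basis \<and>
        distinct (pI d) \<and> set (pI d) = {x \<in> PN. card (sharing d x) < 2} \<and>
        distinct (pGamma d) \<and> set (pGamma d) = {x \<in> PN. card (sharing d x) \<ge> 2} \<and>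
        Tr d \<in> carrier_mat nG nG \<and> invertible_mat (Tr d) \<and> nPi d \<le> nG \<and>
        (\<forall>k\<in>{nPi d..<nG}. \<forall>x\<in>dof_nodes d k. \<forall>y\<in>dof_nodes d k. sharing d x = sharing d y) \<and>
        distinct (dDelta d) \<and> set (dDelta d) = {(i, k). nPi d \<le> k \<and> k < nG \<and> i \<in> dof_sharing d k})"

definition jump_matrix :: "fetidp \<Rightarrow> bool" where
  "jump_matrix d \<longleftrightarrow>
     dim_col (BDelta d) = nDelta d \<and>
     (\<forall>r<nLambda d. \<exists>c<nDelta d. \<exists>c'<nDelta d. c \<noteq> c' \<and> snd (dDelta d ! c) = snd (dDelta d ! c') \<and>
        BDelta d $$ (r, c) = 1 \<and> BDelta d $$ (r, c') = - 1 \<and>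
        (\<forall>j<nDelta d. j \<noteq> c \<and> j \<noteq> c' \<longrightarrow> BDelta d $$ (r, j) = 0)) \<and>
     (\<forall>w\<in>carrier_vec (nDelta d). BDelta d *\<^sub>v w = 0\<^sub>v (nLambda d) \<longleftrightarrow>
        (\<forall>c<nDelta d. \<forall>c'<nDelta d. snd (dDelta d ! c) = snd (dDelta d ! c') \<longrightarrow> w $ c = w $ c')) \<and>
     vec_space.rank (nLambda d) (BDelta d) = nLambda d \<and>
     BDelta d * transpose_mat (B_Delta_D d) = 1\<^sub>m (nLambda d)"

definition mass_matrix_bounds :: "real \<Rightarrow> real \<Rightarrow> fetidp \<Rightarrow> bool" where
  "mass_matrix_bounds cZ CZ d \<longleftrightarrow> (\<forall>q\<in>carrier_vec (dim_row (Z_mat d)).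
     cZ * (hmesh d)\<^sup>2 * (q \<bullet> q) \<le> q \<bullet> (Z_mat d *\<^sub>v q) \<and>
     q \<bullet> (Z_mat d *\<^sub>v q) \<le> CZ * (hmesh d)\<^sup>2 * (q \<bullet> q))"

text \<open>In nodal values, the constant pressures are the vectors with equal entries.\<close>

definition kernel_constants :: "fetidp \<Rightarrow> bool" where
  "kernel_constants d \<longleftrightarrow>
     {q \<in> carrier_vec (dim_row (B_mat d)). transpose_mat (B_mat d) *\<^sub>v q = 0\<^sub>v (dim_col (B_mat d))}
       = {vec (dim_row (B_mat d)) (\<lambda>_. c) | c. True}"

definition fetidp_setting :: "pt set \<Rightarrow> real \<Rightarrow> real \<Rightarrow> real \<Rightarrow> real \<Rightarrow> fetidp \<Rightarrow> bool" where
  "fetidp_setting \<Omega> \<sigma> \<kappa> cZ CZ d \<longleftrightarrow>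
     Omega d = \<Omega> \<and> 0 < hmesh d \<and> hmesh d \<le> Hsub d \<and>
     triangular_mesh \<Omega> (Mesh d) \<and> shape_regular \<sigma> (hmesh d) (Mesh d) \<and>
     decomposition \<kappa> d \<and> decomposition_dofs d \<and> jump_matrix d \<and>
     mass_matrix_bounds cZ CZ d \<and> kernel_constants d \<and> invertible_mat (A_tilde d)"

end

theory Submission
  imports Defs
begin

text \<open>
  Let \<open>|w|\<close> be the broken \<open>H\<^sup>1\<close> seminorm, so that \<open>\<langle>w, w\<rangle> = |w|\<^sup>2\<close> in the \<open>A_tilde\<close> inner product on
  \<open>W_tilde0\<close>, and let \<open>w\<^sub>x = A_tilde\<^sup>-\<^sup>1 B_C\<^sup>T x\<close>, an element of \<open>W_tilde0\<close> with \<open>\<langle>G x, x\<rangle> = |w\<^sub>x|\<^sup>2\<close>.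

  Upper bound: \<open>\<langle>M\<^sup>-\<^sup>1 B_C w, B_C w\<rangle>\<close> is \<open>h\<^sup>-\<^sup>2\<close> times the square of the interface divergence, bounded by
  the pointwise estimate \<open>(div u)\<^sup>2 \<le> 2 |grad u|\<^sup>2\<close> and the mass matrix, plus the energy of \<open>P_D w\<close>,
  bounded by the jump estimate. Cauchy-Schwarz in the \<open>M\<close> inner product concludes.

  Lower bound: for \<open>y = M x\<close> in the range of \<open>G\<close> it suffices to find \<open>w\<close> in \<open>W_tilde0\<close> with \<open>B_C w = y\<close> and
  \<open>|w|\<^sup>2 \<le> C \<beta>\<^sup>-\<^sup>2 \<langle>M\<^sup>-\<^sup>1 y, y\<rangle>\<close>. The dual lift of the multiplier part of \<open>y\<close> has the right jump. The
  remaining divergence is attained by a continuous velocity because \<open>y\<close> is in the range of \<open>G\<close>, and the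
  inf-sup condition selects such a velocity of small energy. The same condition forces \<open>\<beta>\<^sup>2 \<le> 2\<close>, which
  absorbs the energy of the lift.
\<close>

section \<open>Forms of piecewise affine functions\<close>

text \<open>If \<open>x = M\<^sup>-\<^sup>1 G z\<close>, then \<open>M x = G z = B_C w\<close> for
  the solution \<open>w\<close> in \<open>W_tilde0\<close> that belongs to \<open>z\<close>. The
  range condition thus supplies a velocity with the right constraint values, but without control of
  its energy. Subtracting the dual lift of its jump leaves a velocity without jumps, hence a
  conforming one, and only there does the global inf-sup condition apply: it bounds the velocity of
  least energy with the same divergence. Constant pressures lie in the kernel of the transposed
  divergence, so this velocity solves a singular saddle point system, whose multiplier must be
  normalised to zero average before inf-sup can be used on it. \<open>A_tilde\<close> is a saddle
  point matrix, so Cauchy-Schwarz for it is confined to \<open>W_tilde0\<close>; elsewhere the Gram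
  matrix \<open>energy_mat\<close> measures velocities. The constants come from the dimension 2 in
  the pointwise divergence estimate, from \<open>cZ\<close> and \<open>CZ\<close>, and from
  splitting squares of sums. The upper constant is first \<open>2 * CZ + \<Phi>\<close>.\<close>

definition affine_on :: "pt set \<Rightarrow> (pt \<Rightarrow> 'b::real_normed_vector) \<Rightarrow> bool" where
  "affine_on T f \<longleftrightarrow> (\<exists>L c. linear L \<and> (\<forall>y\<in>T. f y = L y + c))"

lemma affine_on_inner: "affine_on T (f :: pt \<Rightarrow> real)" if "\<forall>y\<in>T. f y = inner a y + b"
  unfolding affine_on_def using that bounded_linear.linear[OF bounded_linear_inner_right] by blast

lemma affine_on_scaleR_right:
  assumes "affine_on T (f :: pt \<Rightarrow> real)"
  shows "affine_on T (\<lambda>y. f y *\<^sub>R (e :: 'b::real_normed_vector))"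
proof -
  obtain L c where L: "linear L" "\<forall>y\<in>T. f y = L y + c"
    using assms unfolding affine_on_def by blast
  have "linear (\<lambda>y. L y *\<^sub>R e)"
    by (rule linearI) (simp_all add: linear_add[OF L(1)] linear_scale[OF L(1)] scaleR_add_left)
  then show ?thesis
    unfolding affine_on_def using L(2) by (intro exI[of _ "\<lambda>y. L y *\<^sub>R e"] exI[of _ "c *\<^sub>R e"]) (auto simp: scaleR_add_left)
qed

lemma affine_on_sum:
  assumes "\<And>r. r \<in> I \<Longrightarrow> affine_on T (F r)"
  shows "affine_on T (\<lambda>y. \<Sum>r\<in>I. w r *\<^sub>R F r y)"
proof -
  have "\<forall>r. \<exists>L c. r \<in> I \<longrightarrow> linear L \<and> (\<forall>y\<in>T. F r y = L y + c)"
    using assms unfolding affine_on_def by metis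
  then obtain L c where L: "\<And>r. r \<in> I \<Longrightarrow> linear (L r)" "\<And>r y. r \<in> I \<Longrightarrow> y \<in> T \<Longrightarrow> F r y = L r y + c r"
    by metis
  have "linear (\<lambda>y. \<Sum>r\<in>I. w r *\<^sub>R L r y)"
    by (intro linear_compose_sum ballI linear_compose_scale_right L(1))
  moreover have "\<forall>y\<in>T. (\<Sum>r\<in>I. w r *\<^sub>R F r y) = (\<Sum>r\<in>I. w r *\<^sub>R L r y) + (\<Sum>r\<in>I. w r *\<^sub>R c r)"
    by (simp add: L(2) scaleR_add_right sum.distrib)
  ultimately show ?thesis unfolding affine_on_def by blast
qed

lemma affine_on_zero: "affine_on T (\<lambda>y. 0)"
  unfolding affine_on_def by (intro exI[of _ "\<lambda>y. 0"] exI[of _ 0]) (auto simp: module_hom_zero)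

text \<open>The points where the linear part has the required value form a convex set. It contains
  the extreme points, and by Krein-Milman these span \<open>T\<close>.\<close>

lemma affine_on_eq_const:
  assumes "affine_on T f" "compact T" "convex T" "\<And>x. x extreme_point_of T \<Longrightarrow> f x = k" "y \<in> T"
  shows "f y = k"
proof -
  obtain L c where L: "linear L" "\<And>y. y \<in> T \<Longrightarrow> f y = L y + c"
    using assms(1) unfolding affine_on_def by blast
  have T: "T = convex hull {x. x extreme_point_of T}"
    by (rule Krein_Milman_Minkowski[OF assms(2,3)])
  have "convex (L -` {k - c})"
    by (rule convex_linear_vimage[OF L(1)]) simp
  moreover have "L x + c = k" if "x extreme_point_of T" for x
    using assms(4)[OF that] L(2)[of x] that by (auto simp: extreme_point_of_def)
  then have "{x. x extreme_point_of T} \<subseteq> L -` {k - c}"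
    by (auto simp: algebra_simps eq_diff_eq)
  ultimately have "T \<subseteq> L -` {k - c}"
    using T hull_minimal[of "{x. x extreme_point_of T}" "L -` {k - c}" convex] by simp
  then show ?thesis using assms(5) L(2) by (auto simp: algebra_simps)
qed

lemma affine_on_derivative:
  assumes "affine_on T f"
  obtains L where "\<And>y. y \<in> interior T \<Longrightarrow> (f has_derivative L) (at y)"
proof -
  obtain L c where L: "linear L" "\<And>y. y \<in> T \<Longrightarrow> f y = L y + c"
    using assms unfolding affine_on_def by blast
  have "(f has_derivative L) (at y)" if "y \<in> interior T" for y
  proof -
    have "((\<lambda>y. L y + c) has_derivative L) (at y)"
      using linear_imp_has_derivative[OF L(1)] by (auto intro!: derivative_eq_intros)
    then show ?thesis
      by (rule has_derivative_transform_within_open[OF _ open_interior that])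
        (use L(2) interior_subset in fastforce)
  qed
  then show thesis using that by blast
qed

lemma frechet_derivative_eqI: "(f has_derivative L) (at y) \<Longrightarrow> frechet_derivative f (at y) = L"
  using frechet_derivative_at by metis

lemma affine_on_frechet_const:
  assumes "affine_on T f"
  shows "\<exists>L. \<forall>y\<in>interior T. frechet_derivative f (at y) = L"
proof -
  obtain L where "\<And>y. y \<in> interior T \<Longrightarrow> (f has_derivative L) (at y)"
    by (rule affine_on_derivative[OF assms]) blast
  then show ?thesis
    by (intro exI[of _ L] ballI frechet_derivative_eqI)
qed

text \<open>On an open set the derivative at a point depends only on values in the set. Hence two
  functions may be exchanged in a form over a subdomain even if they differ outside it.\<close>

lemma form_cong:
  assumes "open S" "\<And>y. y \<in> S \<Longrightarrow> u y = u' y" "\<And>y. y \<in> S \<Longrightarrow> v y = v' y"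
  shows "form_a S u v = form_a S u' v'"
    and "(\<And>y. y \<in> S \<Longrightarrow> q y = q' y) \<Longrightarrow> form_b S u q = form_b S u' q'"
proof -
  have fd: "frechet_derivative f (at y) = frechet_derivative g (at y)"
    if "y \<in> S" "\<And>y. y \<in> S \<Longrightarrow> f y = g y" for f g :: "pt \<Rightarrow> pt" and y
  proof -
    have "(f has_derivative L) (at y) \<longleftrightarrow> (g has_derivative L) (at y)" for L
      using has_derivative_transform_within_open[OF _ assms(1) that(1), of f L UNIV g]
        has_derivative_transform_within_open[OF _ assms(1) that(1), of g L UNIV f] that(2)
      by auto
    then show ?thesis unfolding frechet_derivative_def by simp
  qed
  have "grad_product u v y = grad_product u' v' y" if "y \<in> S" for y
    unfolding grad_product_def by (simp only: fd[OF that assms(2)] fd[OF that assms(3)])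
  then show "form_a S u v = form_a S u' v'"
    unfolding form_a_def by (intro set_lebesgue_integral_cong) (auto simp: assms(1) borel_open)
  have "divergence u y = divergence u' y" if "y \<in> S" for y
    unfolding divergence_def by (simp only: fd[OF that assms(2)])
  then show "form_b S u q = form_b S u' q'" if "\<And>y. y \<in> S \<Longrightarrow> q y = q' y"
    unfolding form_b_def using that
    by (intro arg_cong[where f=uminus] set_lebesgue_integral_cong) (auto simp: assms(1) borel_open)
qed

text \<open>The open pieces may leave a null set uncovered. The argument passes to the gauge
  integral, for which finite unions and null differences of domains are available, and returns by
  absolute integrability.\<close>

lemma integral_partition:
  fixes f :: "pt \<Rightarrow> real"
  assumes "f absolutely_integrable_on \<Omega>" "finite I" "\<And>i. i \<in> I \<Longrightarrow> open (S i)" "\<And>i. i \<in> I \<Longrightarrow> S i \<subseteq> \<Omega>"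
    and "\<And>i j. i \<in> I \<Longrightarrow> j \<in> I \<Longrightarrow> i \<noteq> j \<Longrightarrow> S i \<inter> S j = {}"
    and "negligible (\<Omega> - \<Union>(S ` I))"
  shows "set_lebesgue_integral lebesgue \<Omega> f = (\<Sum>i\<in>I. set_lebesgue_integral lebesgue (S i) f)"
proof -
  have ai: "f absolutely_integrable_on S i" if "i \<in> I" for i
    by (rule set_integrable_subset[OF assms(1)]) (use assms(3,4) that in \<open>auto simp: borel_open\<close>)
  have "(f has_integral (\<Sum>i\<in>I. integral (S i) f)) (\<Union>(S ` I))"
  proof (rule has_integral_UN[OF assms(2)])
    show "(f has_integral integral (S i) f) (S i)" if "i \<in> I" for i
      using ai[OF that] set_lebesgue_integral_eq_integral(1) by blast
    show "pairwise (\<lambda>i i'. negligible (S i \<inter> S i')) I"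
      using assms(5) by (auto simp: pairwise_def)
  qed
  then have "integral (\<Union>(S ` I)) f = (\<Sum>i\<in>I. integral (S i) f)" by blast
  moreover have "integral \<Omega> f = integral (\<Union>(S ` I)) f"
  proof (rule integral_spike_set)
    show "negligible {x \<in> \<Omega> - \<Union>(S ` I). f x \<noteq> 0}"
      by (rule negligible_subset[OF assms(6)]) auto
    have "{x \<in> \<Union>(S ` I) - \<Omega>. f x \<noteq> 0} = {}" using assms(4) by blast
    then show "negligible {x \<in> \<Union>(S ` I) - \<Omega>. f x \<noteq> 0}" by (simp only: negligible_empty)
  qed
  moreover have "(\<Sum>i\<in>I. set_lebesgue_integral lebesgue (S i) f) = (\<Sum>i\<in>I. integral (S i) f)"
    by (intro sum.cong refl set_lebesgue_integral_eq_integral(2) ai)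
  ultimately show ?thesis
    using set_lebesgue_integral_eq_integral(2)[OF assms(1)] by simp
qed

text \<open>Convexity makes the cell frontiers null sets and compactness makes continuous functions
  integrable on cells. The midpoint refinement qualifies without a proof that its cells meet face to
  face.\<close>

locale cell_cover =
  fixes \<T> :: "pt set set"
  assumes finite_cells: "finite \<T>"
    and convex_cell: "T \<in> \<T> \<Longrightarrow> convex T"
    and compact_cell: "T \<in> \<T> \<Longrightarrow> compact T"
begin

definition pw_affine :: "(pt \<Rightarrow> 'b::real_normed_vector) \<Rightarrow> bool" where
  "pw_affine f \<longleftrightarrow> (\<forall>T\<in>\<T>. affine_on T f)"

text \<open>The exceptional null set: at every other covered point a piecewise affine function is
  differentiable.\<close>

definition skeleton :: "pt set" where
  "skeleton = (\<Union>T\<in>\<T>. frontier T)"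

lemma negligible_skeleton: "negligible skeleton"
  unfolding skeleton_def using finite_cells convex_cell
  by (intro negligible_Union) (auto intro: negligible_convex_frontier)

lemma in_interior:
  assumes "y \<in> \<Union>\<T>" "y \<notin> skeleton"
  obtains T where "T \<in> \<T>" "y \<in> interior T"
proof -
  obtain T where T: "T \<in> \<T>" "y \<in> T" using assms(1) by blast
  then have "y \<in> interior T"
    using assms(2) closure_subset[of T] unfolding skeleton_def frontier_def by blast
  then show thesis using that T by blast
qed

lemma pw_affine_differentiable:
  "pw_affine f \<Longrightarrow> y \<in> \<Union>\<T> \<Longrightarrow> y \<notin> skeleton \<Longrightarrow> f differentiable (at y)"
  by (metis affine_on_derivative differentiable_def in_interior pw_affine_def)

lemma pw_affine_frechet_const:
  assumes "pw_affine u" "T \<in> \<T>"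
  obtains L where "\<And>y. y \<in> interior T \<Longrightarrow> frechet_derivative u (at y) = L"
  using affine_on_frechet_const[of T u] assms unfolding pw_affine_def by blast

lemma pw_affine_sum: "(\<And>r. r \<in> I \<Longrightarrow> pw_affine (F r)) \<Longrightarrow> pw_affine (\<lambda>y. \<Sum>r\<in>I. w r *\<^sub>R F r y)"
  unfolding pw_affine_def by (simp add: affine_on_sum)

lemma pw_affine_zero: "pw_affine (\<lambda>y. 0)"
  unfolding pw_affine_def by (simp add: affine_on_zero)

text \<open>\<open>frechet_derivative\<close> is defined by choice and need not be additive at a
  point without derivative. Linearity therefore holds off the skeleton only, and each integral
  identity below discards the skeleton as a null set.\<close>

lemma frechet_sum:
  assumes "finite I" "\<And>r. r \<in> I \<Longrightarrow> pw_affine (F r)" "y \<in> \<Union>\<T>" "y \<notin> skeleton"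
  shows "frechet_derivative (\<lambda>y. \<Sum>r\<in>I. w r *\<^sub>R F r y) (at y) e = (\<Sum>r\<in>I. w r *\<^sub>R frechet_derivative (F r) (at y) e)"
proof -
  have "(F r has_derivative frechet_derivative (F r) (at y)) (at y)" if "r \<in> I" for r
    using pw_affine_differentiable[OF assms(2)[OF that] assms(3,4)] frechet_derivative_works by blast
  then have "((\<lambda>y. \<Sum>r\<in>I. w r *\<^sub>R F r y) has_derivative (\<lambda>e. \<Sum>r\<in>I. w r *\<^sub>R frechet_derivative (F r) (at y) e)) (at y)"
    by (intro has_derivative_sum has_derivative_scaleR_right) auto
  from frechet_derivative_eqI[OF this] show ?thesis by simp
qed

text \<open>Nothing is known about \<open>g\<close> on the cell frontiers. Induction over the cells
  splits \<open>S\<close> into \<open>S \<inter> T\<close> and \<open>S - T\<close>, so overlaps of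
  cells need no care. Taking \<open>g\<close> or \<open>q\<close> constant yields the integrability
  of gradient products, of divergences times pressures and of products of pressures.\<close>

lemma integrable_const_times_continuous:
  fixes g q :: "pt \<Rightarrow> real"
  assumes "\<And>T. T \<in> \<T> \<Longrightarrow> \<exists>c. \<forall>y\<in>interior T. g y = c" "continuous_on (\<Union>\<T>) q"
    and "S \<in> sets lebesgue" "S \<subseteq> \<Union>\<T>"
  shows "(\<lambda>y. g y * q y) absolutely_integrable_on S"
proof -
  have "(\<lambda>y. g y * q y) absolutely_integrable_on S"
    if "finite \<U>" "\<U> \<subseteq> \<T>" "S \<in> sets lebesgue" "S \<subseteq> \<Union>\<U>" for \<U> S
    using that
  proof (induction \<U> arbitrary: S rule: finite_induct)
    case empty
    then show ?case by simp
  next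
    case (insert T \<U>)
    have TT: "T \<in> \<T>" using insert.prems by auto
    have cl: "T \<in> sets lebesgue"
      using compact_cell[OF TT] by (simp add: borel_compact)
    obtain c where c: "\<And>y. y \<in> interior T \<Longrightarrow> g y = c" using assms(1)[OF TT] by blast
    have "continuous_on T q" using assms(2) TT by (meson Union_upper continuous_on_subset)
    then have "integrable lborel (\<lambda>x. indicat_real T x *\<^sub>R q x)"
      using borel_integrable_compact compact_cell[OF TT] by blast
    then have "q absolutely_integrable_on T"
      by (simp add: set_integrable_def integrable_completion borel_measurable_integrable)
    then have "(\<lambda>y. c * q y) absolutely_integrable_on T"
      by (rule set_integrable_mult_right)
    then have "(\<lambda>y. g y * q y) absolutely_integrable_on T"
    proof (rule absolutely_integrable_spike)
      show "negligible (frontier T)" using convex_cell[OF TT] negligible_convex_frontier by blast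
      show "g x * q x = c * q x" if "x \<in> T - frontier T" for x
        using that c[of x] closure_subset[of T] unfolding frontier_def by auto
    qed
    then have 1: "(\<lambda>y. g y * q y) absolutely_integrable_on (S \<inter> T)"
      by (rule set_integrable_subset) (use insert.prems cl in auto)
    have 2: "(\<lambda>y. g y * q y) absolutely_integrable_on (S - T)"
      by (rule insert.IH) (use insert.prems cl in auto)
    have "(\<lambda>y. g y * q y) absolutely_integrable_on ((S \<inter> T) \<union> (S - T))"
      by (rule set_integrable_Un[OF 1 2]) (use insert.prems cl in auto)
    moreover have "(S \<inter> T) \<union> (S - T) = S" by blast
    ultimately show ?case by simp
  qed
  from this[OF finite_cells subset_refl assms(3,4)] show ?thesis .
qed

section \<open>Linearity, positivity and divergence bound of the forms on a measurable set\<close>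

context
  fixes S :: "pt set"
  assumes S: "S \<in> sets lebesgue" "S \<subseteq> \<Union>\<T>"
begin

lemma pressure_integrable:
  assumes "continuous_on (\<Union>\<T>) q" "continuous_on (\<Union>\<T>) q'"
  shows "(q :: pt \<Rightarrow> real) absolutely_integrable_on S" "(\<lambda>y. q y * q' y) absolutely_integrable_on S"
proof -
  show "q absolutely_integrable_on S"
    using integrable_const_times_continuous[OF _ assms(1) S, of "\<lambda>y. 1"]  by simp
  show "(\<lambda>y. q y * q' y) absolutely_integrable_on S"
    using integrable_const_times_continuous[OF _ continuous_on_mult[OF assms] S, of "\<lambda>y. 1"]
    by simp
qed

lemma grad_product_integrable:
  assumes "pw_affine u" "pw_affine v"
  shows "grad_product u v absolutely_integrable_on S"
proof -
  have "\<exists>c. \<forall>y\<in>interior T. grad_product u v y = c" if T: "T \<in> \<T>" for T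
  proof -
    obtain L where "\<And>y. y \<in> interior T \<Longrightarrow> frechet_derivative u (at y) = L"
      by (rule pw_affine_frechet_const[OF assms(1) T]) blast
    moreover obtain M where "\<And>y. y \<in> interior T \<Longrightarrow> frechet_derivative v (at y) = M"
      by (rule pw_affine_frechet_const[OF assms(2) T]) blast
    ultimately show ?thesis unfolding grad_product_def by simp
  qed
  from integrable_const_times_continuous[OF this continuous_on_const S, of 1] show ?thesis by simp
qed

lemma divergence_integrable:
  assumes "pw_affine u" "continuous_on (\<Union>\<T>) q"
  shows "(\<lambda>y. divergence u y * q y) absolutely_integrable_on S"
proof -
  have "\<exists>c. \<forall>y\<in>interior T. divergence u y = c" if T: "T \<in> \<T>" for T
  proof -
    obtain L where "\<And>y. y \<in> interior T \<Longrightarrow> frechet_derivative u (at y) = L"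
      by (rule pw_affine_frechet_const[OF assms(1) T]) blast
    then show ?thesis unfolding divergence_def by simp
  qed
  from integrable_const_times_continuous[OF this assms(2) S] show ?thesis by simp
qed

lemma form_a_commute: "form_a S u v = form_a S v u"
  unfolding form_a_def grad_product_def by (simp add: inner_commute)

lemma form_a_sum:
  assumes "finite I" "\<And>r. r \<in> I \<Longrightarrow> pw_affine (F r)" "pw_affine v"
  shows "form_a S (\<lambda>y. \<Sum>r\<in>I. w r *\<^sub>R F r y) v = (\<Sum>r\<in>I. w r * form_a S (F r) v)"
proof -
  have u: "pw_affine (\<lambda>y. \<Sum>r\<in>I. w r *\<^sub>R F r y)" using assms(2) by (rule pw_affine_sum)
  have "grad_product (\<lambda>y. \<Sum>r\<in>I. w r *\<^sub>R F r y) v y = (\<Sum>r\<in>I. w r * grad_product (F r) v y)"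
    if "y \<in> S - skeleton" for y
    using that S(2) unfolding grad_product_def
    by (subst frechet_sum[OF assms(1,2)])
       (auto simp: inner_sum_left sum_distrib_left intro: sum.swap)
  then have "integral S (grad_product (\<lambda>y. \<Sum>r\<in>I. w r *\<^sub>R F r y) v) = integral S (\<lambda>y. \<Sum>r\<in>I. w r * grad_product (F r) v y)"
    by (intro integral_spike[OF negligible_skeleton]) auto
  also have "\<dots> = (\<Sum>r\<in>I. w r * integral S (grad_product (F r) v))"
    using assms set_lebesgue_integral_eq_integral(1)[OF grad_product_integrable]
    by (subst integral_sum) (auto intro!: integrable_on_mult_right)
  finally show ?thesis
    unfolding form_a_def using u assms
    by (simp add: set_lebesgue_integral_eq_integral(2) grad_product_integrable)
qed

lemma form_b_sum:
  assumes "finite I" "\<And>r. r \<in> I \<Longrightarrow> pw_affine (F r)" "continuous_on (\<Union>\<T>) q"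
  shows "form_b S (\<lambda>y. \<Sum>r\<in>I. w r *\<^sub>R F r y) q = (\<Sum>r\<in>I. w r * form_b S (F r) q)"
proof -
  have u: "pw_affine (\<lambda>y. \<Sum>r\<in>I. w r *\<^sub>R F r y)" using assms(2) by (rule pw_affine_sum)
  have "divergence (\<lambda>y. \<Sum>r\<in>I. w r *\<^sub>R F r y) y * q y = (\<Sum>r\<in>I. w r * (divergence (F r) y * q y))"
    if "y \<in> S - skeleton" for y
  proof -
    have "divergence (\<lambda>y. \<Sum>r\<in>I. w r *\<^sub>R F r y) y = (\<Sum>r\<in>I. w r * divergence (F r) y)"
      using that S(2) unfolding divergence_def
      by (subst frechet_sum[OF assms(1,2)])
         (auto simp: inner_sum_left sum_distrib_left intro: sum.swap)
    then show ?thesis by (simp add: sum_distrib_left sum_distrib_right mult.assoc)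
  qed
  then have "integral S (\<lambda>y. divergence (\<lambda>y. \<Sum>r\<in>I. w r *\<^sub>R F r y) y * q y) = integral S (\<lambda>y. \<Sum>r\<in>I. w r * (divergence (F r) y * q y))"
    by (intro integral_spike[OF negligible_skeleton]) auto
  also have "\<dots> = (\<Sum>r\<in>I. w r * integral S (\<lambda>y. divergence (F r) y * q y))"
    using assms set_lebesgue_integral_eq_integral(1)[OF divergence_integrable]
    by (subst integral_sum) (auto intro!: integrable_on_mult_right)
  finally show ?thesis
    unfolding form_b_def using u assms
    by (simp add: set_lebesgue_integral_eq_integral(2) divergence_integrable sum_negf)
qed

lemma form_b_sum_pressure:
  assumes "finite I" "pw_affine u" "\<And>r. r \<in> I \<Longrightarrow> continuous_on (\<Union>\<T>) (p r)"
  shows "form_b S u (\<lambda>y. \<Sum>r\<in>I. c r * p r y) = (\<Sum>r\<in>I. c r * form_b S u (p r))"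
proof -
  have q: "continuous_on (\<Union>\<T>) (\<lambda>y. \<Sum>r\<in>I. c r * p r y)"
    using assms by (intro continuous_intros) auto
  have "integral S (\<lambda>y. divergence u y * (\<Sum>r\<in>I. c r * p r y)) = integral S (\<lambda>y. \<Sum>r\<in>I. c r * (divergence u y * p r y))"
    by (simp add: sum_distrib_left mult.left_commute)
  also have "\<dots> = (\<Sum>r\<in>I. c r * integral S (\<lambda>y. divergence u y * p r y))"
    using assms set_lebesgue_integral_eq_integral(1)[OF divergence_integrable]
    by (subst integral_sum) (auto intro!: integrable_on_mult_right)
  finally show ?thesis
    unfolding form_b_def using assms q
    by (simp add: set_lebesgue_integral_eq_integral(2) divergence_integrable sum_negf)
qed

lemma form_a_nonneg: "form_a S u u \<ge> 0"
  unfolding form_a_def set_lebesgue_integral_def grad_product_def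
  by (intro integral_nonneg_AE AE_I2) (auto intro!: sum_nonneg mult_nonneg_nonneg)

text \<open>Cauchy-Schwarz against the constant 1 over the two coordinate directions; the factor 2
  is the dimension of the plane. It reappears in \<open>2 * CZ\<close> and in the bound 2 for the
  squared inf-sup constant.\<close>

lemma divergence_square_le: "(divergence u y)\<^sup>2 \<le> 2 * grad_product u u y"
proof -
  let ?D = "frechet_derivative u (at y)"
  have "(divergence u y)\<^sup>2 \<le> (\<Sum>e\<in>(Basis::pt set). (inner (?D e) e)\<^sup>2) * card (Basis::pt set)"
    unfolding divergence_def
    using Cauchy_Schwarz_ineq_sum[of "\<lambda>e. inner (?D e) e" "\<lambda>e. 1" "Basis::pt set"] by simp
  also have "\<dots> = 2 * (\<Sum>e\<in>(Basis::pt set). (inner (?D e) e)\<^sup>2)" by (simp add: DIM_cart)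
  also have "\<dots> \<le> 2 * grad_product u u y"
  proof -
    have "(inner (?D e) e)\<^sup>2 \<le> inner (?D e) (?D e)" if "e \<in> Basis" for e
      using Cauchy_Schwarz_ineq[of "?D e" e] that by (simp add: inner_Basis)
    then show ?thesis unfolding grad_product_def by (simp add: sum_mono)
  qed
  finally show ?thesis .
qed

text \<open>Integration of \<open>0 \<le> (t * divergence u y + q y)\<^sup>2\<close>. Keeping
  \<open>t\<close> free makes the estimate additive over subdomains; the product form is recovered
  only after summation.\<close>

lemma form_b_young:
  assumes "pw_affine u" "continuous_on (\<Union>\<T>) q"
  shows "2 * t * form_b S u q \<le> 2 * t\<^sup>2 * form_a S u u + set_lebesgue_integral lebesgue S (\<lambda>y. q y * q y)"
proof -
  note ig = set_lebesgue_integral_eq_integral(1)[OF grad_product_integrable[OF assms(1,1)]]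
    and iq = set_lebesgue_integral_eq_integral(1)[OF pressure_integrable(2)[OF assms(2,2)]]
    and id = set_lebesgue_integral_eq_integral(1)[OF divergence_integrable[OF assms]]
  have "integral S (\<lambda>y. (- 2 * t) * (divergence u y * q y)) \<le> integral S (\<lambda>y. 2 * t\<^sup>2 * grad_product u u y + q y * q y)"
  proof (rule integral_le)
    show "(\<lambda>y. (- 2 * t) * (divergence u y * q y)) integrable_on S"
      using id by (rule integrable_on_mult_right)
    show "(\<lambda>y. 2 * t\<^sup>2 * grad_product u u y + q y * q y) integrable_on S"
      using integrable_on_mult_right[OF ig] iq by (rule integrable_add)
    show "(- 2 * t) * (divergence u y * q y) \<le> 2 * t\<^sup>2 * grad_product u u y + q y * q y" for y
    proof -
      have "0 \<le> (t * divergence u y + q y)\<^sup>2" by simp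
      moreover have "t\<^sup>2 * (divergence u y)\<^sup>2 \<le> t\<^sup>2 * (2 * grad_product u u y)"
        by (rule mult_left_mono[OF divergence_square_le]) simp
      ultimately show ?thesis by (simp add: power2_eq_square algebra_simps)
    qed
  qed
  also have "\<dots> = 2 * t\<^sup>2 * integral S (grad_product u u) + integral S (\<lambda>y. q y * q y)"
    by (simp only: integral_add[OF integrable_on_mult_right[OF ig] iq] integral_mult_right)
  finally show ?thesis
    unfolding form_a_def form_b_def
    by (simp add: set_lebesgue_integral_eq_integral(2)[OF grad_product_integrable[OF assms(1,1)]]
       set_lebesgue_integral_eq_integral(2)[OF pressure_integrable(2)[OF assms(2,2)]]
       set_lebesgue_integral_eq_integral(2)[OF divergence_integrable[OF assms]])
qed

end

end

text \<open>A quadratic polynomial in \<open>t\<close> that is never negative has nonpositive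
  discriminant; for \<open>a = 0\<close> it is linear, which forces \<open>b = 0\<close>.\<close>

lemma discriminant_le:
  fixes a b c :: real
  assumes "\<And>t. 2 * t * b \<le> t\<^sup>2 * a + c" "0 \<le> a"
  shows "b\<^sup>2 \<le> a * c"
proof (cases "a = 0")
  case True
  have "b = 0"
  proof (rule ccontr)
    assume b: "b \<noteq> 0"
    \<comment> \<open>For \<open>a = 0\<close> this value of \<open>t\<close> turns the hypothesis
      into \<open>2 * (c + 1) \<le> c\<close>, although \<open>t = 0\<close> gives
      \<open>0 \<le> c\<close>.\<close>
    have "2 * ((c + 1) / b) * b = 2 * (c + 1)" using b by simp
    then have "2 * (c + 1) \<le> c" using assms(1)[of "(c + 1) / b"] \<open>a = 0\<close> by simp
    moreover have "0 \<le> c" using assms(1)[of 0] by simp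
    ultimately show False by simp
  qed
  then show ?thesis using \<open>a = 0\<close> by simp
next
  case False
  have "2 * (b / a) * b = 2 * (b\<^sup>2 / a)" "(b / a)\<^sup>2 * a = b\<^sup>2 / a"
    using False by (simp_all add: power2_eq_square)
  then have "b\<^sup>2 / a \<le> c" using assms(1)[of "b / a"] by linarith
  then show ?thesis using False assms(2) by (simp add: field_simps)
qed

section \<open>Triangular meshes\<close>

text \<open>A frontier point in the interior of one of the polytopes would be interior to
  \<open>closure S\<close>, hence in the open set \<open>S\<close>. So the frontier is covered by
  finitely many frontiers of convex sets.\<close>

lemma negligible_polygonal_frontier:
  assumes "polygonal_domain S"
  shows "negligible (frontier S)"
proof -
  obtain \<P> where P: "finite \<P>" "\<And>P. P \<in> \<P> \<Longrightarrow> polytope P" "closure S = \<Union>\<P>"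
    and S: "open S" "interior (closure S) = S"
    using assms unfolding polygonal_domain_def by blast
  have "frontier S \<subseteq> (\<Union>P\<in>\<P>. frontier P)"
  proof
    fix x assume x: "x \<in> frontier S"
    then obtain P where "P \<in> \<P>" "x \<in> P" using P(3) unfolding frontier_def by blast
    moreover have "x \<notin> interior P"
    proof
      assume "x \<in> interior P"
      then have "x \<in> interior (closure S)"
        using interior_mono[of P "closure S"] P(3) \<open>P \<in> \<P>\<close> by blast
      then show False using x S by (simp add: frontier_def interior_open)
    qed
    ultimately show "x \<in> (\<Union>P\<in>\<P>. frontier P)"
      using closure_subset unfolding frontier_def by blast
  qed
  moreover have "negligible (\<Union>P\<in>\<P>. frontier P)"
    using P by (intro negligible_Union) (auto intro!: negligible_convex_frontier polytope_imp_convex)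
  ultimately show ?thesis using negligible_subset by blast
qed

lemma triangle_vertices:
  assumes "2 simplex T"
  obtains a b c where "distinct [a, b, c]" "T = convex hull {a, b, c}" "{x. x extreme_point_of T} = {a, b, c}"
proof -
  obtain C where C: "\<not> affine_dependent C" "int (card C) = 2 + 1" "T = convex hull C"
    using assms unfolding simplex_def by blast
  then have "card C = 3" by simp
  then obtain a b c where abc: "C = {a, b, c}" "a \<noteq> b" "b \<noteq> c" "a \<noteq> c"
    by (auto simp: card_3_iff)
  have "{x. x extreme_point_of T} = C"
    using extreme_point_of_convex_hull_affine_independent[OF C(1)] C(3) by blast
  then show thesis using that[of a b c] C(3) abc by auto
qed

lemma simplex_cell:
  assumes "n simplex T"
  shows "convex T" "compact T"
  using assms finite_imp_compact_convex_hull aff_independent_finite unfolding simplex_def by auto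

text \<open>In barycentric coordinates: a point with one coordinate at least 1/2 lies in the corner
  triangle of that vertex, and any other point lies in the medial triangle.\<close>

lemma triangle_subdivision:
  fixes a b c :: pt
  shows "convex hull {a, b, c} \<subseteq>
    convex hull {a, midpoint a b, midpoint a c} \<union> convex hull {b, midpoint b c, midpoint b a} \<union>
    convex hull {c, midpoint c a, midpoint c b} \<union> convex hull {midpoint a b, midpoint b c, midpoint c a}"
proof
  fix y assume "y \<in> convex hull {a, b, c}"
  then obtain u v w where uvw: "0 \<le> u" "0 \<le> v" "0 \<le> w" "u + v + w = 1" "y = u *\<^sub>R a + v *\<^sub>R b + w *\<^sub>R c"
    unfolding convex_hull_3 by blast
  have corner: "x \<in> convex hull {p, midpoint p q, midpoint p r}"
    if "x = u *\<^sub>R p + v *\<^sub>R q + w *\<^sub>R r" "0 \<le> v" "0 \<le> w" "u + v + w = 1" "1 / 2 \<le> u" for p q r x :: pt and u v w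
  proof -
    \<comment> \<open>Each midpoint contributes half of its weight to \<open>p\<close>, so the
      weights of \<open>q\<close> and \<open>r\<close> double and \<open>p\<close> keeps the
      rest.\<close>
    have "x = (2 * u - 1) *\<^sub>R p + (2 * v) *\<^sub>R midpoint p q + (2 * w) *\<^sub>R midpoint p r"
    proof -
      have u: "u = 1 - v - w" using that by simp
      show ?thesis unfolding that(1) u by (simp add: midpoint_def Finite_Cartesian_Product.vec_eq_iff field_simps)
    qed
    moreover have "0 \<le> 2 * u - 1" "0 \<le> 2 * v" "0 \<le> 2 * w" "2 * u - 1 + 2 * v + 2 * w = 1"
      using that by auto
    ultimately show ?thesis unfolding convex_hull_3 by blast
  qed
  consider "1 / 2 \<le> u" | "1 / 2 \<le> v" | "1 / 2 \<le> w" | "u \<le> 1 / 2" "v \<le> 1 / 2" "w \<le> 1 / 2" by linarith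
  then show "y \<in> convex hull {a, midpoint a b, midpoint a c} \<union> convex hull {b, midpoint b c, midpoint b a} \<union>
    convex hull {c, midpoint c a, midpoint c b} \<union> convex hull {midpoint a b, midpoint b c, midpoint c a}"
  proof cases
    case 1
    then show ?thesis using corner[of y u a v b w c] uvw by blast
  next
    case 2
    then show ?thesis using corner[of y v b w c u a] uvw by (simp add: add_ac)
  next
    case 3
    then show ?thesis using corner[of y w c u a v b] uvw by (simp add: add_ac)
  next
    case 4
    have "y = (1 - 2 * w) *\<^sub>R midpoint a b + (1 - 2 * u) *\<^sub>R midpoint b c + (1 - 2 * v) *\<^sub>R midpoint c a"
    proof -
      have w: "w = 1 - u - v" using uvw by simp
      show ?thesis unfolding uvw(5) w by (simp add: midpoint_def Finite_Cartesian_Product.vec_eq_iff field_simps)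
    qed
    moreover have "0 \<le> 1 - 2 * w" "0 \<le> 1 - 2 * u" "0 \<le> 1 - 2 * v" "1 - 2 * w + (1 - 2 * u) + (1 - 2 * v) = 1"
      using 4 uvw by auto
    ultimately show ?thesis unfolding convex_hull_3 by blast
  qed
qed

lemma midpoint_refinement_cell:
  assumes "T' \<in> midpoint_refinement \<T>"
  shows "convex T'" "compact T'"
  using assms unfolding midpoint_refinement_def
  by (auto intro!: finite_imp_compact_convex_hull)

lemma midpoint_refinement_subset:
  assumes "T' \<in> midpoint_refinement \<T>"
  obtains T where "T \<in> \<T>" "T' \<subseteq> T"
proof -
  have mid: "midpoint x y \<in> convex hull S" if "x \<in> convex hull S" "y \<in> convex hull S" for x y :: pt and S
    using that convex_convex_hull[of S] midpoint_in_closed_segment[of x y]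
    by (meson convex_contains_segment subsetD)
  consider a b c where "T' = convex hull {a, midpoint a b, midpoint a c}" "convex hull {a, b, c} \<in> \<T>"
    | a b c where "T' = convex hull {midpoint a b, midpoint b c, midpoint c a}" "convex hull {a, b, c} \<in> \<T>"
    using assms unfolding midpoint_refinement_def by blast
  then show thesis
    by cases (rule that, assumption, simp, rule hull_minimal, auto intro!: mid simp: hull_inc)+
qed

text \<open>The containment in the given coarse triangle is what later keeps a refined cell inside
  the closed subdomain to which the triangle belongs.\<close>

lemma midpoint_refinement_cover:
  assumes "T \<in> \<T>" "2 simplex T" "y \<in> T"
  obtains T' where "T' \<in> midpoint_refinement \<T>" "T' \<subseteq> T" "y \<in> T'"
proof -
  have mid: "midpoint x y \<in> convex hull S" if "x \<in> convex hull S" "y \<in> convex hull S" for x y :: pt and S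
    using that convex_convex_hull[of S] midpoint_in_closed_segment[of x y]
    by (meson convex_contains_segment subsetD)
  obtain a b c where T: "T = convex hull {a, b, c}" using triangle_vertices[OF assms(2)] by metis
  have in_T: "convex hull {a, b, c} \<in> \<T>" "convex hull {b, c, a} \<in> \<T>" "convex hull {c, a, b} \<in> \<T>"
    using T assms(1) by (simp_all add: insert_commute)
  have sub: "convex hull {a, midpoint a b, midpoint a c} \<subseteq> T" "convex hull {b, midpoint b c, midpoint b a} \<subseteq> T"
    "convex hull {c, midpoint c a, midpoint c b} \<subseteq> T" "convex hull {midpoint a b, midpoint b c, midpoint c a} \<subseteq> T"
    unfolding T by (rule hull_minimal; auto intro!: mid simp: hull_inc)+
  have "convex hull {a, midpoint a b, midpoint a c} \<in> midpoint_refinement \<T>"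
    "convex hull {b, midpoint b c, midpoint b a} \<in> midpoint_refinement \<T>"
    "convex hull {c, midpoint c a, midpoint c b} \<in> midpoint_refinement \<T>"
    "convex hull {midpoint a b, midpoint b c, midpoint c a} \<in> midpoint_refinement \<T>"
    unfolding midpoint_refinement_def using in_T by blast+
  moreover have "y \<in> convex hull {a, midpoint a b, midpoint a c} \<union> convex hull {b, midpoint b c, midpoint b a} \<union>
    convex hull {c, midpoint c a, midpoint c b} \<union> convex hull {midpoint a b, midpoint b c, midpoint c a}"
    using triangle_subdivision[of a b c] assms(3) T by blast
  ultimately show thesis using that sub by blast
qed

lemma finite_mesh_nodes:
  assumes "finite \<T>" "\<And>T. T \<in> \<T> \<Longrightarrow> 2 simplex T"
  shows "finite (mesh_nodes \<T>)"
proof -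
  have "finite {x. x extreme_point_of T}" if "T \<in> \<T>" for T
    using triangle_vertices[OF assms(2)[OF that]] by (metis finite.emptyI finite_insert)
  then have "finite (\<Union>T\<in>\<T>. {x. x extreme_point_of T})" using assms(1) by blast
  moreover have "mesh_nodes \<T> = (\<Union>T\<in>\<T>. {x. x extreme_point_of T})"
    unfolding mesh_nodes_def by blast
  ultimately show ?thesis by simp
qed

text \<open>The comprehension ranges over all points of the plane. A triangle in the mesh has three
  extreme points, all among \<open>a\<close>, \<open>b\<close>, \<open>c\<close>; by counting, these
  three are mesh nodes, and there are finitely many nodes.\<close>

lemma finite_midpoint_refinement:
  assumes "finite \<T>" "\<And>T. T \<in> \<T> \<Longrightarrow> 2 simplex T"
  shows "finite (midpoint_refinement \<T>)"
proof -
  let ?N = "mesh_nodes \<T>"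
  have N: "a \<in> ?N \<and> b \<in> ?N \<and> c \<in> ?N" if T: "convex hull {a, b, c} \<in> \<T>" for a b c
  proof -
    obtain p q r where p: "distinct [p, q, r]" "{x. x extreme_point_of convex hull {a, b, c}} = {p, q, r}"
      using triangle_vertices[OF assms(2)[OF T]] by metis
    then have sub: "{p, q, r} \<subseteq> {a, b, c}" using extreme_point_of_convex_hull by blast
    have "card {p, q, r} = 3" using p(1) by simp
    moreover have "card {a, b, c} \<le> 3" by (simp add: card_insert_if)
    ultimately have "{p, q, r} = {a, b, c}" using card_subset_eq[OF _ sub] card_mono[OF _ sub] by simp
    then show ?thesis using p(2) T unfolding mesh_nodes_def by blast
  qed
  let ?f = "\<lambda>(a, b, c). convex hull {a, midpoint a b, midpoint a c}"
  let ?g = "\<lambda>(a, b, c). convex hull {midpoint a b, midpoint b c, midpoint c a}"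
  have "midpoint_refinement \<T> \<subseteq> ?f ` (?N \<times> ?N \<times> ?N) \<union> ?g ` (?N \<times> ?N \<times> ?N)"
    unfolding midpoint_refinement_def using N by fastforce
  moreover have "finite (?f ` (?N \<times> ?N \<times> ?N) \<union> ?g ` (?N \<times> ?N \<times> ?N))"
    using finite_mesh_nodes[OF assms] by simp
  ultimately show ?thesis using finite_subset by blast
qed

lemma P1_affine_on:
  "f \<in> P1_functions \<T> \<Longrightarrow> T \<in> \<T> \<Longrightarrow> affine_on T f"
  unfolding P1_functions_def using affine_on_inner by blast

text \<open>On a cell without the node, the basis function vanishes at all vertices and is affine.
  This locality decides which subdomains see an interface function.\<close>

lemma nodal_basis_zero:
  assumes "nodal_basis \<T> \<phi>" "x \<in> mesh_nodes \<T>" "T \<in> \<T>" "compact T" "convex T" "x \<notin> T" "y \<in> T"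
  shows "\<phi> x y = 0"
proof (rule affine_on_eq_const[of T])
  show "affine_on T (\<phi> x)"
    using assms(1-3) P1_affine_on unfolding nodal_basis_def by blast
  show "\<phi> x z = 0" if "z extreme_point_of T" for z
  proof -
    have "z \<in> mesh_nodes \<T>" "z \<in> T" using that assms(3) unfolding mesh_nodes_def extreme_point_of_def by blast+
    then show ?thesis using assms(1,2,6) unfolding nodal_basis_def by auto
  qed
qed (use assms in auto)

text \<open>Identifies the vector with equal entries as a constant pressure, so that its mean over
  the domain can be computed.\<close>

lemma nodal_basis_partition_of_unity:
  assumes "nodal_basis \<T> \<phi>" "finite (mesh_nodes \<T>)" "T \<in> \<T>" "compact T" "convex T" "y \<in> T"
  shows "(\<Sum>x\<in>mesh_nodes \<T>. \<phi> x y) = 1"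
proof (rule affine_on_eq_const[of T "\<lambda>y. \<Sum>x\<in>mesh_nodes \<T>. \<phi> x y"])
  show "affine_on T (\<lambda>y. \<Sum>x\<in>mesh_nodes \<T>. \<phi> x y)"
  proof -
    have "affine_on T (\<phi> x)" if "x \<in> mesh_nodes \<T>" for x
      using that assms(1,3) P1_affine_on unfolding nodal_basis_def by blast
    from affine_on_sum[OF this, of "mesh_nodes \<T>" "\<lambda>x. x" "\<lambda>x. 1"] show ?thesis by simp
  qed
  show "(\<Sum>x\<in>mesh_nodes \<T>. \<phi> x z) = 1" if "z extreme_point_of T" for z
  proof -
    have z: "z \<in> mesh_nodes \<T>" using that assms(3) unfolding mesh_nodes_def by blast
    then have "(\<Sum>x\<in>mesh_nodes \<T>. \<phi> x z) = (\<Sum>x\<in>mesh_nodes \<T>. if z = x then 1 else 0)"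
      using assms(1) unfolding nodal_basis_def by (intro sum.cong) auto
    then show ?thesis using z assms(2) by simp
  qed
qed (use assms in auto)

section \<open>Linear algebra\<close>

lemma mult_mat_zero_vec [simp]: "(A :: real mat) \<in> carrier_mat n m \<Longrightarrow> A *\<^sub>v 0\<^sub>v m = 0\<^sub>v n"
  by (intro eq_vecI) (auto simp: scalar_prod_def)

lemma mat_inverse_injective:
  fixes A :: "real mat"
  assumes "A \<in> carrier_mat n n" "\<And>v. v \<in> carrier_vec n \<Longrightarrow> A *\<^sub>v v = 0\<^sub>v n \<Longrightarrow> v = 0\<^sub>v n"
  shows "the (mat_inverse A) \<in> carrier_mat n n" "A * the (mat_inverse A) = 1\<^sub>m n"
proof -
  have "det A \<noteq> 0" using det_0_iff_vec_prod_zero_field[OF assms(1)] assms(2) by blast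
  then have "A \<in> Units (ring_mat TYPE(real) n ())" by (rule det_non_zero_imp_unit[OF assms(1)])
  then obtain B where "mat_inverse A = Some B" using mat_inverse(1)[OF assms(1)] by fastforce
  then show "the (mat_inverse A) \<in> carrier_mat n n" "A * the (mat_inverse A) = 1\<^sub>m n"
    using mat_inverse(2)[OF assms(1)] by auto
qed

lemma invertible_mat_injective:
  fixes A :: "real mat"
  assumes "A \<in> carrier_mat n n" "invertible_mat A" "v \<in> carrier_vec n" "A *\<^sub>v v = 0\<^sub>v n"
  shows "v = 0\<^sub>v n"
proof -
  obtain B where B: "A * B = 1\<^sub>m (dim_row A)" "B * A = 1\<^sub>m (dim_row B)"
    using assms(2) unfolding invertible_mat_def inverts_mat_def by blast
  have "dim_col B = n" using B(1) assms(1) by (metis carrier_matD(1) index_mult_mat(3) index_one_mat(3))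
  moreover have "dim_row B = n" using B(2) assms(1) by (metis carrier_matD(2) index_mult_mat(3) index_one_mat(3))
  ultimately have "B \<in> carrier_mat n n" by auto
  then have "v = (B * A) *\<^sub>v v" using B(2) assms(3) \<open>dim_row B = n\<close> by simp
  also have "\<dots> = B *\<^sub>v 0\<^sub>v n" using assms \<open>B \<in> carrier_mat n n\<close> by simp
  finally show ?thesis using \<open>B \<in> carrier_mat n n\<close> by simp
qed

lemma invertible_mat_surjective:
  fixes A :: "real mat"
  assumes "A \<in> carrier_mat n n" "invertible_mat A" "b \<in> carrier_vec n"
  obtains v where "v \<in> carrier_vec n" "A *\<^sub>v v = b"
proof (rule that)
  let ?B = "the (mat_inverse A)"
  note B = mat_inverse_injective[OF assms(1) invertible_mat_injective[OF assms(1,2)]]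
  show "?B *\<^sub>v b \<in> carrier_vec n" using B(1) assms(3) by simp
  have "A *\<^sub>v (?B *\<^sub>v b) = (A * ?B) *\<^sub>v b" using assms B(1) by simp
  then show "A *\<^sub>v (?B *\<^sub>v b) = b" using B(2) assms(3) by simp
qed

lemma adjoint_scalar_prod:
  fixes A :: "real mat"
  assumes "A \<in> carrier_mat m n" "v \<in> carrier_vec m" "w \<in> carrier_vec n"
  shows "v \<bullet> (A *\<^sub>v w) = (transpose_mat A *\<^sub>v v) \<bullet> w"
  using transpose_vec_mult_scalar[OF assms(1,3,2)] by simp

lemma symmetric_scalar_prod:
  fixes A :: "real mat"
  assumes "A \<in> carrier_mat n n" "transpose_mat A = A" "v \<in> carrier_vec n" "w \<in> carrier_vec n"
  shows "v \<bullet> (A *\<^sub>v w) = w \<bullet> (A *\<^sub>v v)"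
  using adjoint_scalar_prod[OF assms(1,3,4)] assms by (simp add: comm_scalar_prod[of _ n])

lemma quadratic_form_add_smult:
  fixes A :: "real mat"
  assumes "A \<in> carrier_mat n n" "transpose_mat A = A" "v \<in> carrier_vec n" "w \<in> carrier_vec n"
  shows "(v + t \<cdot>\<^sub>v w) \<bullet> (A *\<^sub>v (v + t \<cdot>\<^sub>v w)) = v \<bullet> (A *\<^sub>v v) + 2 * t * (v \<bullet> (A *\<^sub>v w)) + t\<^sup>2 * (w \<bullet> (A *\<^sub>v w))"
proof -
  have "A *\<^sub>v (v + t \<cdot>\<^sub>v w) = A *\<^sub>v v + t \<cdot>\<^sub>v (A *\<^sub>v w)"
    using assms by (simp add: mult_add_distrib_mat_vec mult_mat_vec)
  then have "(v + t \<cdot>\<^sub>v w) \<bullet> (A *\<^sub>v (v + t \<cdot>\<^sub>v w)) =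
      v \<bullet> (A *\<^sub>v v) + t * (v \<bullet> (A *\<^sub>v w)) + t * (w \<bullet> (A *\<^sub>v v)) + t * (t * (w \<bullet> (A *\<^sub>v w)))"
    using assms by (simp add: add_scalar_prod_distrib[of _ n] scalar_prod_add_distrib[of _ n] algebra_simps)
  then show ?thesis using symmetric_scalar_prod[OF assms] by (simp add: power2_eq_square)
qed

text \<open>Nonnegativity is asked only at \<open>w\<close> and along the line through
  \<open>v\<close> in direction \<open>w\<close>, because the lemma is also applied to
  \<open>A_tilde\<close>, which is controlled on \<open>W_tilde0\<close> alone.\<close>

lemma form_Cauchy_Schwarz:
  fixes A :: "real mat"
  assumes "A \<in> carrier_mat n n" "transpose_mat A = A" "v \<in> carrier_vec n" "w \<in> carrier_vec n"
    and "\<And>t. 0 \<le> (v + t \<cdot>\<^sub>v w) \<bullet> (A *\<^sub>v (v + t \<cdot>\<^sub>v w))" "0 \<le> w \<bullet> (A *\<^sub>v w)"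
  shows "(v \<bullet> (A *\<^sub>v w))\<^sup>2 \<le> (v \<bullet> (A *\<^sub>v v)) * (w \<bullet> (A *\<^sub>v w))"
proof -
  have "(- (v \<bullet> (A *\<^sub>v w)))\<^sup>2 \<le> (w \<bullet> (A *\<^sub>v w)) * (v \<bullet> (A *\<^sub>v v))"
  proof (rule discriminant_le)
    show "2 * t * - (v \<bullet> (A *\<^sub>v w)) \<le> t\<^sup>2 * (w \<bullet> (A *\<^sub>v w)) + v \<bullet> (A *\<^sub>v v)" for t
      using assms(5)[of t] quadratic_form_add_smult[OF assms(1-4), of t] by simp
  qed (rule assms(6))
  then show ?thesis by (simp add: mult.commute)
qed

text \<open>Adding the rank-one term \<open>\<mu> \<mu>\<^sup>T\<close> makes the singular Schur complement \<open>B A\<^sup>-\<^sup>1 B\<^sup>T\<close> injective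
  and does not disturb the equation, because the right-hand side is orthogonal to the kernel.\<close>

lemma saddle_point_solution:
  fixes A B :: "real mat"
  assumes A: "A \<in> carrier_mat n n" "\<And>v. v \<in> carrier_vec n \<Longrightarrow> 0 \<le> v \<bullet> (A *\<^sub>v v)"
      "\<And>v. v \<in> carrier_vec n \<Longrightarrow> v \<bullet> (A *\<^sub>v v) = 0 \<Longrightarrow> v = 0\<^sub>v n"
    and B: "B \<in> carrier_mat m n"
    and e: "e \<in> carrier_vec m" "transpose_mat B *\<^sub>v e = 0\<^sub>v n"
      "\<And>q. q \<in> carrier_vec m \<Longrightarrow> transpose_mat B *\<^sub>v q = 0\<^sub>v n \<Longrightarrow> \<exists>c. q = c \<cdot>\<^sub>v e"
    and \<mu>: "\<mu> \<in> carrier_vec m" "\<mu> \<bullet> e \<noteq> 0"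
    and w: "w \<in> carrier_vec n"
  obtains q v where "q \<in> carrier_vec m" "v \<in> carrier_vec n" "\<mu> \<bullet> q = 0"
    "A *\<^sub>v v = transpose_mat B *\<^sub>v q" "B *\<^sub>v v = B *\<^sub>v w"
proof -
  let ?Ai = "the (mat_inverse A)"
  have inj: "v = 0\<^sub>v n" if "v \<in> carrier_vec n" "A *\<^sub>v v = 0\<^sub>v n" for v
    using A(3)[OF that(1)] that by simp
  note Ai = mat_inverse_injective[OF A(1) inj]
  define R where "R = mat m m (\<lambda>(i, j). \<mu> $ i * \<mu> $ j)"
  define S where "S = B * ?Ai * transpose_mat B + R"
  define sol where "sol q = ?Ai *\<^sub>v (transpose_mat B *\<^sub>v q)" for q
  have sol: "sol q \<in> carrier_vec n" "A *\<^sub>v sol q = transpose_mat B *\<^sub>v q" if "q \<in> carrier_vec m" for q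
  proof -
    show "sol q \<in> carrier_vec n" unfolding sol_def using Ai(1) B that by simp
    have "A *\<^sub>v sol q = (A * ?Ai) *\<^sub>v (transpose_mat B *\<^sub>v q)"
      unfolding sol_def using A(1) Ai(1) B that by simp
    then show "A *\<^sub>v sol q = transpose_mat B *\<^sub>v q" using Ai(2) B that by simp
  qed
  have R: "R \<in> carrier_mat m m" unfolding R_def by simp
  have S: "S \<in> carrier_mat m m" unfolding S_def using R Ai(1) B by simp
  have Rq: "R *\<^sub>v q = (\<mu> \<bullet> q) \<cdot>\<^sub>v \<mu>" if "q \<in> carrier_vec m" for q
    using that \<mu>(1) unfolding R_def
    by (intro eq_vecI) (auto simp: scalar_prod_def sum_distrib_left sum_distrib_right ac_simps intro!: sum.cong)
  have Sq: "S *\<^sub>v q = B *\<^sub>v sol q + (\<mu> \<bullet> q) \<cdot>\<^sub>v \<mu>" if "q \<in> carrier_vec m" for q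
  proof -
    have BAB: "B * ?Ai * transpose_mat B \<in> carrier_mat m m" using Ai(1) B by simp
    have "S *\<^sub>v q = (B * ?Ai * transpose_mat B) *\<^sub>v q + R *\<^sub>v q"
      unfolding S_def using add_mult_distrib_mat_vec[OF BAB R that] .
    also have "(B * ?Ai * transpose_mat B) *\<^sub>v q = B *\<^sub>v sol q"
      unfolding sol_def using Ai(1) B that by (simp add: assoc_mult_mat_vec[of _ m n _ m] assoc_mult_mat_vec[of _ m n _ n])
    finally show ?thesis using Rq[OF that] by simp
  qed
  have "q = 0\<^sub>v m" if q: "q \<in> carrier_vec m" "S *\<^sub>v q = 0\<^sub>v m" for q
  proof -
    have "0 = q \<bullet> (S *\<^sub>v q)" using q by simp
    \<comment> \<open>The form of \<open>S\<close> at \<open>q\<close> is the energy of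
      \<open>sol q\<close> plus a square. If it vanishes, \<open>q\<close> is in the kernel of the
      transpose of \<open>B\<close>, hence a multiple of \<open>e\<close>, and
      \<open>\<mu> \<bullet> e \<noteq> 0\<close> excludes nonzero multiples.\<close>
    also have "\<dots> = q \<bullet> (B *\<^sub>v sol q) + (\<mu> \<bullet> q)\<^sup>2"
      using q(1) B \<mu>(1) sol(1)[OF q(1)] comm_scalar_prod[OF q(1) \<mu>(1)]
      by (simp add: Sq scalar_prod_add_distrib[of _ m] power2_eq_square)
    also have "q \<bullet> (B *\<^sub>v sol q) = sol q \<bullet> (A *\<^sub>v sol q)"
      using adjoint_scalar_prod[OF B q(1) sol(1)[OF q(1)]] sol[OF q(1)] A(1) B q(1)
      by (simp add: comm_scalar_prod[of _ n])
    finally have "sol q \<bullet> (A *\<^sub>v sol q) = 0 \<and> \<mu> \<bullet> q = 0"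
      using A(2)[OF sol(1)[OF q(1)]] by (simp add: add_nonneg_eq_0_iff eq_commute[of 0])
    then have "sol q = 0\<^sub>v n" "\<mu> \<bullet> q = 0" using A(3)[OF sol(1)[OF q(1)]] by auto
    then have "transpose_mat B *\<^sub>v q = 0\<^sub>v n" using sol(2)[OF q(1)] A(1) by simp
    then obtain c where c: "q = c \<cdot>\<^sub>v e" using e(3) q(1) by blast
    then have "c * (\<mu> \<bullet> e) = 0" using \<open>\<mu> \<bullet> q = 0\<close> \<mu>(1) e(1) by simp
    then show ?thesis using c \<mu>(2) e(1) by auto
  qed
  note Si = mat_inverse_injective[OF S this]
  define q where "q = the (mat_inverse S) *\<^sub>v (B *\<^sub>v w)"
  have q: "q \<in> carrier_vec m" unfolding q_def using Si(1) B w by simp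
  have Bw: "B *\<^sub>v w \<in> carrier_vec m" using B w by simp
  have "S *\<^sub>v q = (S * the (mat_inverse S)) *\<^sub>v (B *\<^sub>v w)"
    unfolding q_def using S Si(1) Bw by simp
  then have eq: "B *\<^sub>v sol q + (\<mu> \<bullet> q) \<cdot>\<^sub>v \<mu> = B *\<^sub>v w" using Sq[OF q] Si(2) Bw by simp
  have e0: "e \<bullet> (B *\<^sub>v v) = 0" if "v \<in> carrier_vec n" for v
    using adjoint_scalar_prod[OF B e(1) that] e(2) that by simp
  \<comment> \<open>Testing with \<open>e\<close>, which is orthogonal to the range of
    \<open>B\<close>, leaves only the rank-one term. So \<open>\<mu> \<bullet> q = 0\<close>, and
    the perturbation drops out of the equation.\<close>
  have "0 = e \<bullet> (B *\<^sub>v sol q + (\<mu> \<bullet> q) \<cdot>\<^sub>v \<mu>)" using eq e0[OF w] by simp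
  also have "\<dots> = (\<mu> \<bullet> q) * (\<mu> \<bullet> e)"
    using e0[OF sol(1)[OF q]] e(1) \<mu>(1) B sol(1)[OF q] comm_scalar_prod[OF e(1) \<mu>(1)]
    by (simp add: scalar_prod_add_distrib[of _ m])
  finally have \<mu>q: "\<mu> \<bullet> q = 0" using \<mu>(2) by simp
  have "B *\<^sub>v sol q = B *\<^sub>v w"
  proof -
    have "(\<mu> \<bullet> q) \<cdot>\<^sub>v \<mu> = 0\<^sub>v m" unfolding \<mu>q using \<mu>(1) by auto
    then show ?thesis using eq right_zero_vec[of "B *\<^sub>v sol q" m] B sol(1)[OF q] by simp
  qed
  then show thesis using that[OF q sol(1)[OF q] \<mu>q sol(2)[OF q]] by blast
qed

text \<open>The abstract core, with \<open>V\<close> in the role of \<open>W_tilde0\<close>: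
  continuity of \<open>B\<close> on \<open>V\<close> bounds \<open>G\<close> from above, and a
  stable lifting of the values of \<open>B\<close> on \<open>V\<close> bounds it from below. Each
  estimate is Cauchy-Schwarz followed by cancellation of one factor.\<close>

lemma preconditioned_bounds:
  fixes A B P :: "real mat"
  defines "G \<equiv> B * the (mat_inverse A) * transpose_mat B"
  assumes A: "A \<in> carrier_mat n n" "invertible_mat A" "transpose_mat A = A"
    and B: "B \<in> carrier_mat m n"
    and P: "P \<in> carrier_mat m m" "transpose_mat P = P"
      "\<And>x. x \<in> carrier_vec m \<Longrightarrow> 0 \<le> x \<bullet> (P *\<^sub>v x)"
      "\<And>x. x \<in> carrier_vec m \<Longrightarrow> x \<bullet> (P *\<^sub>v x) = 0 \<Longrightarrow> x = 0\<^sub>v m"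
    and V: "V \<subseteq> carrier_vec n" "\<And>v w t. v \<in> V \<Longrightarrow> w \<in> V \<Longrightarrow> v + t \<cdot>\<^sub>v w \<in> V"
      "\<And>v. v \<in> V \<Longrightarrow> 0 \<le> v \<bullet> (A *\<^sub>v v)"
      "\<And>v x. v \<in> carrier_vec n \<Longrightarrow> x \<in> carrier_vec m \<Longrightarrow> A *\<^sub>v v = transpose_mat B *\<^sub>v x \<Longrightarrow> v \<in> V"
    and upper: "0 \<le> K" "\<And>v. v \<in> V \<Longrightarrow> (B *\<^sub>v v) \<bullet> (P *\<^sub>v (B *\<^sub>v v)) \<le> K * (v \<bullet> (A *\<^sub>v v))"
    and lower: "0 \<le> D" "\<And>v. v \<in> V \<Longrightarrow> \<exists>w\<in>V. B *\<^sub>v w = B *\<^sub>v v \<and> w \<bullet> (A *\<^sub>v w) \<le> D * ((B *\<^sub>v v) \<bullet> (P *\<^sub>v (B *\<^sub>v v)))"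
    and z: "z \<in> carrier_vec m"
    and x: "x = (P * G) *\<^sub>v z"
  shows "0 \<le> (the (mat_inverse P) *\<^sub>v x) \<bullet> x \<and>
    (the (mat_inverse P) *\<^sub>v x) \<bullet> x \<le> D * ((G *\<^sub>v x) \<bullet> x) \<and>
    (G *\<^sub>v x) \<bullet> x \<le> K * ((the (mat_inverse P) *\<^sub>v x) \<bullet> x)"
proof -
  note Ai = mat_inverse_injective[OF A(1) invertible_mat_injective[OF A(1,2)]]
  have P_inj: "x = 0\<^sub>v m" if "x \<in> carrier_vec m" "P *\<^sub>v x = 0\<^sub>v m" for x
    using P(4)[OF that(1)] that by simp
  note M = mat_inverse_injective[OF P(1) P_inj]
  define sol where "sol x = the (mat_inverse A) *\<^sub>v (transpose_mat B *\<^sub>v x)" for x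
  have sol: "sol x \<in> carrier_vec n" "A *\<^sub>v sol x = transpose_mat B *\<^sub>v x" "sol x \<in> V" "G *\<^sub>v x = B *\<^sub>v sol x"
    if "x \<in> carrier_vec m" for x
  proof -
    show *: "sol x \<in> carrier_vec n" unfolding sol_def using Ai(1) B that by simp
    have "A *\<^sub>v sol x = (A * the (mat_inverse A)) *\<^sub>v (transpose_mat B *\<^sub>v x)"
      unfolding sol_def using A(1) Ai(1) B that by simp
    then show **: "A *\<^sub>v sol x = transpose_mat B *\<^sub>v x" using Ai(2) B that by simp
    show "sol x \<in> V" using V(4)[OF * that **] .
    show "G *\<^sub>v x = B *\<^sub>v sol x"
      unfolding sol_def G_def using Ai(1) B that
      by (simp add: assoc_mult_mat_vec[of _ m n _ m] assoc_mult_mat_vec[of _ m n _ n])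
  qed
  have G: "G \<in> carrier_mat m m" unfolding G_def using B Ai(1) by simp
  have PM: "P *\<^sub>v (the (mat_inverse P) *\<^sub>v x) = x" if "x \<in> carrier_vec m" for x
    using that M P(1) assoc_mult_mat_vec[OF P(1) M(1) that] by simp
  define y where "y = the (mat_inverse P) *\<^sub>v x"
  define s where "s = sol x"
  have x: "x \<in> carrier_vec m" "x = P *\<^sub>v (G *\<^sub>v z)" unfolding x using P(1) G z by auto
  have y: "y \<in> carrier_vec m" "P *\<^sub>v y = x" unfolding y_def using M(1) x(1) PM by auto
  have Gz: "G *\<^sub>v z \<in> carrier_vec m" using G z by simp
  \<comment> \<open>Here the range condition enters: by injectivity of \<open>P\<close>, the vector
    \<open>y\<close> is \<open>G z\<close> and thus a value of \<open>B\<close> on \<open>V\<close>,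
    which the lifting hypothesis requires.\<close>
  have "P *\<^sub>v (y - G *\<^sub>v z) = 0\<^sub>v m"
    using y(2) x(2) P(1) y(1) Gz x(1) mult_minus_distrib_mat_vec[OF P(1) y(1) Gz] by simp
  then have "y - G *\<^sub>v z = 0\<^sub>v m" using P_inj y(1) Gz by simp
  then have yG: "y = B *\<^sub>v sol z" using Gz y(1) sol(4)[OF z] by (auto simp: vec_eq_iff)
  note s = sol[OF x(1), folded s_def]
  have adj: "(B *\<^sub>v v) \<bullet> x = v \<bullet> (A *\<^sub>v s)" if "v \<in> carrier_vec n" for v
    using adjoint_scalar_prod[OF B x(1) that] s(2) that B x(1) by (simp add: comm_scalar_prod[of _ m] comm_scalar_prod[of _ n])
  have gram_P: "(v \<bullet> (P *\<^sub>v w))\<^sup>2 \<le> (v \<bullet> (P *\<^sub>v v)) * (w \<bullet> (P *\<^sub>v w))" if "v \<in> carrier_vec m" "w \<in> carrier_vec m" for v w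
    using form_Cauchy_Schwarz[OF P(1,2) that] P(3) that by simp
  have gram_A: "(v \<bullet> (A *\<^sub>v w))\<^sup>2 \<le> (v \<bullet> (A *\<^sub>v v)) * (w \<bullet> (A *\<^sub>v w))" if "v \<in> V" "w \<in> V" for v w
    using form_Cauchy_Schwarz[OF A(1,3)] V(1) V(2)[OF that] V(3) that by blast
  have cancel: "a \<le> c * b" if "a\<^sup>2 \<le> (c * a) * b" "0 \<le> a" "0 \<le> b" "0 \<le> c" for a b c :: real
  proof (cases "a = 0")
    case False
    then have "a * a \<le> a * (c * b)" using that by (simp add: power2_eq_square ac_simps)
    then show ?thesis using False that(2) by (simp add: mult_le_cancel_left)
  qed (use that in simp)
  have Mx: "y \<bullet> x = y \<bullet> (P *\<^sub>v y)" using y by simp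
  have Gx: "(G *\<^sub>v x) \<bullet> x = s \<bullet> (A *\<^sub>v s)" using adj[OF s(1)] s(4) by simp
  have "((G *\<^sub>v x) \<bullet> x)\<^sup>2 \<le> (K * ((G *\<^sub>v x) \<bullet> x)) * (y \<bullet> x)"
  proof -
    have Bs: "B *\<^sub>v s \<in> carrier_vec m" using B s(1) by simp
    have "((G *\<^sub>v x) \<bullet> x)\<^sup>2 = ((B *\<^sub>v s) \<bullet> (P *\<^sub>v y))\<^sup>2" using s(4) y(2) by simp
    also have "\<dots> \<le> ((B *\<^sub>v s) \<bullet> (P *\<^sub>v (B *\<^sub>v s))) * (y \<bullet> (P *\<^sub>v y))" using gram_P[OF Bs y(1)] .
    also have "\<dots> \<le> (K * (s \<bullet> (A *\<^sub>v s))) * (y \<bullet> (P *\<^sub>v y))"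
      using upper(2)[OF s(3)] P(3)[OF y(1)] by (rule mult_right_mono)
    finally show ?thesis using Gx Mx by simp
  qed
  then have upper_x: "(G *\<^sub>v x) \<bullet> x \<le> K * (y \<bullet> x)"
    using cancel Gx Mx V(3)[OF s(3)] P(3)[OF y(1)] upper(1) by metis
  obtain w where w: "w \<in> V" "B *\<^sub>v w = y" "w \<bullet> (A *\<^sub>v w) \<le> D * (y \<bullet> (P *\<^sub>v y))"
    using lower(2)[OF sol(3)[OF z]] yG by auto
  \<comment> \<open>Since \<open>B w = y\<close>, the adjoint relation turns the pairing with
    \<open>x\<close> into an \<open>A\<close>-product with \<open>s\<close>, where the small energy
    of the lifting \<open>w\<close> can be used.\<close>
  have "(y \<bullet> x)\<^sup>2 = (w \<bullet> (A *\<^sub>v s))\<^sup>2" using adj w V(1) by auto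
  also have "\<dots> \<le> (w \<bullet> (A *\<^sub>v w)) * (s \<bullet> (A *\<^sub>v s))" using gram_A[OF w(1) s(3)] .
  also have "\<dots> \<le> (D * (y \<bullet> x)) * ((G *\<^sub>v x) \<bullet> x)"
    unfolding Gx Mx using w(3) V(3)[OF s(3)] by (rule mult_right_mono)
  finally have "(y \<bullet> x)\<^sup>2 \<le> (D * (y \<bullet> x)) * ((G *\<^sub>v x) \<bullet> x)" .
  then have "y \<bullet> x \<le> D * ((G *\<^sub>v x) \<bullet> x)"
    using cancel Gx Mx V(3)[OF s(3)] P(3)[OF y(1)] lower(1) by metis
  moreover have "0 \<le> y \<bullet> x" unfolding Mx by (rule P(3)[OF y(1)])
  ultimately show ?thesis using upper_x unfolding y_def by blast
qed

section \<open>Matrix entries\<close>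

lemma mult_mat_vec_sum:
  "A \<in> carrier_mat n m \<Longrightarrow> v \<in> carrier_vec m \<Longrightarrow> i < n \<Longrightarrow> (A *\<^sub>v v) $ i = (\<Sum>j<m. A $$ (i, j) * v $ j)"
  by (auto simp: scalar_prod_def atLeast0LessThan intro!: sum.cong)

lemma scalar_prod_sum:
  "w \<in> carrier_vec n \<Longrightarrow> v \<bullet> w = (\<Sum>i<n. v $ i * w $ i)"
  by (auto simp: scalar_prod_def atLeast0LessThan)

lemma form_sum:
  fixes A :: "real mat"
  assumes "A \<in> carrier_mat n m" "v \<in> carrier_vec m"
  shows "w \<bullet> (A *\<^sub>v v) = (\<Sum>i<n. w $ i * (\<Sum>j<m. v $ j * A $$ (i, j)))"
proof -
  have "w \<bullet> (A *\<^sub>v v) = (\<Sum>i<n. w $ i * (A *\<^sub>v v) $ i)"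
    using assms by (intro scalar_prod_sum) simp
  then show ?thesis using mult_mat_vec_sum[OF assms] by (simp add: mult.commute cong: sum.cong_simp)
qed

lemma vec_eq_zero_scalar_prod:
  fixes x :: "real vec"
  assumes "x \<in> carrier_vec n" "\<And>u. u \<in> carrier_vec n \<Longrightarrow> u \<bullet> x = 0"
  shows "x = 0\<^sub>v n"
proof (rule eq_vecI)
  show "x $ i = 0\<^sub>v n $ i" if "i < dim_vec (0\<^sub>v n)" for i
    using assms(2)[of "unit_vec n i"] assms(1) that by simp
qed (use assms in auto)

lemma append_cols_dim [simp]:
  "dim_row (A @\<^sub>c B) = dim_row A" "dim_col (A @\<^sub>c B) = dim_col A + dim_col B"
  unfolding append_cols_def by auto

lemma append_cols_index [simp]:
  "i < dim_row A \<Longrightarrow> j < dim_col A + dim_col B \<Longrightarrow>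
    (A @\<^sub>c B) $$ (i, j) = (if j < dim_col A then A $$ (i, j) else B $$ (i, j - dim_col A))"
  unfolding append_cols_def by auto

lemma append_rows_dim:
  "dim_row (A @\<^sub>r B) = dim_row A + dim_row B" "dim_col (A @\<^sub>r B) = dim_col A"
  unfolding append_rows_def by auto

lemma append_rows_index:
  "i < dim_row A + dim_row B \<Longrightarrow> j < dim_col A \<Longrightarrow> dim_col B = dim_col A \<Longrightarrow>
    (A @\<^sub>r B) $$ (i, j) = (if i < dim_row A then A $$ (i, j) else B $$ (i - dim_row A, j))"
  unfolding append_rows_def by auto

lemma grad_product_zero: "grad_product (\<lambda>y. 0) v y = 0" "grad_product v (\<lambda>y. 0) y = 0"
  unfolding grad_product_def by (simp_all add: frechet_derivative_const)

lemma form_zero [simp]: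
  "form_a S (\<lambda>y. 0) v = 0" "form_a S v (\<lambda>y. 0) = 0" "form_b S (\<lambda>y. 0) q = 0" "form_b S v (\<lambda>y. 0) = 0"
  unfolding form_a_def form_b_def divergence_def
  by (simp_all add: grad_product_zero frechet_derivative_const set_lebesgue_integral_def)

section \<open>Broken forms and coordinates of the partially assembled space\<close>

definition broken_a :: "fetidp \<Rightarrow> broken \<Rightarrow> broken \<Rightarrow> real" where
  "broken_a d u v = (\<Sum>i<nsub d. form_a (Sub d i) (u i) (v i))"

definition broken_b :: "fetidp \<Rightarrow> broken \<Rightarrow> (pt \<Rightarrow> real) \<Rightarrow> real" where
  "broken_b d u q = (\<Sum>i<nsub d. form_b (Sub d i) (u i) q)"

text \<open>A coordinate of \<open>W_tilde\<close> is a velocity or a pressure. Giving every coordinate both a velocity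
  and a pressure basis function, one of them zero, turns all sixteen blocks of \<open>A_tilde\<close>
  into the single formula of \<open>A_tilde_index\<close>.\<close>

definition coord_velocity :: "fetidp \<Rightarrow> nat \<Rightarrow> broken" where
  "coord_velocity d r = (if r < nVI d then fI d ! r else if r < nVI d + nPI d then (\<lambda>i y. 0)
     else if r < nVI d + nPI d + nDelta d then fDelta d ! (r - (nVI d + nPI d))
     else fPi d ! (r - (nVI d + nPI d + nDelta d)))"

definition coord_pressure :: "fetidp \<Rightarrow> nat \<Rightarrow> pt \<Rightarrow> real" where
  "coord_pressure d r = (if nVI d \<le> r \<and> r < nVI d + nPI d then pbasis d (pI d ! (r - nVI d)) else (\<lambda>y. 0))"

definition velocity :: "fetidp \<Rightarrow> real vec \<Rightarrow> broken" where
  "velocity d w i y = (\<Sum>r<nW d. w $ r *\<^sub>R coord_velocity d r i y)"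

definition pressure :: "fetidp \<Rightarrow> real vec \<Rightarrow> pt \<Rightarrow> real" where
  "pressure d w y = (\<Sum>r<nW d. w $ r * coord_pressure d r y)"

lemma broken_zero [simp]:
  "broken_a d (\<lambda>i y. 0) v = 0" "broken_a d v (\<lambda>i y. 0) = 0" "broken_b d (\<lambda>i y. 0) q = 0" "broken_b d v (\<lambda>y. 0) = 0"
  unfolding broken_a_def broken_b_def by simp_all

lemma length_broken_lists [simp]:
  "length (fI d) = nVI d" "length (pI d) = nPI d" "length (fDelta d) = nDelta d" "length (fPi d) = nPi d"
  "length (pGamma d) = nPGamma d"
  unfolding fI_def fDelta_def fPi_def nVI_def nPI_def nDelta_def nPGamma_def by simp_all

lemma blockA_dim [simp]: "dim_row (blockA d U V) = length U" "dim_col (blockA d U V) = length V"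
  unfolding blockA_def by auto

lemma blockB_dim [simp]: "dim_row (blockB d P V) = length P" "dim_col (blockB d P V) = length V"
  unfolding blockB_def by auto

lemma blockA_index [simp]: "r < length U \<Longrightarrow> c < length V \<Longrightarrow> blockA d U V $$ (r, c) = broken_a d (U ! r) (V ! c)"
  unfolding blockA_def broken_a_def by auto

lemma blockB_index [simp]: "r < length P \<Longrightarrow> c < length V \<Longrightarrow> blockB d P V $$ (r, c) = broken_b d (V ! c) (pbasis d (P ! r))"
  unfolding blockB_def broken_b_def by auto

lemma A_tilde_carrier: "A_tilde d \<in> carrier_mat (nW d) (nW d)"
  unfolding A_tilde_def Let_def nW_def carrier_mat_def by (simp add: append_rows_dim)

lemma coord_cases:
  assumes "r < nW d"
  obtains "r < nVI d"
    | s where "s < nPI d" "r = nVI d + s"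
    | s where "s < nDelta d" "r = nVI d + nPI d + s"
    | s where "s < nPi d" "r = nVI d + nPI d + nDelta d + s"
proof -
  consider "r < nVI d" | "nVI d \<le> r" "r - nVI d < nPI d"
    | "nVI d + nPI d \<le> r" "r - (nVI d + nPI d) < nDelta d"
    | "nVI d + nPI d + nDelta d \<le> r" "r - (nVI d + nPI d + nDelta d) < nPi d"
    using assms unfolding nW_def by linarith
  then show thesis using that by cases (metis le_add_diff_inverse)+
qed

lemma coord_simps [simp]:
  "r < nVI d \<Longrightarrow> coord_velocity d r = fI d ! r"
  "s < nPI d \<Longrightarrow> coord_velocity d (nVI d + s) = (\<lambda>i y. 0)"
  "s < nDelta d \<Longrightarrow> coord_velocity d (nVI d + nPI d + s) = fDelta d ! s"
  "s < nPi d \<Longrightarrow> coord_velocity d (nVI d + nPI d + nDelta d + s) = fPi d ! s"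
  "r < nVI d \<Longrightarrow> coord_pressure d r = (\<lambda>y. 0)"
  "s < nPI d \<Longrightarrow> coord_pressure d (nVI d + s) = pbasis d (pI d ! s)"
  "coord_pressure d (nVI d + nPI d + s) = (\<lambda>y. 0)"
  unfolding coord_velocity_def coord_pressure_def by auto

lemma coord_pressure_Pi [simp]: "coord_pressure d (nVI d + nPI d + nDelta d + s) = (\<lambda>y. 0)"
  unfolding coord_pressure_def by auto

lemma A_tilde_index:
  assumes "r < nW d" "c < nW d"
  shows "A_tilde d $$ (r, c) = broken_a d (coord_velocity d r) (coord_velocity d c)
    + broken_b d (coord_velocity d c) (coord_pressure d r) + broken_b d (coord_velocity d r) (coord_pressure d c)"
proof (cases rule: coord_cases[OF assms(1), case_names I P D Pi])
  case I
  show ?thesis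
    by (cases rule: coord_cases[OF assms(2)])
      (use I in \<open>simp_all add: A_tilde_def Let_def append_rows_index append_rows_dim\<close>)
next
  case (P s)
  show ?thesis
    by (cases rule: coord_cases[OF assms(2)])
      (use P in \<open>simp_all add: A_tilde_def Let_def append_rows_index append_rows_dim\<close>)
next
  case (D s)
  show ?thesis
    by (cases rule: coord_cases[OF assms(2)])
      (use D in \<open>simp_all add: A_tilde_def Let_def append_rows_index append_rows_dim\<close>)
next
  case (Pi s)
  show ?thesis
    by (cases rule: coord_cases[OF assms(2)])
      (use Pi in \<open>simp_all add: A_tilde_def Let_def append_rows_index append_rows_dim\<close>)
qed

text \<open>The same block row occurs twice: with the interior pressures it defines
  \<open>W_tilde0\<close>, with the interface pressures it is the upper part of
  \<open>B_C\<close>.\<close>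

lemma constraint_index:
  assumes "r < length Q" "c < nW d"
  shows "(blockB d Q (fI d) @\<^sub>c 0\<^sub>m (length Q) (nPI d) @\<^sub>c blockB d Q (fDelta d) @\<^sub>c blockB d Q (fPi d)) $$ (r, c)
    = broken_b d (coord_velocity d c) (pbasis d (Q ! r))"
  by (cases rule: coord_cases[OF assms(2)]) (use assms(1) in simp_all)

lemma R_Delta_carrier: "R_Delta d \<in> carrier_mat (nDelta d) (nW d)"
  unfolding R_Delta_def nW_def carrier_mat_def by simp

lemma R_Delta_index:
  assumes "r < nDelta d" "c < nW d"
  shows "R_Delta d $$ (r, c) = (if c = nVI d + nPI d + r then 1 else 0)"
  by (cases rule: coord_cases[OF assms(2)]) (use assms(1) in \<open>auto simp: R_Delta_def\<close>)

lemma B_C_carrier: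
  assumes "dim_col (BDelta d) = nDelta d"
  shows "B_C d \<in> carrier_mat (nX d) (nW d)"
  using assms unfolding B_C_def nX_def nW_def carrier_mat_def by (simp add: append_rows_dim nLambda_def)

lemma R_Delta_mult:
  assumes "w \<in> carrier_vec (nW d)"
  shows "R_Delta d *\<^sub>v w = vec (nDelta d) (\<lambda>j. w $ (nVI d + nPI d + j))"
proof (rule eq_vecI)
  fix j assume j: "j < dim_vec (vec (nDelta d) (\<lambda>j. w $ (nVI d + nPI d + j)))"
  then have "(R_Delta d *\<^sub>v w) $ j = (\<Sum>c<nW d. if c = nVI d + nPI d + j then w $ c else 0)"
    by (simp add: mult_mat_vec_sum[OF R_Delta_carrier assms] R_Delta_index if_distrib[of "\<lambda>x. x * _"] cong: if_cong sum.cong_simp)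
  then show "(R_Delta d *\<^sub>v w) $ j = vec (nDelta d) (\<lambda>j. w $ (nVI d + nPI d + j)) $ j"
    using j by (simp add: nW_def if_distrib[of "\<lambda>x. x * _"] cong: if_cong)
qed (use R_Delta_carrier[of d] in auto)

lemma BDelta_R_Delta_mult:
  assumes "w \<in> carrier_vec (nW d)" "dim_col (BDelta d) = nDelta d"
  shows "(0\<^sub>m (nLambda d) (nVI d) @\<^sub>c 0\<^sub>m (nLambda d) (nPI d) @\<^sub>c BDelta d @\<^sub>c 0\<^sub>m (nLambda d) (nPi d)) *\<^sub>v w
    = BDelta d *\<^sub>v (R_Delta d *\<^sub>v w)" (is "?L *\<^sub>v w = _")
proof -
  have BD: "BDelta d \<in> carrier_mat (nLambda d) (nDelta d)" using assms(2) unfolding nLambda_def by auto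
  have "?L = BDelta d * R_Delta d"
  proof (rule eq_matI)
    fix r c assume rc: "r < dim_row (BDelta d * R_Delta d)" "c < dim_col (BDelta d * R_Delta d)"
    then have r: "r < nLambda d" and c: "c < nW d" using R_Delta_carrier[of d] BD by auto
    have "(BDelta d * R_Delta d) $$ (r, c) = (\<Sum>j<nDelta d. BDelta d $$ (r, j) * R_Delta d $$ (j, c))"
      using rc BD R_Delta_carrier[of d] by (simp add: scalar_prod_def atLeast0LessThan)
    also have "\<dots> = (\<Sum>j<nDelta d. if c = nVI d + nPI d + j then BDelta d $$ (r, j) else 0)"
      using c by (intro sum.cong) (auto simp: R_Delta_index)
    also have "\<dots> = ?L $$ (r, c)"
      by (cases rule: coord_cases[OF c]) (use r BD in auto)
    finally show "?L $$ (r, c) = (BDelta d * R_Delta d) $$ (r, c)" by simp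
  qed (use BD R_Delta_carrier[of d] in \<open>auto simp: nW_def\<close>)
  then show ?thesis using assoc_mult_mat_vec[OF BD R_Delta_carrier assms(1)] by simp
qed

section \<open>Broken forms of a discretization\<close>

locale fetidp_discretization =
  fixes \<Omega> :: "pt set" and \<sigma> \<kappa> cZ CZ :: real and d :: fetidp
  assumes domain: "polygonal_domain \<Omega>"
    and cZ_pos: "0 < cZ" and CZ_pos: "0 < CZ"
    and setting: "fetidp_setting \<Omega> \<sigma> \<kappa> cZ CZ d"
begin

lemma Omega_eq [simp]: "Omega d = \<Omega>"
  and hmesh_pos: "0 < hmesh d"
  and decomposition: "decomposition \<kappa> d"
  and dofs: "decomposition_dofs d"
  and jump: "jump_matrix d"
  and mass: "mass_matrix_bounds cZ CZ d"
  and kernel: "kernel_constants d"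
  and A_tilde_invertible: "invertible_mat (A_tilde d)"
  using setting unfolding fetidp_setting_def by auto

lemma coarse_mesh:
  "finite (Mesh d)" "T \<in> Mesh d \<Longrightarrow> 2 simplex T" "\<Union>(Mesh d) = closure \<Omega>"
  using setting unfolding fetidp_setting_def triangular_mesh_def triangulation_def by auto

lemma coarse_cell: "T \<in> Mesh d \<Longrightarrow> convex T" "T \<in> Mesh d \<Longrightarrow> compact T"
  using coarse_mesh(2) simplex_cell by blast+

abbreviation "refined \<equiv> midpoint_refinement (Mesh d)"

sublocale cell_cover refined
  using finite_midpoint_refinement[OF coarse_mesh(1,2)] midpoint_refinement_cell
  by unfold_locales auto

lemma Union_refined: "\<Union>refined = closure \<Omega>"
proof -
  have "\<Union>refined = \<Union>(Mesh d)"
  proof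
    show "\<Union>refined \<subseteq> \<Union>(Mesh d)"
    proof
      fix y assume "y \<in> \<Union>refined"
      then obtain T' where T': "T' \<in> refined" "y \<in> T'" by blast
      obtain T where "T \<in> Mesh d" "T' \<subseteq> T" by (rule midpoint_refinement_subset[OF T'(1)])
      then show "y \<in> \<Union>(Mesh d)" using T'(2) by blast
    qed
    show "\<Union>(Mesh d) \<subseteq> \<Union>refined"
    proof
      fix y assume "y \<in> \<Union>(Mesh d)"
      then obtain T where T: "T \<in> Mesh d" "y \<in> T" by blast
      obtain T' where "T' \<in> refined" "y \<in> T'" by (rule midpoint_refinement_cover[OF T(1) coarse_mesh(2)[OF T(1)] T(2)])
      then show "y \<in> \<Union>refined" by blast
    qed
  qed
  then show ?thesis using coarse_mesh(3) by simp
qed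

lemma Omega_open: "open \<Omega>" and Omega_nonempty: "\<Omega> \<noteq> {}" and Omega_bounded: "bounded \<Omega>"
  using domain unfolding polygonal_domain_def by auto

lemma Omega_cover: "\<Omega> \<in> sets lebesgue" "\<Omega> \<subseteq> \<Union>refined"
  using Omega_open Union_refined closure_subset by (auto simp: borel_open)

lemma Sub_polygonal: "i < nsub d \<Longrightarrow> polygonal_domain (Sub d i)"
  and Sub_subset: "i < nsub d \<Longrightarrow> Sub d i \<subseteq> \<Omega>"
  and Sub_closure: "i < nsub d \<Longrightarrow> closure (Sub d i) = \<Union>{T \<in> Mesh d. T \<subseteq> closure (Sub d i)}"
  and Sub_disjoint: "i < nsub d \<Longrightarrow> j < nsub d \<Longrightarrow> i \<noteq> j \<Longrightarrow> Sub d i \<inter> Sub d j = {}"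
  and Sub_union: "closure \<Omega> = (\<Union>i<nsub d. closure (Sub d i))"
  using decomposition unfolding decomposition_def Omega_eq by blast+

lemma Sub_open: "i < nsub d \<Longrightarrow> open (Sub d i)"
  using Sub_polygonal unfolding polygonal_domain_def by blast

lemma Sub_cover: "i < nsub d \<Longrightarrow> Sub d i \<in> sets lebesgue" "i < nsub d \<Longrightarrow> Sub d i \<subseteq> \<Union>refined"
  using Sub_open subset_trans[OF Sub_subset Omega_cover(2)] by (simp_all add: borel_open)

text \<open>The closed subdomains cover the domain, so a point missed by the open ones lies on one
  of the null frontiers.\<close>

lemma Sub_exhaust: "negligible (\<Omega> - \<Union>(Sub d ` {..<nsub d}))"
proof (rule negligible_subset)
  show "negligible (\<Union>i<nsub d. frontier (Sub d i))"
    using negligible_polygonal_frontier[OF Sub_polygonal] by (intro negligible_Union) auto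
  show "\<Omega> - \<Union>(Sub d ` {..<nsub d}) \<subseteq> (\<Union>i<nsub d. frontier (Sub d i))"
  proof
    fix x assume x: "x \<in> \<Omega> - \<Union>(Sub d ` {..<nsub d})"
    then obtain i where i: "i < nsub d" "x \<in> closure (Sub d i)"
      using Sub_union closure_subset[of \<Omega>] by blast
    then have "x \<in> frontier (Sub d i)"
      using x Sub_open[OF i(1)] unfolding frontier_def by (auto simp: interior_open)
    then show "x \<in> (\<Union>i<nsub d. frontier (Sub d i))" using i by blast
  qed
qed

lemma integral_Sub:
  fixes f :: "pt \<Rightarrow> real"
  assumes "f absolutely_integrable_on \<Omega>"
  shows "set_lebesgue_integral lebesgue \<Omega> f = (\<Sum>i<nsub d. set_lebesgue_integral lebesgue (Sub d i) f)"
proof (rule integral_partition[OF assms finite_lessThan])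
  show "open (Sub d i)" if "i \<in> {..<nsub d}" for i using that Sub_open by blast
  show "Sub d i \<subseteq> \<Omega>" if "i \<in> {..<nsub d}" for i using that Sub_subset by blast
  show "Sub d i \<inter> Sub d j = {}" if "i \<in> {..<nsub d}" "j \<in> {..<nsub d}" "i \<noteq> j" for i j
    using that Sub_disjoint[of i j] by simp
qed (rule Sub_exhaust)

lemma dof_facts:
  shows velocity_basis: "nodal_basis refined (vbasis d)"
    and pressure_basis: "nodal_basis (Mesh d) (pbasis d)"
    and vI_set: "set (vI d) = (mesh_nodes refined \<inter> \<Omega> - Interface d) \<times> Basis"
    and vGamma_set: "set (vGamma d) = (mesh_nodes refined \<inter> \<Omega> \<inter> Interface d) \<times> Basis"
    and pI_set: "set (pI d) = {x \<in> mesh_nodes (Mesh d). card (sharing d x) < 2}"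
    and pGamma_set: "set (pGamma d) = {x \<in> mesh_nodes (Mesh d). card (sharing d x) \<ge> 2}"
    and pI_distinct: "distinct (pI d)" and pGamma_distinct: "distinct (pGamma d)"
    and Tr_carrier: "Tr d \<in> carrier_mat (length (vGamma d)) (length (vGamma d))"
    and Tr_invertible: "invertible_mat (Tr d)"
    and nPi_le: "nPi d \<le> length (vGamma d)"
    and dDelta_distinct: "distinct (dDelta d)"
    and dDelta_set: "set (dDelta d) = {(i, k). nPi d \<le> k \<and> k < length (vGamma d) \<and> i \<in> dof_sharing d k}"
  using dofs unfolding decomposition_dofs_def Let_def Omega_eq by - (elim conjE, assumption)+

lemma pressure_distinct: "distinct (pI d @ pGamma d)"
  using pI_distinct pGamma_distinct pI_set pGamma_set by auto

lemma pressure_nodes: "set (pI d @ pGamma d) = mesh_nodes (Mesh d)"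
  using pI_set pGamma_set by auto

lemma pw_affine_vfun:
  assumes "z \<in> set (vI d @ vGamma d)"
  shows "pw_affine (vfun d z)"
proof -
  have "fst z \<in> mesh_nodes refined" using assms vI_set vGamma_set by auto
  then have "vbasis d (fst z) \<in> P1_functions refined" using velocity_basis unfolding nodal_basis_def by blast
  then show ?thesis
    unfolding pw_affine_def vfun_def by (intro ballI affine_on_scaleR_right P1_affine_on)
qed

lemma pw_affine_interface_fun: "pw_affine (interface_fun d k)"
  unfolding interface_fun_def by (rule pw_affine_sum) (simp add: pw_affine_vfun)

lemma pw_affine_coord_velocity:
  assumes "r < nW d"
  shows "pw_affine (coord_velocity d r i)"
proof (cases rule: coord_cases[OF assms])
  case 1
  then show ?thesis by (simp add: fI_def nVI_def pw_affine_vfun)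
next
  case (2 s)
  then show ?thesis by (simp add: pw_affine_zero)
next
  case (3 s)
  then show ?thesis
    by (simp add: fDelta_def nDelta_def pw_affine_zero pw_affine_interface_fun split: prod.split)
next
  case (4 s)
  then show ?thesis by (simp add: fPi_def pw_affine_interface_fun)
qed

lemma pw_affine_velocity: "pw_affine (velocity d w i)"
  unfolding velocity_def[abs_def] by (rule pw_affine_sum) (simp add: pw_affine_coord_velocity)

lemma continuous_pbasis:
  assumes "x \<in> mesh_nodes (Mesh d)"
  shows "continuous_on (\<Union>refined) (pbasis d x)"
proof -
  have "pbasis d x \<in> P1_functions (Mesh d)" using assms pressure_basis unfolding nodal_basis_def by blast
  then show ?thesis unfolding Union_refined coarse_mesh(3)[symmetric] P1_functions_def by blast
qed

lemma continuous_pbasis_nth: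
  assumes "r < length (pI d @ pGamma d)"
  shows "continuous_on (\<Union>refined) (pbasis d ((pI d @ pGamma d) ! r))"
  using nth_mem[OF assms] unfolding pressure_nodes by (rule continuous_pbasis)

lemma continuous_coord_pressure: "continuous_on (\<Union>refined) (coord_pressure d r)"
proof -
  have "continuous_on (\<Union>refined) (pbasis d (pI d ! s))" if "s < nPI d" for s
    using continuous_pbasis[of "pI d ! s"] nth_mem[of s "pI d"] that pI_set by simp
  from this[of "r - nVI d"] show ?thesis unfolding coord_pressure_def by (simp add: less_diff_conv2)
qed

lemma continuous_pressure: "continuous_on (\<Union>refined) (pressure d w)"
  unfolding pressure_def[abs_def] by (intro continuous_intros continuous_coord_pressure)

lemma pressure_fun_eq: "pressure_fun d q = (\<lambda>y. \<Sum>r<length (pI d @ pGamma d). q $ r * pbasis d ((pI d @ pGamma d) ! r) y)"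
  unfolding pressure_fun_def Let_def by simp

lemma continuous_pressure_fun: "continuous_on (\<Union>refined) (pressure_fun d q)"
  unfolding pressure_fun_eq using continuous_pbasis_nth by (intro continuous_intros) auto

lemma broken_a_commute: "broken_a d u v = broken_a d v u"
  unfolding broken_a_def using form_a_commute Sub_cover by (intro sum.cong) auto

lemma broken_a_velocity_left:
  assumes "\<And>i. pw_affine (v i)"
  shows "broken_a d (velocity d w) v = (\<Sum>r<nW d. w $ r * broken_a d (coord_velocity d r) v)"
proof -
  have "broken_a d (velocity d w) v = (\<Sum>i<nsub d. \<Sum>r<nW d. w $ r * form_a (Sub d i) (coord_velocity d r i) (v i))"
    unfolding broken_a_def velocity_def[abs_def]
    using Sub_cover by (intro sum.cong refl form_a_sum) (auto simp: pw_affine_coord_velocity assms)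
  then show ?thesis unfolding broken_a_def by (simp add: sum_distrib_left sum.swap[of _ "{..<nsub d}"])
qed

lemma broken_a_velocity:
  "broken_a d (velocity d w) (velocity d v) = (\<Sum>r<nW d. w $ r * (\<Sum>c<nW d. v $ c * broken_a d (coord_velocity d r) (coord_velocity d c)))"
proof -
  have "broken_a d (coord_velocity d r) (velocity d v) = (\<Sum>c<nW d. v $ c * broken_a d (coord_velocity d r) (coord_velocity d c))"
    if "r < nW d" for r
    using broken_a_velocity_left[of "coord_velocity d r" v] that
    by (simp add: pw_affine_coord_velocity broken_a_commute[of "coord_velocity d r"])
  then show ?thesis by (simp add: broken_a_velocity_left pw_affine_velocity)
qed

lemma broken_b_velocity:
  assumes "continuous_on (\<Union>refined) q"
  shows "broken_b d (velocity d w) q = (\<Sum>r<nW d. w $ r * broken_b d (coord_velocity d r) q)"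
proof -
  have "broken_b d (velocity d w) q = (\<Sum>i<nsub d. \<Sum>r<nW d. w $ r * form_b (Sub d i) (coord_velocity d r i) q)"
    unfolding broken_b_def velocity_def[abs_def]
    using Sub_cover by (intro sum.cong refl form_b_sum) (auto simp: pw_affine_coord_velocity assms)
  then show ?thesis unfolding broken_b_def by (simp add: sum_distrib_left sum.swap[of _ "{..<nsub d}"])
qed

lemma broken_b_sum:
  assumes "finite I" "\<And>i. pw_affine (u i)" "\<And>r. r \<in> I \<Longrightarrow> continuous_on (\<Union>refined) (p r)"
  shows "broken_b d u (\<lambda>y. \<Sum>r\<in>I. c r * p r y) = (\<Sum>r\<in>I. c r * broken_b d u (p r))"
proof -
  have "broken_b d u (\<lambda>y. \<Sum>r\<in>I. c r * p r y) = (\<Sum>i<nsub d. \<Sum>r\<in>I. c r * form_b (Sub d i) (u i) (p r))"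
    unfolding broken_b_def
    using Sub_cover assms by (intro sum.cong refl form_b_sum_pressure) auto
  then show ?thesis unfolding broken_b_def by (simp add: sum_distrib_left sum.swap[of _ "{..<nsub d}"])
qed

lemma broken_b_velocity_pressure:
  "broken_b d (velocity d w) (pressure d v) = (\<Sum>r<nW d. w $ r * (\<Sum>c<nW d. v $ c * broken_b d (coord_velocity d r) (coord_pressure d c)))"
  unfolding broken_b_velocity[OF continuous_pressure]
  unfolding pressure_def[abs_def]
  by (intro sum.cong refl arg_cong2[where f="(*)"] broken_b_sum) (auto simp: pw_affine_coord_velocity continuous_coord_pressure)

lemma broken_a_nonneg: "0 \<le> broken_a d u u"
  unfolding broken_a_def using form_a_nonneg Sub_cover by (intro sum_nonneg) auto

text \<open>The Young estimates of all subdomains are added with one common \<open>t\<close>, and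
  the discriminant criterion then gives the product form for the sums.\<close>

lemma broken_b_square_le:
  assumes "\<And>i. pw_affine (u i)" "continuous_on (\<Union>refined) q"
  shows "(broken_b d u q)\<^sup>2 \<le> 2 * broken_a d u u * set_lebesgue_integral lebesgue \<Omega> (\<lambda>y. q y * q y)"
proof (rule discriminant_le)
  fix t
  have "2 * t * broken_b d u q = (\<Sum>i<nsub d. 2 * t * form_b (Sub d i) (u i) q)"
    unfolding broken_b_def by (simp add: sum_distrib_left)
  also have "\<dots> \<le> (\<Sum>i<nsub d. 2 * t\<^sup>2 * form_a (Sub d i) (u i) (u i) + set_lebesgue_integral lebesgue (Sub d i) (\<lambda>y. q y * q y))"
    using Sub_cover assms by (intro sum_mono form_b_young) auto
  also have "\<dots> = t\<^sup>2 * (2 * broken_a d u u) + set_lebesgue_integral lebesgue \<Omega> (\<lambda>y. q y * q y)"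
    unfolding broken_a_def integral_Sub[OF pressure_integrable(2)[OF Omega_cover assms(2,2)]]
    by (simp add: sum.distrib sum_distrib_left mult_ac)
  finally show "2 * t * broken_b d u q \<le> t\<^sup>2 * (2 * broken_a d u u) + set_lebesgue_integral lebesgue \<Omega> (\<lambda>y. q y * q y)" .
qed (use broken_a_nonneg in simp)

lemma A_tilde_form:
  assumes "v \<in> carrier_vec (nW d)"
  shows "w \<bullet> (A_tilde d *\<^sub>v v) = broken_a d (velocity d w) (velocity d v)
    + broken_b d (velocity d v) (pressure d w) + broken_b d (velocity d w) (pressure d v)"
proof -
  have "w \<bullet> (A_tilde d *\<^sub>v v) = (\<Sum>r<nW d. w $ r * (\<Sum>c<nW d. v $ c *
     (broken_a d (coord_velocity d r) (coord_velocity d c)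
    + broken_b d (coord_velocity d c) (coord_pressure d r) + broken_b d (coord_velocity d r) (coord_pressure d c))))"
    using form_sum[OF A_tilde_carrier assms] by (simp add: A_tilde_index)
  also have "\<dots> = broken_a d (velocity d w) (velocity d v)
    + (\<Sum>r<nW d. w $ r * (\<Sum>c<nW d. v $ c * broken_b d (coord_velocity d c) (coord_pressure d r)))
    + broken_b d (velocity d w) (pressure d v)"
    unfolding broken_a_velocity broken_b_velocity_pressure by (simp add: algebra_simps sum.distrib)
  also have "(\<Sum>r<nW d. w $ r * (\<Sum>c<nW d. v $ c * broken_b d (coord_velocity d c) (coord_pressure d r))) =
      broken_b d (velocity d v) (pressure d w)"
    unfolding broken_b_velocity_pressure sum_distrib_left by (subst sum.swap) (simp add: mult.left_commute)
  finally show ?thesis .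
qed

lemma A_tilde_symmetric: "transpose_mat (A_tilde d) = A_tilde d"
  using A_tilde_carrier[of d] broken_a_commute
  by (intro eq_matI) (auto simp: A_tilde_index)

end

section \<open>Continuous velocities\<close>

lemma sum_lessThan_add:
  fixes f :: "nat \<Rightarrow> 'a::comm_monoid_add"
  shows "(\<Sum>r<m + n. f r) = (\<Sum>r<m. f r) + (\<Sum>s<n. f (m + s))"
  by (induction n) (simp_all add: add.assoc)

lemma length_dof_lists [simp]: "length (vI d) = nVI d" "length (dDelta d) = nDelta d"
  unfolding nVI_def nDelta_def by simp_all

context fetidp_discretization
begin

abbreviation "nG \<equiv> length (vGamma d)"
abbreviation "nQ \<equiv> nPI d + nPGamma d"

text \<open>The intermediate description through which broken and conforming velocities are
  compared: \<open>a\<close> holds interior nodal values and \<open>b\<close> coefficients in the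
  basis given by the columns of \<open>Tr\<close>.\<close>

definition common_fun :: "(nat \<Rightarrow> real) \<Rightarrow> (nat \<Rightarrow> real) \<Rightarrow> pt \<Rightarrow> pt" where
  "common_fun a b y = (\<Sum>r<nVI d. a r *\<^sub>R vfun d (vI d ! r) y) + (\<Sum>k<nG. b k *\<^sub>R interface_fun d k y)"

definition conforming_fun :: "real vec \<Rightarrow> pt \<Rightarrow> pt" where
  "conforming_fun v y = (\<Sum>r<nVI d + nG. v $ r *\<^sub>R vfun d ((vI d @ vGamma d) ! r) y)"

text \<open>Equality on the open subdomains is all that the forms can see; their frontiers are null
  sets.\<close>

definition represents :: "real vec \<Rightarrow> real vec \<Rightarrow> bool" where
  "represents w v \<longleftrightarrow> (\<forall>i<nsub d. \<forall>y\<in>Sub d i. velocity d w i y = conforming_fun v y)"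

text \<open>A point of the subdomain lies in a refined cell inside the closed subdomain. If the
  subdomain does not share the degree of freedom, this cell contains none of its nodes, so all nodal
  functions involved vanish there.\<close>

lemma interface_fun_zero:
  assumes "i < nsub d" "i \<notin> dof_sharing d k" "y \<in> Sub d i"
  shows "interface_fun d k y = 0"
proof -
  have "Tr d $$ (g, k) *\<^sub>R vfun d (vGamma d ! g) y = 0" if g: "g < nG" for g
  proof (cases "Tr d $$ (g, k) = 0")
    case False
    let ?x = "fst (vGamma d ! g)"
    have "?x \<in> dof_nodes d k" using False g unfolding dof_nodes_def by blast
    then have x: "?x \<notin> closure (Sub d i)"
      using assms(1,2) unfolding dof_sharing_def sharing_def by blast
    have "y \<in> closure (Sub d i)" using assms(3) closure_subset by blast
    then obtain T where T: "T \<in> Mesh d" "T \<subseteq> closure (Sub d i)" "y \<in> T"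
      using Sub_closure[OF assms(1)] by blast
    obtain T' where T': "T' \<in> refined" "T' \<subseteq> T" "y \<in> T'"
      by (rule midpoint_refinement_cover[OF T(1) coarse_mesh(2)[OF T(1)] T(3)])
    have "?x \<in> mesh_nodes refined" using nth_mem[OF g] vGamma_set by auto
    then have "vbasis d ?x y = 0"
      by (rule nodal_basis_zero[OF velocity_basis _ T'(1) compact_cell[OF T'(1)] convex_cell[OF T'(1)] _ T'(3)])
        (use x T' T in blast)
    then show ?thesis unfolding vfun_def by simp
  qed simp
  then show ?thesis unfolding interface_fun_def by (intro sum.neutral) simp
qed

lemma velocity_common:
  assumes "\<And>r. r < nVI d \<Longrightarrow> w $ r = a r"
    and "\<And>j. j < nDelta d \<Longrightarrow> w $ (nVI d + nPI d + j) = b (snd (dDelta d ! j))"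
    and "\<And>k. k < nPi d \<Longrightarrow> w $ (nVI d + nPI d + nDelta d + k) = b k"
    and i: "i < nsub d" and y: "y \<in> Sub d i"
  shows "velocity d w i y = common_fun a b y"
proof -
  let ?h = "\<lambda>x. b (snd x) *\<^sub>R (if i = fst x then interface_fun d (snd x) y else 0)"
  let ?K = "{k \<in> {nPi d..<nG}. i \<in> dof_sharing d k}"
  have "velocity d w i y = (\<Sum>r<nVI d. a r *\<^sub>R vfun d (vI d ! r) y)
      + (\<Sum>j<nDelta d. ?h (dDelta d ! j)) + (\<Sum>k<nPi d. b k *\<^sub>R interface_fun d k y)"
    unfolding velocity_def nW_def
    by (simp add: sum_lessThan_add assms(1-3) fI_def fDelta_def fPi_def if_distrib[of "\<lambda>f. f y"] case_prod_beta
        cong: sum.cong_simp if_cong)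
  \<comment> \<open>The dual coordinates are listed by copies. In subdomain \<open>i\<close> only
    the copies with first component \<open>i\<close> contribute.\<close>
  also have "(\<Sum>j<nDelta d. ?h (dDelta d ! j)) = sum ?h (set (dDelta d))"
    by (rule sum.reindex_bij_betw[OF bij_betw_nth[OF dDelta_distinct]]) auto
  also have "\<dots> = sum ?h (Pair i ` ?K)"
  proof (rule sum.mono_neutral_right)
    show "Pair i ` ?K \<subseteq> set (dDelta d)" unfolding dDelta_set by auto
    show "\<forall>x\<in>set (dDelta d) - Pair i ` ?K. ?h x = 0" unfolding dDelta_set by auto
  qed simp
  also have "\<dots> = (\<Sum>k\<in>?K. b k *\<^sub>R interface_fun d k y)"
    by (subst sum.reindex) (auto simp: inj_on_def)
  \<comment> \<open>Dual functions not shared by subdomain \<open>i\<close> vanish in it, so they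
    may be added. The resulting sum has the same form in every subdomain, which is
    continuity.\<close>
  also have "\<dots> = (\<Sum>k\<in>{nPi d..<nG}. b k *\<^sub>R interface_fun d k y)"
    by (rule sum.mono_neutral_left) (auto simp: interface_fun_zero[OF i _ y])
  also have "(\<Sum>r<nVI d. a r *\<^sub>R vfun d (vI d ! r) y) + (\<Sum>k\<in>{nPi d..<nG}. b k *\<^sub>R interface_fun d k y)
      + (\<Sum>k<nPi d. b k *\<^sub>R interface_fun d k y) = common_fun a b y"
    unfolding common_fun_def lessThan_atLeast0
    using sum.atLeastLessThan_concat[OF le0 nPi_le, of "\<lambda>k. b k *\<^sub>R interface_fun d k y"]
    by (simp add: add.assoc add.commute)
  finally show ?thesis .
qed

lemma conforming_common:
  assumes "\<And>r. r < nVI d \<Longrightarrow> v $ r = a r"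
    and "\<And>g. g < nG \<Longrightarrow> v $ (nVI d + g) = (\<Sum>k<nG. Tr d $$ (g, k) * b k)"
  shows "conforming_fun v y = common_fun a b y"
proof -
  have "conforming_fun v y = (\<Sum>r<nVI d. a r *\<^sub>R vfun d (vI d ! r) y)
      + (\<Sum>g<nG. (\<Sum>k<nG. Tr d $$ (g, k) * b k) *\<^sub>R vfun d (vGamma d ! g) y)"
    unfolding conforming_fun_def
    by (simp add: sum_lessThan_add assms nth_append cong: sum.cong_simp)
  also have "(\<Sum>g<nG. (\<Sum>k<nG. Tr d $$ (g, k) * b k) *\<^sub>R vfun d (vGamma d ! g) y)
     = (\<Sum>k<nG. b k *\<^sub>R interface_fun d k y)"
    unfolding interface_fun_def scaleR_sum_left scaleR_sum_right
    by (subst sum.swap) (simp add: mult.commute)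
  finally show ?thesis unfolding common_fun_def .
qed

lemma BDelta_carrier: "BDelta d \<in> carrier_mat (nLambda d) (nDelta d)"
  using jump unfolding jump_matrix_def nLambda_def by auto

lemma BDelta_kernel:
  assumes "u \<in> carrier_vec (nDelta d)"
  shows "BDelta d *\<^sub>v u = 0\<^sub>v (nLambda d) \<longleftrightarrow>
    (\<forall>c<nDelta d. \<forall>c'<nDelta d. snd (dDelta d ! c) = snd (dDelta d ! c') \<longrightarrow> u $ c = u $ c')"
  using jump assms unfolding jump_matrix_def by blast

lemma continuous_represents:
  assumes w: "w \<in> carrier_vec (nW d)" and "BDelta d *\<^sub>v (R_Delta d *\<^sub>v w) = 0\<^sub>v (nLambda d)"
  obtains v where "v \<in> carrier_vec (nVI d + nG)" "represents w v"
proof -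
  \<comment> \<open>A dual coefficient is read off from an arbitrary copy; the vanishing jump makes
    the choice irrelevant.\<close>
  define b where "b k = (if k < nPi d then w $ (nVI d + nPI d + nDelta d + k)
    else w $ (nVI d + nPI d + (SOME j. j < nDelta d \<and> snd (dDelta d ! j) = k)))" for k
  have eq: "w $ (nVI d + nPI d + c) = w $ (nVI d + nPI d + c')"
    if "c < nDelta d" "c' < nDelta d" "snd (dDelta d ! c) = snd (dDelta d ! c')" for c c'
  proof -
    have "R_Delta d *\<^sub>v w \<in> carrier_vec (nDelta d)" by (rule mult_mat_vec_carrier[OF R_Delta_carrier w])
    from iffD1[OF BDelta_kernel[OF this] assms(2)] that
    have "(R_Delta d *\<^sub>v w) $ c = (R_Delta d *\<^sub>v w) $ c'" by blast
    then show ?thesis using that(1,2) by (simp add: R_Delta_mult[OF w])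
  qed
  have b_Delta: "w $ (nVI d + nPI d + j) = b (snd (dDelta d ! j))" if j: "j < nDelta d" for j
  proof -
    have "dDelta d ! j \<in> set (dDelta d)" using j by simp
    then have "nPi d \<le> snd (dDelta d ! j)" unfolding dDelta_set by auto
    moreover have "w $ (nVI d + nPI d + j) = w $ (nVI d + nPI d + (SOME c. c < nDelta d \<and> snd (dDelta d ! c) = snd (dDelta d ! j)))"
      by (rule someI2[of _ j], simp add: j, rule eq[OF j]) simp_all
    ultimately show ?thesis unfolding b_def by simp
  qed
  define v where "v = vec (nVI d + nG) (\<lambda>r. if r < nVI d then w $ r else \<Sum>k<nG. Tr d $$ (r - nVI d, k) * b k)"
  have "represents w v"
    unfolding represents_def
  proof (intro allI impI ballI)
    fix i y assume "i < nsub d" "y \<in> Sub d i"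
    then have "velocity d w i y = common_fun (($) w) b y"
      by (intro velocity_common b_Delta) (simp_all add: b_def)
    also have "\<dots> = conforming_fun v y"
      by (rule conforming_common[symmetric]) (simp_all add: v_def)
    finally show "velocity d w i y = conforming_fun v y" .
  qed
  then show thesis using that[of v] by (simp add: v_def)
qed

text \<open>An invertible \<open>Tr\<close> has no zero column, and a node in the domain lies in
  some closed subdomain. Hence every dual function has a copy, and its coefficient can be recovered
  from the broken vector.\<close>

lemma dof_sharing_nonempty:
  assumes k: "k < nG"
  shows "\<exists>i. i \<in> dof_sharing d k"
proof -
  have "\<exists>g<nG. Tr d $$ (g, k) \<noteq> 0"
  proof (rule ccontr)
    assume *: "\<not> (\<exists>g<nG. Tr d $$ (g, k) \<noteq> 0)"
    have "Tr d *\<^sub>v unit_vec nG k = 0\<^sub>v nG"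
    proof (rule eq_vecI)
      fix g assume "g < dim_vec (0\<^sub>v nG :: real vec)"
      then have g: "g < nG" by simp
      have "(\<Sum>j<nG. Tr d $$ (g, j) * unit_vec nG k $ j) = 0"
      proof (intro sum.neutral ballI)
        fix j assume "j \<in> {..<nG}"
        then show "Tr d $$ (g, j) * unit_vec nG k $ j = 0"
          using * g k by (cases "j = k") simp_all
      qed
      then show "(Tr d *\<^sub>v unit_vec nG k) $ g = 0\<^sub>v nG $ g"
        unfolding mult_mat_vec_sum[OF Tr_carrier unit_vec_carrier g] using g by simp
    qed (use Tr_carrier in simp)
    then have "unit_vec nG k = (0\<^sub>v nG :: real vec)"
      by (rule invertible_mat_injective[OF Tr_carrier Tr_invertible unit_vec_carrier])
    from arg_cong[OF this, of "\<lambda>u. u $ k"] show False using k by simp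
  qed
  then obtain g where g: "g < nG" "Tr d $$ (g, k) \<noteq> 0" by blast
  let ?x = "fst (vGamma d ! g)"
  have "?x \<in> \<Omega>" using nth_mem[OF g(1)] unfolding vGamma_set mem_Times_iff by blast
  then obtain i where "i < nsub d" "?x \<in> closure (Sub d i)"
    using Sub_union closure_subset[of \<Omega>] by blast
  then have "i \<in> sharing d ?x" unfolding sharing_def by simp
  moreover have "?x \<in> dof_nodes d k" using g unfolding dof_nodes_def by blast
  ultimately show ?thesis unfolding dof_sharing_def by blast
qed

text \<open>The vanishing pressure part and the final injectivity claim let definiteness of the
  energy pass from broken vectors to \<open>A_mat\<close>.\<close>

lemma represents_exists:
  assumes v: "v \<in> carrier_vec (nVI d + nG)"
  obtains w where "w \<in> carrier_vec (nW d)" "\<And>s. s < nPI d \<Longrightarrow> w $ (nVI d + s) = 0"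
    "BDelta d *\<^sub>v (R_Delta d *\<^sub>v w) = 0\<^sub>v (nLambda d)" "represents w v"
    "w = 0\<^sub>v (nW d) \<Longrightarrow> v = 0\<^sub>v (nVI d + nG)"
proof -
  have "vec nG (\<lambda>g. v $ (nVI d + g)) \<in> carrier_vec nG" by simp
  from invertible_mat_surjective[OF Tr_carrier Tr_invertible this]
  obtain b where b: "b \<in> carrier_vec nG" "Tr d *\<^sub>v b = vec nG (\<lambda>g. v $ (nVI d + g))" .
  define w where "w = vec (nW d) (\<lambda>r. if r < nVI d then v $ r else if r < nVI d + nPI d then 0
    else if r < nVI d + nPI d + nDelta d then b $ (snd (dDelta d ! (r - (nVI d + nPI d))))
    else b $ (r - (nVI d + nPI d + nDelta d)))"
  have w: "w \<in> carrier_vec (nW d)" unfolding w_def by simp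
  have wI: "w $ r = v $ r" if "r < nVI d" for r using that unfolding w_def nW_def by simp
  have wP: "w $ (nVI d + s) = 0" if "s < nPI d" for s using that unfolding w_def nW_def by simp
  have wD: "w $ (nVI d + nPI d + j) = b $ (snd (dDelta d ! j))" if "j < nDelta d" for j
    using that unfolding w_def nW_def by simp
  have wPi: "w $ (nVI d + nPI d + nDelta d + k) = b $ k" if "k < nPi d" for k
    using that unfolding w_def nW_def by simp
  have Trb: "v $ (nVI d + g) = (\<Sum>k<nG. Tr d $$ (g, k) * b $ k)" if "g < nG" for g
    using arg_cong[OF b(2), of "\<lambda>u. u $ g"] mult_mat_vec_sum[OF Tr_carrier b(1) that] that by simp
  have jump0: "BDelta d *\<^sub>v (R_Delta d *\<^sub>v w) = 0\<^sub>v (nLambda d)"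
    unfolding R_Delta_mult[OF w] by (subst BDelta_kernel) (simp_all add: wD)
  have rep: "represents w v"
    unfolding represents_def
  proof (intro allI impI ballI)
    fix i y assume "i < nsub d" "y \<in> Sub d i"
    then have "velocity d w i y = common_fun (($) v) (($) b) y"
      by (intro velocity_common) (simp_all add: wI wD wPi)
    also have "\<dots> = conforming_fun v y"
      by (rule conforming_common[symmetric]) (simp_all add: Trb)
    finally show "velocity d w i y = conforming_fun v y" .
  qed
  have "v = 0\<^sub>v (nVI d + nG)" if w0: "w = 0\<^sub>v (nW d)"
  proof -
    have bk: "b $ k = 0" if k: "k < nG" for k
    proof (cases "k < nPi d")
      case True
      then show ?thesis using wPi[OF True] w0 by (simp add: nW_def)
    next
      case False
      obtain i where "i \<in> dof_sharing d k" using dof_sharing_nonempty[OF k] by blast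
      then have "(i, k) \<in> set (dDelta d)" unfolding dDelta_set using False k by simp
      then obtain j where "j < nDelta d" "dDelta d ! j = (i, k)" by (metis in_set_conv_nth length_dof_lists(2))
      then show ?thesis using wD[of j] w0 by (simp add: nW_def)
    qed
    show ?thesis
    proof (rule eq_vecI)
      fix r assume "r < dim_vec (0\<^sub>v (nVI d + nG) :: real vec)"
      then have r: "r < nVI d + nG" by simp
      show "v $ r = 0\<^sub>v (nVI d + nG) $ r"
      proof (cases "r < nVI d")
        case True
        then show ?thesis using wI[OF True] w0 r by (simp add: nW_def)
      next
        case False
        then show ?thesis using Trb[of "r - nVI d"] r bk by simp
      qed
    qed (use v in simp)
  qed
  then show thesis using that[OF w _ jump0 rep] wP by blast
qed

lemma pw_affine_conforming: "pw_affine (conforming_fun v)"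
proof -
  have "(vI d @ vGamma d) ! r \<in> set (vI d @ vGamma d)" if "r < nVI d + nG" for r
    using that by (intro nth_mem) simp
  then show ?thesis
    unfolding conforming_fun_def[abs_def] by (intro pw_affine_sum pw_affine_vfun) simp
qed

lemma represents_form_a:
  assumes "represents w v"
  shows "broken_a d (velocity d w) (velocity d w) = form_a \<Omega> (conforming_fun v) (conforming_fun v)"
proof -
  have "form_a \<Omega> (conforming_fun v) (conforming_fun v) = (\<Sum>i<nsub d. form_a (Sub d i) (conforming_fun v) (conforming_fun v))"
    unfolding form_a_def by (rule integral_Sub[OF grad_product_integrable[OF Omega_cover pw_affine_conforming pw_affine_conforming]])
  also have "\<dots> = (\<Sum>i<nsub d. form_a (Sub d i) (velocity d w i) (velocity d w i))"
    using assms Sub_open unfolding represents_def by (intro sum.cong refl form_cong(1)) auto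
  finally show ?thesis unfolding broken_a_def by simp
qed

lemma represents_form_b:
  assumes "represents w v" "continuous_on (\<Union>refined) q"
  shows "broken_b d (velocity d w) q = form_b \<Omega> (conforming_fun v) q"
proof -
  have "form_b \<Omega> (conforming_fun v) q = (\<Sum>i<nsub d. form_b (Sub d i) (conforming_fun v) q)"
    unfolding form_b_def
    using integral_Sub[OF divergence_integrable[OF Omega_cover pw_affine_conforming assms(2)]] by (simp add: sum_negf)
  also have "\<dots> = (\<Sum>i<nsub d. form_b (Sub d i) (velocity d w i) q)"
    using assms(1) Sub_open unfolding represents_def by (intro sum.cong refl form_cong(2)) auto
  finally show ?thesis unfolding broken_b_def by simp
qed

section \<open>The matrices of the conforming discretization as forms of functions\<close>

lemma A_mat_carrier: "A_mat d \<in> carrier_mat (nVI d + nG) (nVI d + nG)"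
  unfolding A_mat_def Let_def by (intro carrier_matI) simp_all

lemma B_mat_carrier: "B_mat d \<in> carrier_mat nQ (nVI d + nG)"
  unfolding B_mat_def Let_def by (intro carrier_matI) simp_all

lemma Z_mat_carrier: "Z_mat d \<in> carrier_mat nQ nQ"
  unfolding Z_mat_def Let_def by (intro carrier_matI) simp_all

lemma pw_affine_vfun_nth: "r < nVI d + nG \<Longrightarrow> pw_affine (vfun d ((vI d @ vGamma d) ! r))"
  by (rule pw_affine_vfun[OF nth_mem]) simp

lemma A_mat_index:
  "r < nVI d + nG \<Longrightarrow> c < nVI d + nG \<Longrightarrow>
    A_mat d $$ (r, c) = form_a \<Omega> (vfun d ((vI d @ vGamma d) ! r)) (vfun d ((vI d @ vGamma d) ! c))"
  unfolding A_mat_def Let_def by simp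

lemma B_mat_index:
  "r < nQ \<Longrightarrow> c < nVI d + nG \<Longrightarrow>
    B_mat d $$ (r, c) = form_b \<Omega> (vfun d ((vI d @ vGamma d) ! c)) (pbasis d ((pI d @ pGamma d) ! r))"
  unfolding B_mat_def Let_def by simp

lemma Z_mat_index:
  "r < nQ \<Longrightarrow> c < nQ \<Longrightarrow> Z_mat d $$ (r, c) = set_lebesgue_integral lebesgue \<Omega>
    (\<lambda>y. pbasis d ((pI d @ pGamma d) ! r) y * pbasis d ((pI d @ pGamma d) ! c) y)"
  unfolding Z_mat_def Let_def by simp

lemma conforming_fun_eq: "conforming_fun v = (\<lambda>y. \<Sum>r<nVI d + nG. v $ r *\<^sub>R vfun d ((vI d @ vGamma d) ! r) y)"
  unfolding conforming_fun_def by simp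

lemma A_mat_form:
  assumes "v \<in> carrier_vec (nVI d + nG)"
  shows "u \<bullet> (A_mat d *\<^sub>v v) = form_a \<Omega> (conforming_fun u) (conforming_fun v)"
proof -
  have 1: "form_a \<Omega> u' (conforming_fun v) = (\<Sum>c<nVI d + nG. v $ c * form_a \<Omega> u' (vfun d ((vI d @ vGamma d) ! c)))"
    if "pw_affine u'" for u'
    unfolding form_a_commute[OF Omega_cover, of u'] conforming_fun_eq
    by (rule form_a_sum[OF Omega_cover]) (simp_all add: pw_affine_vfun_nth that)
  have "form_a \<Omega> (conforming_fun u) (conforming_fun v)
    = (\<Sum>r<nVI d + nG. u $ r * form_a \<Omega> (vfun d ((vI d @ vGamma d) ! r)) (conforming_fun v))"
    unfolding conforming_fun_eq[of u]
    by (rule form_a_sum[OF Omega_cover]) (simp_all add: pw_affine_vfun_nth pw_affine_conforming)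
  also have "\<dots> = u \<bullet> (A_mat d *\<^sub>v v)"
    unfolding form_sum[OF A_mat_carrier assms]
    by (simp add: 1 pw_affine_vfun_nth A_mat_index cong: sum.cong_simp)
  finally show ?thesis by simp
qed

lemma B_mat_mult:
  assumes "v \<in> carrier_vec (nVI d + nG)" "r < nQ"
  shows "(B_mat d *\<^sub>v v) $ r = form_b \<Omega> (conforming_fun v) (pbasis d ((pI d @ pGamma d) ! r))"
proof -
  have "form_b \<Omega> (conforming_fun v) (pbasis d ((pI d @ pGamma d) ! r))
    = (\<Sum>c<nVI d + nG. v $ c * form_b \<Omega> (vfun d ((vI d @ vGamma d) ! c)) (pbasis d ((pI d @ pGamma d) ! r)))"
    unfolding conforming_fun_eq
    by (rule form_b_sum[OF Omega_cover]) (use assms(2) continuous_pbasis_nth in \<open>simp_all add: pw_affine_vfun_nth\<close>)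
  then show ?thesis
    unfolding mult_mat_vec_sum[OF B_mat_carrier assms]
    using assms(2) by (simp add: B_mat_index mult.commute cong: sum.cong_simp)
qed

lemma Z_mat_form:
  assumes "q \<in> carrier_vec nQ"
  shows "q \<bullet> (Z_mat d *\<^sub>v q) = set_lebesgue_integral lebesgue \<Omega> (\<lambda>y. pressure_fun d q y * pressure_fun d q y)"
proof -
  let ?p = "\<lambda>r. pbasis d ((pI d @ pGamma d) ! r)"
  have ai: "(\<lambda>y. ?p r y * ?p c y) absolutely_integrable_on \<Omega>" if "r < nQ" "c < nQ" for r c
    using pressure_integrable(2)[OF Omega_cover continuous_pbasis_nth continuous_pbasis_nth] that by simp
  have "integral \<Omega> (\<lambda>y. pressure_fun d q y * pressure_fun d q y) = integral \<Omega> (\<lambda>y. \<Sum>r<nQ. \<Sum>c<nQ. q $ r * (q $ c * (?p r y * ?p c y)))"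
    unfolding pressure_fun_eq by (simp add: sum_product mult_ac)
  also have "\<dots> = (\<Sum>r<nQ. \<Sum>c<nQ. q $ r * (q $ c * integral \<Omega> (\<lambda>y. ?p r y * ?p c y)))"
  proof -
    have 1: "(\<lambda>y. q $ r * (q $ c * (?p r y * ?p c y))) integrable_on \<Omega>" if "r < nQ" "c < nQ" for r c
      by (intro integrable_on_mult_right set_lebesgue_integral_eq_integral(1)[OF ai] that)
    then have 2: "(\<lambda>y. \<Sum>c<nQ. q $ r * (q $ c * (?p r y * ?p c y))) integrable_on \<Omega>" if "r < nQ" for r
      using that by (intro integrable_sum) simp_all
    have "integral \<Omega> (\<lambda>y. \<Sum>r<nQ. \<Sum>c<nQ. q $ r * (q $ c * (?p r y * ?p c y)))
      = (\<Sum>r<nQ. integral \<Omega> (\<lambda>y. \<Sum>c<nQ. q $ r * (q $ c * (?p r y * ?p c y))))"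
      using 2 by (intro Henstock_Kurzweil_Integration.integral_sum) simp_all
    also have "\<dots> = (\<Sum>r<nQ. \<Sum>c<nQ. integral \<Omega> (\<lambda>y. q $ r * (q $ c * (?p r y * ?p c y))))"
      using 1 by (intro sum.cong refl Henstock_Kurzweil_Integration.integral_sum) simp_all
    finally show ?thesis by simp
  qed
  also have "\<dots> = (\<Sum>r<nQ. q $ r * (\<Sum>c<nQ. q $ c * Z_mat d $$ (r, c)))"
    using set_lebesgue_integral_eq_integral(2)[OF ai]
    by (simp add: Z_mat_index sum_distrib_left cong: sum.cong_simp)
  finally show ?thesis
    using set_lebesgue_integral_eq_integral(2)[OF pressure_integrable(2)[OF Omega_cover continuous_pressure_fun continuous_pressure_fun], of q q]
      form_sum[OF Z_mat_carrier assms] by simp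
qed

section \<open>Energy and discrete divergence\<close>

text \<open>The velocity part of \<open>A_tilde\<close> in all coordinates, without the divergence
  terms. Being semi-definite on the whole space, it also serves vectors outside
  \<open>W_tilde0\<close>.\<close>

definition energy_mat :: "real mat" where
  "energy_mat = mat (nW d) (nW d) (\<lambda>(r, c). broken_a d (coord_velocity d r) (coord_velocity d c))"

abbreviation energy :: "real vec \<Rightarrow> real" where
  "energy w \<equiv> broken_a d (velocity d w) (velocity d w)"

lemma energy_mat_carrier: "energy_mat \<in> carrier_mat (nW d) (nW d)"
  unfolding energy_mat_def by simp

lemma energy_mat_symmetric: "transpose_mat energy_mat = energy_mat"
  unfolding energy_mat_def using broken_a_commute by (intro eq_matI) auto

lemma energy_mat_form:
  assumes "v \<in> carrier_vec (nW d)"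
  shows "w \<bullet> (energy_mat *\<^sub>v v) = broken_a d (velocity d w) (velocity d v)"
  unfolding form_sum[OF energy_mat_carrier assms] broken_a_velocity
  by (simp add: energy_mat_def cong: sum.cong_simp)

lemma energy_Cauchy_Schwarz:
  assumes "u \<in> carrier_vec (nW d)" "v \<in> carrier_vec (nW d)"
  shows "(broken_a d (velocity d u) (velocity d v))\<^sup>2 \<le> energy u * energy v"
proof -
  have "0 \<le> w \<bullet> (energy_mat *\<^sub>v w)" if "w \<in> carrier_vec (nW d)" for w
    using energy_mat_form[OF that] broken_a_nonneg by simp
  then have "(u \<bullet> (energy_mat *\<^sub>v v))\<^sup>2 \<le> (u \<bullet> (energy_mat *\<^sub>v u)) * (v \<bullet> (energy_mat *\<^sub>v v))"
    using assms by (intro form_Cauchy_Schwarz[OF energy_mat_carrier energy_mat_symmetric assms]) simp_all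
  then show ?thesis using energy_mat_form assms by simp
qed

lemma energy_add_le:
  assumes "u \<in> carrier_vec (nW d)" "v \<in> carrier_vec (nW d)"
  shows "energy (u + 1 \<cdot>\<^sub>v v) \<le> 2 * energy u + 2 * energy v"
proof -
  have uv: "u + t \<cdot>\<^sub>v v \<in> carrier_vec (nW d)" for t using assms by simp
  have *: "energy (u + t \<cdot>\<^sub>v v) = energy u + 2 * t * broken_a d (velocity d u) (velocity d v) + t\<^sup>2 * energy v" for t
    using quadratic_form_add_smult[OF energy_mat_carrier energy_mat_symmetric assms, of t]
    unfolding energy_mat_form[OF assms(1)] energy_mat_form[OF assms(2)] energy_mat_form[OF uv] .
  \<comment> \<open>Adding the energy of the difference gives the parallelogram identity, whence the
    factor 2.\<close>
  have "0 \<le> energy (u + (- 1) \<cdot>\<^sub>v v)" by (rule broken_a_nonneg)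
  then show ?thesis using *[of 1] *[of "- 1"] by simp
qed

text \<open>Interior pressures come first: the first \<open>nPI d\<close> entries are the
  constraints of \<open>W_tilde0\<close>, the others the pressure part of
  \<open>B_C\<close>.\<close>

definition div_vec :: "real vec \<Rightarrow> real vec" where
  "div_vec w = vec nQ (\<lambda>r. broken_b d (velocity d w) (pbasis d ((pI d @ pGamma d) ! r)))"

lemma div_vec_carrier [simp]: "div_vec w \<in> carrier_vec nQ" "dim_vec (div_vec w) = nQ"
  unfolding div_vec_def by simp_all

lemma scalar_prod_div_vec: "q \<bullet> div_vec w = broken_b d (velocity d w) (pressure_fun d q)"
proof -
  have "broken_b d (velocity d w) (pressure_fun d q) = (\<Sum>r<nQ. q $ r * broken_b d (velocity d w) (pbasis d ((pI d @ pGamma d) ! r)))"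
    unfolding pressure_fun_eq
    using broken_b_sum[of "{..<nQ}" "velocity d w" "\<lambda>r. pbasis d ((pI d @ pGamma d) ! r)" "($) q"]
      continuous_pbasis_nth pw_affine_velocity by simp
  then show ?thesis by (simp add: scalar_prod_sum[of _ nQ] div_vec_def)
qed

lemma div_vec_add_smult:
  assumes "u \<in> carrier_vec (nW d)" "v \<in> carrier_vec (nW d)"
  shows "div_vec (u + t \<cdot>\<^sub>v v) = div_vec u + t \<cdot>\<^sub>v div_vec v"
proof (rule eq_vecI)
  fix r assume "r < dim_vec (div_vec u + t \<cdot>\<^sub>v div_vec v)"
  then have r: "r < nQ" by simp
  then have "continuous_on (\<Union>refined) (pbasis d ((pI d @ pGamma d) ! r))"
    by (intro continuous_pbasis_nth) simp
  note * = broken_b_velocity[OF this]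
  show "div_vec (u + t \<cdot>\<^sub>v v) $ r = (div_vec u + t \<cdot>\<^sub>v div_vec v) $ r"
    using r assms unfolding div_vec_def
    by (simp add: * algebra_simps sum.distrib sum_distrib_left)
qed simp

lemma mass_bounds:
  assumes "q \<in> carrier_vec nQ"
  shows "cZ * (hmesh d)\<^sup>2 * (q \<bullet> q) \<le> q \<bullet> (Z_mat d *\<^sub>v q)" "q \<bullet> (Z_mat d *\<^sub>v q) \<le> CZ * (hmesh d)\<^sup>2 * (q \<bullet> q)"
  using mass assms Z_mat_carrier unfolding mass_matrix_bounds_def by auto

lemma scalar_prod_self_nonneg: "0 \<le> (q :: real vec) \<bullet> q"
  unfolding scalar_prod_def by (intro sum_nonneg) simp

lemma scalar_prod_div_vec_square_le:
  assumes "q \<in> carrier_vec nQ"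
  shows "(q \<bullet> div_vec w)\<^sup>2 \<le> 2 * energy w * (q \<bullet> (Z_mat d *\<^sub>v q))"
  unfolding scalar_prod_div_vec Z_mat_form[OF assms]
  by (rule broken_b_square_le[OF pw_affine_velocity continuous_pressure_fun])

text \<open>Testing the divergence with the pressure whose nodal values are \<open>div_vec w\<close>
  itself, bounding its mass norm by \<open>CZ\<close>, and cancelling one factor.\<close>

lemma div_vec_norm_le: "div_vec w \<bullet> div_vec w \<le> 2 * CZ * (hmesh d)\<^sup>2 * energy w"
proof (cases "div_vec w \<bullet> div_vec w = 0")
  case True
  then show ?thesis using broken_a_nonneg CZ_pos by simp
next
  case False
  let ?g = "div_vec w \<bullet> div_vec w"
  have g: "0 < ?g" using False scalar_prod_self_nonneg[of "div_vec w"] by simp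
  have "?g\<^sup>2 \<le> 2 * energy w * (div_vec w \<bullet> (Z_mat d *\<^sub>v div_vec w))"
    by (rule scalar_prod_div_vec_square_le) simp
  also have "\<dots> \<le> 2 * energy w * (CZ * (hmesh d)\<^sup>2 * ?g)"
    using mass_bounds(2)[of "div_vec w"] broken_a_nonneg by (intro mult_left_mono) simp_all
  finally have "?g * ?g \<le> (2 * CZ * (hmesh d)\<^sup>2 * energy w) * ?g"
    by (simp add: power2_eq_square mult_ac)
  then show ?thesis using g by (simp add: mult_le_cancel_right)
qed

lemma constraint_mult:
  assumes "w \<in> carrier_vec (nW d)" "r < length Q" "set Q \<subseteq> mesh_nodes (Mesh d)"
  shows "((blockB d Q (fI d) @\<^sub>c 0\<^sub>m (length Q) (nPI d) @\<^sub>c blockB d Q (fDelta d) @\<^sub>c blockB d Q (fPi d)) *\<^sub>v w) $ r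
    = broken_b d (velocity d w) (pbasis d (Q ! r))"
proof -
  have C: "blockB d Q (fI d) @\<^sub>c 0\<^sub>m (length Q) (nPI d) @\<^sub>c blockB d Q (fDelta d) @\<^sub>c blockB d Q (fPi d)
    \<in> carrier_mat (length Q) (nW d)"
    by (intro carrier_matI) (simp_all add: nW_def)
  have "Q ! r \<in> mesh_nodes (Mesh d)" using assms(2,3) nth_mem by blast
  then have "broken_b d (velocity d w) (pbasis d (Q ! r)) = (\<Sum>c<nW d. w $ c * broken_b d (coord_velocity d c) (pbasis d (Q ! r)))"
    by (intro broken_b_velocity continuous_pbasis)
  then show ?thesis
    unfolding mult_mat_vec_sum[OF C assms(1,2)] using assms(2)
    by (simp add: constraint_index mult.commute cong: sum.cong_simp)
qed

lemma W_tilde0_iff: "w \<in> W_tilde0 d \<longleftrightarrow> w \<in> carrier_vec (nW d) \<and> (\<forall>r<nPI d. div_vec w $ r = 0)"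
proof (cases "w \<in> carrier_vec (nW d)")
  case True
  let ?C = "blockB d (pI d) (fI d) @\<^sub>c 0\<^sub>m (nPI d) (nPI d) @\<^sub>c blockB d (pI d) (fDelta d) @\<^sub>c blockB d (pI d) (fPi d)"
  have "set (pI d) \<subseteq> mesh_nodes (Mesh d)" using pI_set by blast
  then have *: "(?C *\<^sub>v w) $ r = div_vec w $ r" if "r < nPI d" for r
    using constraint_mult[OF True, of r "pI d"] that by (simp add: div_vec_def nth_append)
  have "?C *\<^sub>v w = 0\<^sub>v (nPI d) \<longleftrightarrow> (\<forall>r<nPI d. (?C *\<^sub>v w) $ r = 0)"
    by (simp add: Matrix.vec_eq_iff)
  then show ?thesis unfolding W_tilde0_def using True * by simp
qed (simp add: W_tilde0_def)

lemma pressure_zero: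
  assumes "\<And>s. s < nPI d \<Longrightarrow> w $ (nVI d + s) = 0"
  shows "pressure d w = (\<lambda>y. 0)"
proof
  fix y
  have "w $ r * coord_pressure d r y = 0" if "r < nW d" for r
    by (cases rule: coord_cases[OF that]) (simp_all add: assms)
  then show "pressure d w y = 0" unfolding pressure_def by (intro sum.neutral) simp
qed

text \<open>The pressure function of a vector involves interior pressure coordinates only, and
  membership in \<open>W_tilde0\<close> annihilates exactly these.\<close>

lemma W_tilde0_pressure:
  assumes "w \<in> W_tilde0 d"
  shows "broken_b d (velocity d w) (pressure d v) = 0"
proof -
  have "v $ r * broken_b d (velocity d w) (coord_pressure d r) = 0" if "r < nW d" for r
  proof (cases rule: coord_cases[OF that])
    case (2 s)
    then have "broken_b d (velocity d w) (pbasis d (pI d ! s)) = 0"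
      using assms unfolding W_tilde0_iff div_vec_def by (auto simp: nth_append)
    then show ?thesis using 2 by simp
  qed simp_all
  then have "(\<Sum>r<nW d. v $ r * broken_b d (velocity d w) (coord_pressure d r)) = 0"
    by (intro sum.neutral) simp
  moreover have "broken_b d (velocity d w) (pressure d v) = (\<Sum>r<nW d. v $ r * broken_b d (velocity d w) (coord_pressure d r))"
    unfolding pressure_def[abs_def]
    by (rule broken_b_sum) (simp_all add: pw_affine_velocity continuous_coord_pressure)
  ultimately show ?thesis by simp
qed

lemma W_tilde0_form:
  assumes "v \<in> W_tilde0 d" "w \<in> W_tilde0 d"
  shows "v \<bullet> (A_tilde d *\<^sub>v w) = broken_a d (velocity d v) (velocity d w)"
  using A_tilde_form[of w v] assms W_tilde0_pressure W_tilde0_iff by simp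

lemma W_tilde0_add_smult: "v \<in> W_tilde0 d \<Longrightarrow> w \<in> W_tilde0 d \<Longrightarrow> v + t \<cdot>\<^sub>v w \<in> W_tilde0 d"
  unfolding W_tilde0_iff by (auto simp: div_vec_add_smult)

text \<open>The invertibility of \<open>A_tilde\<close> replaces a Poincare inequality: a velocity without energy has no
  divergence either, so it lies in the kernel.\<close>

lemma energy_definite:
  assumes "w \<in> carrier_vec (nW d)" "\<And>s. s < nPI d \<Longrightarrow> w $ (nVI d + s) = 0" "energy w = 0"
  shows "w = 0\<^sub>v (nW d)"
proof (rule invertible_mat_injective[OF A_tilde_carrier A_tilde_invertible assms(1)])
  show "A_tilde d *\<^sub>v w = 0\<^sub>v (nW d)"
  proof (rule vec_eq_zero_scalar_prod)
    show "A_tilde d *\<^sub>v w \<in> carrier_vec (nW d)" by (rule mult_mat_vec_carrier[OF A_tilde_carrier assms(1)])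
    fix u :: "real vec" assume u: "u \<in> carrier_vec (nW d)"
    have "broken_a d (velocity d u) (velocity d w) = 0"
      using energy_Cauchy_Schwarz[OF u assms(1)] assms(3) by simp
    moreover have "broken_b d (velocity d w) (pressure d u) = 0"
      using broken_b_square_le[of "velocity d w" "pressure d u", OF pw_affine_velocity continuous_pressure] assms(3) by simp
    ultimately show "u \<bullet> (A_tilde d *\<^sub>v w) = 0"
      using A_tilde_form[OF assms(1), of u] pressure_zero[OF assms(2)] by simp
  qed
qed

lemma B_C_mult:
  assumes "w \<in> carrier_vec (nW d)"
  shows "B_C d *\<^sub>v w = vec (nPGamma d) (\<lambda>r. div_vec w $ (nPI d + r)) @\<^sub>v (BDelta d *\<^sub>v (R_Delta d *\<^sub>v w))"
proof -
  let ?C = "blockB d (pGamma d) (fI d) @\<^sub>c 0\<^sub>m (nPGamma d) (nPI d) @\<^sub>c blockB d (pGamma d) (fDelta d) @\<^sub>c blockB d (pGamma d) (fPi d)"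
  let ?D = "0\<^sub>m (nLambda d) (nVI d) @\<^sub>c 0\<^sub>m (nLambda d) (nPI d) @\<^sub>c BDelta d @\<^sub>c 0\<^sub>m (nLambda d) (nPi d)"
  have dims: "?C \<in> carrier_mat (nPGamma d) (nW d)" "?D \<in> carrier_mat (nLambda d) (nW d)"
    using BDelta_carrier by (intro carrier_matI; simp add: nW_def)+
  have "set (pGamma d) \<subseteq> mesh_nodes (Mesh d)" using pGamma_set by blast
  then have "?C *\<^sub>v w = vec (nPGamma d) (\<lambda>r. div_vec w $ (nPI d + r))"
    using constraint_mult[OF assms, of _ "pGamma d"]
    by (intro eq_vecI) (simp_all add: div_vec_def nth_append)
  moreover have "?D *\<^sub>v w = BDelta d *\<^sub>v (R_Delta d *\<^sub>v w)"
    by (rule BDelta_R_Delta_mult[OF assms]) (use BDelta_carrier in simp)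
  ultimately show ?thesis
    unfolding B_C_def using mat_mult_append[OF dims assms] by simp
qed

lemma B_C_carrier': "B_C d \<in> carrier_mat (nX d) (nW d)"
  using B_C_carrier BDelta_carrier by blast

text \<open>Testing the equation with an interior pressure coordinate: \<open>B_C\<close> has a zero
  column there, and the corresponding row of \<open>A_tilde\<close> is the divergence
  constraint.\<close>

lemma solution_in_W_tilde0:
  assumes v: "v \<in> carrier_vec (nW d)" and x: "x \<in> carrier_vec (nX d)"
    and eq: "A_tilde d *\<^sub>v v = transpose_mat (B_C d) *\<^sub>v x"
  shows "v \<in> W_tilde0 d"
  unfolding W_tilde0_iff
proof (intro conjI allI impI v)
  fix s assume s: "s < nPI d"
  let ?u = "unit_vec (nW d) (nVI d + s) :: real vec"
  have u: "?u \<in> carrier_vec (nW d)" by simp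
  have sW: "nVI d + s < nW d" using s by (simp add: nW_def)
  have vel: "velocity d ?u = (\<lambda>i y. 0)"
  proof (intro ext)
    fix i y
    have "?u $ r *\<^sub>R coord_velocity d r i y = 0" if "r < nW d" for r
      using s sW that by (cases "r = nVI d + s") simp_all
    then show "velocity d ?u i y = 0" unfolding velocity_def by (intro sum.neutral) simp
  qed
  have pre: "pressure d ?u = pbasis d (pI d ! s)"
  proof
    fix y
    have "pressure d ?u y = (\<Sum>r<nW d. if r = nVI d + s then coord_pressure d r y else 0)"
      unfolding pressure_def using sW by (intro sum.cong refl) simp
    then show "pressure d ?u y = pbasis d (pI d ! s) y" using s sW by simp
  qed
  have "R_Delta d *\<^sub>v ?u = 0\<^sub>v (nDelta d)"
    unfolding R_Delta_mult[OF u] using s by (intro eq_vecI) (simp_all add: nW_def)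
  then have "BDelta d *\<^sub>v (R_Delta d *\<^sub>v ?u) = 0\<^sub>v (nLambda d)" using BDelta_carrier by simp
  moreover have "div_vec ?u $ r = 0" if "r < nQ" for r using that vel by (simp add: div_vec_def)
  ultimately have "B_C d *\<^sub>v ?u = 0\<^sub>v (nX d)"
    unfolding B_C_mult[OF u] nX_def by (intro eq_vecI) simp_all
  then have "x \<bullet> (B_C d *\<^sub>v ?u) = 0" using x by simp
  then have "?u \<bullet> (A_tilde d *\<^sub>v v) = 0"
    using adjoint_scalar_prod[OF B_C_carrier' x u] eq B_C_carrier' x
    by (simp add: comm_scalar_prod[of _ "nW d"])
  then have "broken_b d (velocity d v) (pbasis d (pI d ! s)) = 0"
    unfolding A_tilde_form[OF v] vel pre by simp
  then show "div_vec v $ s = 0" using s by (simp add: div_vec_def nth_append)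
qed

section \<open>The lumped preconditioner\<close>

text \<open>The common factor of \<open>M_lambda_inv\<close> and \<open>P_D\<close>: the former is
  the form of \<open>A_tilde\<close> on lifts, the latter lifts the jump. This is why the jump
  estimate applies directly to the lumped preconditioner.\<close>

definition dual_lift :: "real vec \<Rightarrow> real vec" where
  "dual_lift y = transpose_mat (R_Delta d) *\<^sub>v (transpose_mat (B_Delta_D d) *\<^sub>v y)"

lemma B_Delta_D_carrier: "B_Delta_D d \<in> carrier_mat (nLambda d) (nDelta d)"
  unfolding B_Delta_D_def by simp

lemma R_Delta_transpose_mult:
  assumes "u \<in> carrier_vec (nDelta d)" "c < nW d"
  shows "(transpose_mat (R_Delta d) *\<^sub>v u) $ c = (\<Sum>j<nDelta d. if c = nVI d + nPI d + j then u $ j else 0)"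
proof -
  have "transpose_mat (R_Delta d) \<in> carrier_mat (nW d) (nDelta d)" using R_Delta_carrier by simp
  from mult_mat_vec_sum[OF this assms] have "(transpose_mat (R_Delta d) *\<^sub>v u) $ c
      = (\<Sum>j<nDelta d. transpose_mat (R_Delta d) $$ (c, j) * u $ j)" .
  also have "\<dots> = (\<Sum>j<nDelta d. if c = nVI d + nPI d + j then u $ j else 0)"
  proof (intro sum.cong refl)
    fix j assume "j \<in> {..<nDelta d}"
    then have "transpose_mat (R_Delta d) $$ (c, j) = R_Delta d $$ (j, c)"
      using R_Delta_carrier[of d] assms(2) by (intro index_transpose_mat(1)) simp_all
    then show "transpose_mat (R_Delta d) $$ (c, j) * u $ j = (if c = nVI d + nPI d + j then u $ j else 0)"
      using \<open>j \<in> {..<nDelta d}\<close> assms(2) by (simp add: R_Delta_index)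
  qed
  finally show ?thesis .
qed

lemma dual_lift_carrier: "y \<in> carrier_vec (nLambda d) \<Longrightarrow> dual_lift y \<in> carrier_vec (nW d)"
  unfolding dual_lift_def using R_Delta_carrier[of d] B_Delta_D_carrier by auto

lemma dual_lift_pressure:
  assumes "y \<in> carrier_vec (nLambda d)" "s < nPI d"
  shows "dual_lift y $ (nVI d + s) = 0"
proof -
  have "transpose_mat (B_Delta_D d) *\<^sub>v y \<in> carrier_vec (nDelta d)" using B_Delta_D_carrier assms(1) by auto
  moreover have "nVI d + s < nW d" using assms(2) by (simp add: nW_def)
  ultimately show ?thesis
    unfolding dual_lift_def using assms(2) by (simp add: R_Delta_transpose_mult)
qed

text \<open>The scaling makes the transpose of \<open>B_Delta_D d\<close> a right inverse of
  \<open>BDelta d\<close>, so the lift of \<open>y\<close> has jump \<open>y\<close>.\<close>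

lemma BDelta_dual_lift:
  assumes "y \<in> carrier_vec (nLambda d)"
  shows "BDelta d *\<^sub>v (R_Delta d *\<^sub>v dual_lift y) = y"
proof -
  let ?u = "transpose_mat (B_Delta_D d) *\<^sub>v y"
  have T: "transpose_mat (B_Delta_D d) \<in> carrier_mat (nDelta d) (nLambda d)" using B_Delta_D_carrier by simp
  have u: "?u \<in> carrier_vec (nDelta d)" by (rule mult_mat_vec_carrier[OF T assms])
  have "R_Delta d *\<^sub>v dual_lift y = ?u"
    unfolding R_Delta_mult[OF dual_lift_carrier[OF assms]]
  proof (rule eq_vecI)
    fix j assume "j < dim_vec ?u"
    then have j: "j < nDelta d" using u by (metis carrier_vecD)
    then have "nVI d + nPI d + j < nW d" by (simp add: nW_def)
    from R_Delta_transpose_mult[OF u this] j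
    show "vec (nDelta d) (\<lambda>j. dual_lift y $ (nVI d + nPI d + j)) $ j = ?u $ j"
      unfolding dual_lift_def by simp
  next
    show "dim_vec (vec (nDelta d) (\<lambda>j. dual_lift y $ (nVI d + nPI d + j))) = dim_vec ?u"
      unfolding carrier_vecD[OF u] by simp
  qed
  moreover have "BDelta d *\<^sub>v ?u = (BDelta d * transpose_mat (B_Delta_D d)) *\<^sub>v y"
    by (rule assoc_mult_mat_vec[OF BDelta_carrier T assms, symmetric])
  moreover have "BDelta d * transpose_mat (B_Delta_D d) = 1\<^sub>m (nLambda d)"
    using jump unfolding jump_matrix_def by blast
  ultimately show ?thesis using assms by simp
qed

lemma M_lambda_inv_carrier: "M_lambda_inv d \<in> carrier_mat (nLambda d) (nLambda d)"
  using B_Delta_D_carrier R_Delta_carrier[of d] A_tilde_carrier[of d]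
  unfolding M_lambda_inv_def by (intro carrier_matI) simp_all

lemma M_lambda_inv_eq:
  "M_lambda_inv d = (B_Delta_D d * R_Delta d) * A_tilde d * transpose_mat (B_Delta_D d * R_Delta d)"
proof -
  have D: "B_Delta_D d * R_Delta d \<in> carrier_mat (nLambda d) (nW d)"
    using B_Delta_D_carrier R_Delta_carrier by (rule mult_carrier_mat)
  have "transpose_mat (B_Delta_D d * R_Delta d) = transpose_mat (R_Delta d) * transpose_mat (B_Delta_D d)"
    by (rule transpose_mult[OF B_Delta_D_carrier R_Delta_carrier])
  then show ?thesis
    unfolding M_lambda_inv_def
    using assoc_mult_mat[of "B_Delta_D d * R_Delta d * A_tilde d" "nLambda d" "nW d" "transpose_mat (R_Delta d)" "nDelta d"
      "transpose_mat (B_Delta_D d)" "nLambda d"] D A_tilde_carrier[of d] R_Delta_carrier[of d] B_Delta_D_carrier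
    by simp
qed

lemma M_lambda_inv_symmetric: "transpose_mat (M_lambda_inv d) = M_lambda_inv d"
proof -
  have D: "B_Delta_D d * R_Delta d \<in> carrier_mat (nLambda d) (nW d)" (is "?D \<in> _")
    using B_Delta_D_carrier R_Delta_carrier by (rule mult_carrier_mat)
  have DA: "?D * A_tilde d \<in> carrier_mat (nLambda d) (nW d)" using D A_tilde_carrier by (rule mult_carrier_mat)
  have DT: "transpose_mat ?D \<in> carrier_mat (nW d) (nLambda d)" using D by simp
  have "transpose_mat (?D * A_tilde d * transpose_mat ?D) = ?D * (A_tilde d * transpose_mat ?D)"
    unfolding transpose_mult[OF DA DT] transpose_mult[OF D A_tilde_carrier] A_tilde_symmetric by simp
  also have "\<dots> = ?D * A_tilde d * transpose_mat ?D" by (rule assoc_mult_mat[OF D A_tilde_carrier DT, symmetric])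
  finally show ?thesis unfolding M_lambda_inv_eq .
qed

lemma dual_lift_form:
  assumes "y \<in> carrier_vec (nLambda d)"
  shows "dual_lift y \<bullet> (A_tilde d *\<^sub>v dual_lift y) = energy (dual_lift y)"
  using A_tilde_form[OF dual_lift_carrier[OF assms], of "dual_lift y"] pressure_zero[OF dual_lift_pressure[OF assms]]
  by simp

lemma M_lambda_inv_form:
  assumes "y \<in> carrier_vec (nLambda d)"
  shows "y \<bullet> (M_lambda_inv d *\<^sub>v y) = energy (dual_lift y)"
proof -
  have D: "B_Delta_D d * R_Delta d \<in> carrier_mat (nLambda d) (nW d)" (is "?D \<in> _")
    using B_Delta_D_carrier R_Delta_carrier by (rule mult_carrier_mat)
  have DA: "?D * A_tilde d \<in> carrier_mat (nLambda d) (nW d)" using D A_tilde_carrier by (rule mult_carrier_mat)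
  have DT: "transpose_mat ?D \<in> carrier_mat (nW d) (nLambda d)" using D by simp
  have BT: "transpose_mat (B_Delta_D d) \<in> carrier_mat (nDelta d) (nLambda d)" using B_Delta_D_carrier by simp
  have RT: "transpose_mat (R_Delta d) \<in> carrier_mat (nW d) (nDelta d)" using R_Delta_carrier[of d] by simp
  have lift: "transpose_mat ?D *\<^sub>v y = dual_lift y"
    unfolding dual_lift_def transpose_mult[OF B_Delta_D_carrier R_Delta_carrier]
    by (rule assoc_mult_mat_vec[OF RT BT assms])
  have l: "dual_lift y \<in> carrier_vec (nW d)" by (rule dual_lift_carrier[OF assms])
  have "M_lambda_inv d *\<^sub>v y = ?D *\<^sub>v (A_tilde d *\<^sub>v dual_lift y)"
    unfolding M_lambda_inv_eq assoc_mult_mat_vec[OF DA DT assms] lift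
    by (rule assoc_mult_mat_vec[OF D A_tilde_carrier l])
  then have "y \<bullet> (M_lambda_inv d *\<^sub>v y) = dual_lift y \<bullet> (A_tilde d *\<^sub>v dual_lift y)"
    using adjoint_scalar_prod[OF D assms mult_mat_vec_carrier[OF A_tilde_carrier l]] lift by simp
  then show ?thesis using dual_lift_form[OF assms] by simp
qed

lemma M_inv_carrier: "M_inv d \<in> carrier_mat (nX d) (nX d)"
  using M_lambda_inv_carrier unfolding M_inv_def nX_def by simp

lemma M_inv_symmetric: "transpose_mat (M_inv d) = M_inv d"
proof -
  have P: "(1 / (hmesh d)\<^sup>2) \<cdot>\<^sub>m 1\<^sub>m (nPGamma d) \<in> carrier_mat (nPGamma d) (nPGamma d)" by simp
  have Z1: "0\<^sub>m (nPGamma d) (nLambda d) \<in> carrier_mat (nPGamma d) (nLambda d)"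
    and Z2: "0\<^sub>m (nLambda d) (nPGamma d) \<in> carrier_mat (nLambda d) (nPGamma d)" by simp_all
  have "transpose_mat ((1 / (hmesh d)\<^sup>2) \<cdot>\<^sub>m 1\<^sub>m (nPGamma d)) = (1 / (hmesh d)\<^sup>2) \<cdot>\<^sub>m 1\<^sub>m (nPGamma d)"
    by (intro eq_matI) auto
  moreover have "transpose_mat (0\<^sub>m (nPGamma d) (nLambda d)) = (0\<^sub>m (nLambda d) (nPGamma d) :: real mat)"
    "transpose_mat (0\<^sub>m (nLambda d) (nPGamma d)) = (0\<^sub>m (nPGamma d) (nLambda d) :: real mat)"
    by (intro eq_matI; simp)+
  ultimately show ?thesis
    unfolding M_inv_def transpose_four_block_mat[OF P Z1 Z2 M_lambda_inv_carrier] M_lambda_inv_symmetric by simp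
qed

lemma M_inv_form:
  assumes "g \<in> carrier_vec (nPGamma d)" "y \<in> carrier_vec (nLambda d)"
  shows "(g @\<^sub>v y) \<bullet> (M_inv d *\<^sub>v (g @\<^sub>v y)) = (g \<bullet> g) / (hmesh d)\<^sup>2 + energy (dual_lift y)"
proof -
  have P: "(1 / (hmesh d)\<^sup>2) \<cdot>\<^sub>m 1\<^sub>m (nPGamma d) \<in> carrier_mat (nPGamma d) (nPGamma d)" (is "?P \<in> _") by simp
  have Z1: "0\<^sub>m (nPGamma d) (nLambda d) \<in> carrier_mat (nPGamma d) (nLambda d)"
    and Z2: "0\<^sub>m (nLambda d) (nPGamma d) \<in> carrier_mat (nLambda d) (nPGamma d)" by simp_all
  have My: "M_lambda_inv d *\<^sub>v y \<in> carrier_vec (nLambda d)" by (rule mult_mat_vec_carrier[OF M_lambda_inv_carrier assms(2)])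
  have "?P *\<^sub>v g = (1 / (hmesh d)\<^sup>2) \<cdot>\<^sub>v g"
  proof (rule eq_vecI)
    fix i assume "i < dim_vec ((1 / (hmesh d)\<^sup>2) \<cdot>\<^sub>v g)"
    then have i: "i < nPGamma d" using assms(1) by simp
    have "(\<Sum>j<nPGamma d. ?P $$ (i, j) * g $ j) = (\<Sum>j<nPGamma d. if j = i then 1 / (hmesh d)\<^sup>2 * g $ j else 0)"
      using i by (intro sum.cong refl) simp
    then show "(?P *\<^sub>v g) $ i = ((1 / (hmesh d)\<^sup>2) \<cdot>\<^sub>v g) $ i"
      unfolding mult_mat_vec_sum[OF P assms(1) i] using i assms(1) by simp
  qed (use assms(1) in simp)
  moreover have "0\<^sub>m (nPGamma d) (nLambda d) *\<^sub>v y = 0\<^sub>v (nPGamma d)" "0\<^sub>m (nLambda d) (nPGamma d) *\<^sub>v g = 0\<^sub>v (nLambda d)"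
    using assms by (auto intro!: eq_vecI)
  ultimately have "M_inv d *\<^sub>v (g @\<^sub>v y) = ((1 / (hmesh d)\<^sup>2) \<cdot>\<^sub>v g) @\<^sub>v (M_lambda_inv d *\<^sub>v y)"
    unfolding M_inv_def four_block_mat_mult_vec[OF P Z1 Z2 M_lambda_inv_carrier assms]
    using assms(1) My by simp
  then show ?thesis
    using scalar_prod_append[of g "nPGamma d" y "nLambda d" "(1 / (hmesh d)\<^sup>2) \<cdot>\<^sub>v g" "M_lambda_inv d *\<^sub>v y"]
      assms My M_lambda_inv_form[OF assms(2)] by simp
qed

lemma M_inv_positive:
  assumes "x \<in> carrier_vec (nX d)"
  shows "0 \<le> x \<bullet> (M_inv d *\<^sub>v x)" "x \<bullet> (M_inv d *\<^sub>v x) = 0 \<Longrightarrow> x = 0\<^sub>v (nX d)"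
proof -
  define g where "g = vec_first x (nPGamma d)"
  define y where "y = vec_last x (nLambda d)"
  have x: "x = g @\<^sub>v y" unfolding g_def y_def using assms unfolding nX_def by simp
  have gy: "g \<in> carrier_vec (nPGamma d)" "y \<in> carrier_vec (nLambda d)" unfolding g_def y_def by simp_all
  have form: "x \<bullet> (M_inv d *\<^sub>v x) = (g \<bullet> g) / (hmesh d)\<^sup>2 + energy (dual_lift y)"
    unfolding x by (rule M_inv_form[OF gy])
  have nonneg: "0 \<le> (g \<bullet> g) / (hmesh d)\<^sup>2" "0 \<le> energy (dual_lift y)"
    using scalar_prod_self_nonneg broken_a_nonneg by simp_all
  then show "0 \<le> x \<bullet> (M_inv d *\<^sub>v x)" unfolding form by simp
  assume "x \<bullet> (M_inv d *\<^sub>v x) = 0"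
  then have g0: "g \<bullet> g = 0" and y0: "energy (dual_lift y) = 0"
    using nonneg hmesh_pos unfolding form by (auto simp: add_nonneg_eq_0_iff)
  have "g $ i = 0" if "i < nPGamma d" for i
  proof -
    have "(\<Sum>i<nPGamma d. g $ i * g $ i) = 0" using g0 scalar_prod_sum[OF gy(1), of g] by simp
    then show ?thesis using that by (simp add: sum_nonneg_eq_0_iff)
  qed
  then have "g = 0\<^sub>v (nPGamma d)" using gy(1) by (intro eq_vecI) simp_all
  \<comment> \<open>A lift without energy is zero, and \<open>y\<close> is recovered as its
    jump.\<close>
  moreover have "dual_lift y = 0\<^sub>v (nW d)"
    by (rule energy_definite[OF dual_lift_carrier[OF gy(2)] dual_lift_pressure[OF gy(2)] y0])
  then have "y = 0\<^sub>v (nLambda d)"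
    using BDelta_dual_lift[OF gy(2)] mult_mat_zero_vec[OF R_Delta_carrier] mult_mat_zero_vec[OF BDelta_carrier] by simp
  ultimately show "x = 0\<^sub>v (nX d)" unfolding x nX_def by (intro eq_vecI) simp_all
qed

lemma P_D_mult:
  assumes "w \<in> carrier_vec (nW d)"
  shows "P_D d *\<^sub>v w = dual_lift (BDelta d *\<^sub>v (R_Delta d *\<^sub>v w))"
proof -
  have BT: "transpose_mat (B_Delta_D d) \<in> carrier_mat (nDelta d) (nLambda d)" using B_Delta_D_carrier by simp
  have RT: "transpose_mat (R_Delta d) \<in> carrier_mat (nW d) (nDelta d)" using R_Delta_carrier[of d] by simp
  have Rw: "R_Delta d *\<^sub>v w \<in> carrier_vec (nDelta d)" by (rule mult_mat_vec_carrier[OF R_Delta_carrier assms])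
  have BRw: "BDelta d *\<^sub>v (R_Delta d *\<^sub>v w) \<in> carrier_vec (nLambda d)" by (rule mult_mat_vec_carrier[OF BDelta_carrier Rw])
  have RB: "transpose_mat (R_Delta d) * transpose_mat (B_Delta_D d) \<in> carrier_mat (nW d) (nLambda d)"
    by (rule mult_carrier_mat[OF RT BT])
  show ?thesis
    unfolding P_D_def dual_lift_def assoc_mult_mat_vec[OF mult_carrier_mat[OF RB BDelta_carrier] R_Delta_carrier assms]
      assoc_mult_mat_vec[OF RB BDelta_carrier Rw] assoc_mult_mat_vec[OF RT BT BRw] ..
qed

lemma upper_estimate:
  assumes "jump_estimate d \<Phi>" "w \<in> W_tilde0 d"
  shows "(B_C d *\<^sub>v w) \<bullet> (M_inv d *\<^sub>v (B_C d *\<^sub>v w)) \<le> (2 * CZ + \<Phi>) * (w \<bullet> (A_tilde d *\<^sub>v w))"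
proof -
  have w: "w \<in> carrier_vec (nW d)" and w0: "\<And>r. r < nPI d \<Longrightarrow> div_vec w $ r = 0"
    using assms(2) W_tilde0_iff by auto
  let ?y = "BDelta d *\<^sub>v (R_Delta d *\<^sub>v w)"
  define g where "g = vec (nPGamma d) (\<lambda>r. div_vec w $ (nPI d + r))"
  have g: "g \<in> carrier_vec (nPGamma d)" unfolding g_def by simp
  have y: "?y \<in> carrier_vec (nLambda d)"
    by (intro mult_mat_vec_carrier[OF BDelta_carrier] mult_mat_vec_carrier[OF R_Delta_carrier w])
  have "g \<bullet> g = (\<Sum>r<nPGamma d. div_vec w $ (nPI d + r) * div_vec w $ (nPI d + r))"
    unfolding scalar_prod_sum[OF g] by (simp add: g_def)
  \<comment> \<open>The interior entries vanish on \<open>W_tilde0\<close>, so the interface part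
    carries the whole norm.\<close>
  then have "div_vec w \<bullet> div_vec w = g \<bullet> g"
    using w0 by (simp add: scalar_prod_sum[of _ nQ] sum_lessThan_add)
  then have "(g \<bullet> g) / (hmesh d)\<^sup>2 \<le> 2 * CZ * energy w"
    using div_vec_norm_le[of w] hmesh_pos by (simp add: divide_le_eq mult_ac)
  \<comment> \<open>The vector \<open>P_D w\<close> need not satisfy the divergence constraint; its
    \<open>A_tilde\<close> form is still its energy because its pressure part is zero.\<close>
  moreover have "energy (dual_lift ?y) \<le> \<Phi> * energy w"
    using assms dual_lift_form[OF y] W_tilde0_form[OF assms(2,2)] unfolding jump_estimate_def
    by (metis P_D_mult[OF w])
  ultimately show ?thesis
    unfolding B_C_mult[OF w] g_def[symmetric] M_inv_form[OF g y] W_tilde0_form[OF assms(2,2)]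
    by (simp add: algebra_simps)
qed

section \<open>The conforming problem: definiteness, mean values and constant pressures\<close>

lemma A_mat_positive:
  assumes "v \<in> carrier_vec (nVI d + nG)"
  shows "0 \<le> v \<bullet> (A_mat d *\<^sub>v v)" "v \<bullet> (A_mat d *\<^sub>v v) = 0 \<Longrightarrow> v = 0\<^sub>v (nVI d + nG)"
proof -
  show "0 \<le> v \<bullet> (A_mat d *\<^sub>v v)" unfolding A_mat_form[OF assms] by (rule form_a_nonneg[OF Omega_cover])
  assume 0: "v \<bullet> (A_mat d *\<^sub>v v) = 0"
  from represents_exists[OF assms] obtain w where w: "w \<in> carrier_vec (nW d)"
    "\<And>s. s < nPI d \<Longrightarrow> w $ (nVI d + s) = 0" "BDelta d *\<^sub>v (R_Delta d *\<^sub>v w) = 0\<^sub>v (nLambda d)"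
    "represents w v" "w = 0\<^sub>v (nW d) \<Longrightarrow> v = 0\<^sub>v (nVI d + nG)" by metis
  \<comment> \<open>Definiteness is inherited from the broken representative.\<close>
  have "energy w = 0" unfolding represents_form_a[OF w(4)] using 0 A_mat_form[OF assms] by simp
  then show "v = 0\<^sub>v (nVI d + nG)" using energy_definite[OF w(1,2)] w(5) by blast
qed

lemma A_mat_symmetric: "transpose_mat (A_mat d) = A_mat d"
  using A_mat_carrier form_a_commute[OF Omega_cover] by (intro eq_matI) (auto simp: A_mat_index)

lemma represents_div_vec:
  assumes "v \<in> carrier_vec (nVI d + nG)" "represents w v"
  shows "div_vec w = B_mat d *\<^sub>v v"
proof (rule eq_vecI)
  fix r assume "r < dim_vec (B_mat d *\<^sub>v v)"
  then have r: "r < nQ" using B_mat_carrier by simp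
  then show "div_vec w $ r = (B_mat d *\<^sub>v v) $ r"
    unfolding B_mat_mult[OF assms(1) r] div_vec_def
    using represents_form_b[OF assms(2) continuous_pbasis_nth[of r]] by simp
qed (use B_mat_carrier in simp)

text \<open>The mean value functional in coordinates; it later serves as the vector
  \<open>\<mu>\<close> that removes the kernel of constants.\<close>

definition mean_vec :: "real vec" where
  "mean_vec = vec nQ (\<lambda>r. set_lebesgue_integral lebesgue \<Omega> (pbasis d ((pI d @ pGamma d) ! r)))"

lemma mean_vec_carrier [simp]: "mean_vec \<in> carrier_vec nQ"
  unfolding mean_vec_def by simp

lemma pbasis_integrable: "r < nQ \<Longrightarrow> pbasis d ((pI d @ pGamma d) ! r) absolutely_integrable_on \<Omega>"
  using pressure_integrable(1)[OF Omega_cover continuous_pbasis_nth continuous_pbasis_nth, of r r] by simp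

lemma mean_vec_scalar_prod:
  assumes "q \<in> carrier_vec nQ"
  shows "mean_vec \<bullet> q = set_lebesgue_integral lebesgue \<Omega> (pressure_fun d q)"
proof -
  have "integral \<Omega> (pressure_fun d q) = (\<Sum>r<nQ. integral \<Omega> (\<lambda>y. q $ r * pbasis d ((pI d @ pGamma d) ! r) y))"
    unfolding pressure_fun_eq length_append length_broken_lists
    using set_lebesgue_integral_eq_integral(1)[OF pbasis_integrable]
    by (intro Henstock_Kurzweil_Integration.integral_sum) (auto intro!: integrable_on_mult_right)
  also have "\<dots> = mean_vec \<bullet> q"
    unfolding scalar_prod_sum[OF assms] mean_vec_def
    by (intro sum.cong refl) (simp add: set_lebesgue_integral_eq_integral(2)[OF pbasis_integrable])
  finally show ?thesis
    using set_lebesgue_integral_eq_integral(2)[OF pressure_integrable(1)[OF Omega_cover continuous_pressure_fun continuous_pressure_fun], of q]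
    by simp
qed

abbreviation one_vec :: "real vec" where
  "one_vec \<equiv> vec nQ (\<lambda>_. 1)"

lemma finite_pressure_nodes: "finite (mesh_nodes (Mesh d))"
  by (rule finite_mesh_nodes[OF coarse_mesh(1)]) (rule coarse_mesh(2))

lemma pressure_fun_one:
  assumes "y \<in> \<Omega>"
  shows "pressure_fun d one_vec y = 1"
proof -
  have "y \<in> \<Union>(Mesh d)" using assms closure_subset coarse_mesh(3) by blast
  then obtain T where T: "T \<in> Mesh d" "y \<in> T" by blast
  have "pressure_fun d one_vec y = (\<Sum>r<length (pI d @ pGamma d). pbasis d ((pI d @ pGamma d) ! r) y)"
    unfolding pressure_fun_eq by simp
  also have "\<dots> = (\<Sum>x\<in>set (pI d @ pGamma d). pbasis d x y)"
    by (rule sum.reindex_bij_betw[OF bij_betw_nth[OF pressure_distinct]]) auto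
  also have "\<dots> = 1"
    unfolding pressure_nodes
    by (rule nodal_basis_partition_of_unity[OF pressure_basis finite_pressure_nodes T(1) coarse_cell(2,1)[OF T(1)] T(2)])
  finally show ?thesis .
qed

text \<open>The product is the area of the domain, positive because the domain is open and
  nonempty.\<close>

lemma mean_vec_one: "mean_vec \<bullet> one_vec \<noteq> 0"
proof -
  have "mean_vec \<bullet> one_vec = set_lebesgue_integral lebesgue \<Omega> (\<lambda>y. 1)"
    unfolding mean_vec_scalar_prod[OF vec_carrier]
    using pressure_fun_one Omega_cover(1) by (intro set_lebesgue_integral_cong) auto
  also have "\<dots> = measure lebesgue \<Omega>"
    unfolding set_lebesgue_integral_def using Omega_cover(1) by simp
  also have "\<dots> > 0"
    using open_not_negligible[OF Omega_open Omega_nonempty] lmeasurable_open[OF Omega_bounded Omega_open]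
    unfolding negligible_iff_measure by (simp add: zero_less_measure_iff)
  finally show ?thesis by simp
qed

lemma B_mat_kernel:
  assumes "q \<in> carrier_vec nQ"
  shows "transpose_mat (B_mat d) *\<^sub>v q = 0\<^sub>v (nVI d + nG) \<longleftrightarrow> (\<exists>c. q = c \<cdot>\<^sub>v one_vec)"
proof -
  have dims: "dim_row (B_mat d) = nQ" "dim_col (B_mat d) = nVI d + nG" using B_mat_carrier by auto
  have *: "{q \<in> carrier_vec nQ. transpose_mat (B_mat d) *\<^sub>v q = 0\<^sub>v (nVI d + nG)} = {vec nQ (\<lambda>_. c) | c. True}"
    using kernel unfolding kernel_constants_def dims .
  have "transpose_mat (B_mat d) *\<^sub>v q = 0\<^sub>v (nVI d + nG) \<longleftrightarrow>
      q \<in> {q \<in> carrier_vec nQ. transpose_mat (B_mat d) *\<^sub>v q = 0\<^sub>v (nVI d + nG)}"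
    using assms by blast
  also have "\<dots> \<longleftrightarrow> (\<exists>c. q = vec nQ (\<lambda>_. c))" unfolding * by blast
  also have "\<dots> \<longleftrightarrow> (\<exists>c. q = c \<cdot>\<^sub>v one_vec)"
  proof (rule iff_exI)
    fix c
    have "vec nQ (\<lambda>_. c) = c \<cdot>\<^sub>v one_vec" by (intro eq_vecI) simp_all
    then show "(q = vec nQ (\<lambda>_. c)) = (q = c \<cdot>\<^sub>v one_vec)" by (rule arg_cong)
  qed
  finally show ?thesis .
qed

section \<open>The two estimates\<close>

text \<open>Two degrees of freedom guarantee a nonzero pressure of zero average, on which inf-sup
  says something.\<close>

lemma nQ_ge_2: "2 \<le> nQ"
proof -
  have "closure \<Omega> \<noteq> {}" using Omega_nonempty by simp
  then obtain T where T: "T \<in> Mesh d" unfolding coarse_mesh(3)[symmetric] by blast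
  obtain a b c where abc: "distinct [a, b, c]" "T = convex hull {a, b, c}" "{x. x extreme_point_of T} = {a, b, c}"
    by (rule triangle_vertices[OF coarse_mesh(2)[OF T]])
  have "{a, b} \<subseteq> mesh_nodes (Mesh d)" using abc(3) T unfolding mesh_nodes_def by blast
  then have "card {a, b} \<le> card (mesh_nodes (Mesh d))"
    by (rule card_mono[OF finite_pressure_nodes])
  moreover have "card (mesh_nodes (Mesh d)) = nQ"
    using distinct_card[OF pressure_distinct] unfolding pressure_nodes by simp
  moreover have "card {a, b} = 2" using abc(1) by simp
  ultimately show ?thesis by simp
qed

lemma zero_average_iff:
  assumes "q \<in> carrier_vec nQ"
  shows "zero_average d q \<longleftrightarrow> mean_vec \<bullet> q = 0"
  unfolding zero_average_def mean_vec_scalar_prod[OF assms] by simp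

text \<open>Every use of inf-sup has this form: a uniform bound on the quotients bounds the
  supremum, and hence the mass norm of \<open>q\<close>.\<close>

lemma inf_sup_bounded:
  assumes "inf_sup d \<beta>" and q: "q \<in> carrier_vec nQ" "mean_vec \<bullet> q = 0"
    and bound: "\<And>w. w \<in> carrier_vec (nVI d + nG) \<Longrightarrow> (q \<bullet> (B_mat d *\<^sub>v w))\<^sup>2 \<le> c * (w \<bullet> (A_mat d *\<^sub>v w))" "0 \<le> c"
  shows "\<beta>\<^sup>2 * (q \<bullet> (Z_mat d *\<^sub>v q)) \<le> c"
proof -
  have dims: "dim_row (B_mat d) = nQ" "dim_col (B_mat d) = nVI d + nG" using B_mat_carrier by auto
  have "\<beta>\<^sup>2 * (q \<bullet> (Z_mat d *\<^sub>v q)) \<le>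
    (SUP w\<in>carrier_vec (nVI d + nG). (q \<bullet> (B_mat d *\<^sub>v w))\<^sup>2 / (w \<bullet> (A_mat d *\<^sub>v w)))"
    using assms(1) q zero_average_iff[OF q(1)] unfolding inf_sup_def dims by blast
  also have "\<dots> \<le> c"
  proof (rule cSUP_least)
    show "carrier_vec (nVI d + nG) \<noteq> ({} :: real vec set)" using zero_carrier_vec by blast
    fix w :: "real vec" assume w: "w \<in> carrier_vec (nVI d + nG)"
    show "(q \<bullet> (B_mat d *\<^sub>v w))\<^sup>2 / (w \<bullet> (A_mat d *\<^sub>v w)) \<le> c"
    \<comment> \<open>With a zero denominator the quotient is 0, and \<open>0 \<le> c\<close>
      suffices.\<close>
    proof (cases "w \<bullet> (A_mat d *\<^sub>v w) = 0")
      case False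
      then show ?thesis using bound(1)[OF w] A_mat_positive(1)[OF w] by (simp add: divide_le_eq)
    qed (use bound(2) in simp)
  qed
  finally show ?thesis .
qed

lemma Z_mat_positive:
  assumes "q \<in> carrier_vec nQ"
  shows "0 \<le> q \<bullet> (Z_mat d *\<^sub>v q)" "q \<noteq> 0\<^sub>v nQ \<Longrightarrow> 0 < q \<bullet> (Z_mat d *\<^sub>v q)"
proof -
  have c: "0 < cZ * (hmesh d)\<^sup>2" using cZ_pos hmesh_pos by simp
  show "0 \<le> q \<bullet> (Z_mat d *\<^sub>v q)"
    using mass_bounds(1)[OF assms] scalar_prod_self_nonneg[of q] c by (meson mult_nonneg_nonneg less_imp_le order_trans)
  assume "q \<noteq> 0\<^sub>v nQ"
  then obtain i where i: "i < nQ" "q $ i \<noteq> 0" using assms by (metis carrier_vecD eq_vecI index_zero_vec)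
  have "0 < (\<Sum>i<nQ. q $ i * q $ i)"
    using i by (intro sum_pos2[of _ i]) (auto simp: zero_less_mult_iff)
  then have "0 < q \<bullet> q" using scalar_prod_sum[OF assms, of q] by simp
  then show "0 < q \<bullet> (Z_mat d *\<^sub>v q)" using mass_bounds(1)[OF assms] c by (meson mult_pos_pos less_le_trans)
qed

text \<open>The divergence form has squared continuity constant at most 2, and one nonzero pressure
  of zero average suffices to compare it with the inf-sup constant.\<close>

lemma inf_sup_constant_le:
  assumes "inf_sup d \<beta>"
  shows "\<beta>\<^sup>2 \<le> 2"
proof -
  \<comment> \<open>Orthogonal to \<open>mean_vec\<close> using at most the first two nodes; if the
    first mean is zero, the first basis vector already is.\<close>
  define q where "q = (if mean_vec $ 0 = 0 then unit_vec nQ 0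
    else vec nQ (\<lambda>i. if i = 0 then mean_vec $ 1 else if i = 1 then - (mean_vec $ 0) else 0))"
  obtain m where m: "nQ = Suc (Suc m)" using nQ_ge_2 by (metis add_2_eq_Suc le_Suc_ex)
  have q: "q \<in> carrier_vec nQ" unfolding q_def by simp
  have "mean_vec \<bullet> q = (\<Sum>i<Suc (Suc m). mean_vec $ i * q $ i)" using scalar_prod_sum[OF q, of mean_vec] m by simp
  also have "\<dots> = 0"
    unfolding q_def m sum.lessThan_Suc_shift by (simp add: sum.neutral)
  finally have mean: "mean_vec \<bullet> q = 0" .
  have "q \<noteq> 0\<^sub>v nQ"
  proof
    assume "q = 0\<^sub>v nQ"
    then have "q $ 0 = 0" "q $ 1 = 0" using m by simp_all
    then show False unfolding q_def m by (simp split: if_splits)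
  qed
  then have pos: "0 < q \<bullet> (Z_mat d *\<^sub>v q)" by (rule Z_mat_positive(2)[OF q])
  have "\<beta>\<^sup>2 * (q \<bullet> (Z_mat d *\<^sub>v q)) \<le> 2 * (q \<bullet> (Z_mat d *\<^sub>v q))"
  proof (rule inf_sup_bounded[OF assms q mean])
    fix v :: "real vec" assume v: "v \<in> carrier_vec (nVI d + nG)"
    from represents_exists[OF v] obtain w where w: "represents w v" by metis
    show "(q \<bullet> (B_mat d *\<^sub>v v))\<^sup>2 \<le> 2 * (q \<bullet> (Z_mat d *\<^sub>v q)) * (v \<bullet> (A_mat d *\<^sub>v v))"
      using scalar_prod_div_vec_square_le[OF q, of w]
      unfolding represents_div_vec[OF v w] represents_form_a[OF w] A_mat_form[OF v] by (simp add: mult_ac)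
  qed (use pos in simp)
  then show ?thesis using pos by (simp add: mult_le_cancel_right)
qed

text \<open>Here \<open>v\<close> is the velocity of least energy with the divergence of
  \<open>w\<close>, and \<open>q\<close> is its multiplier. The choice of \<open>mean_vec\<close> as
  \<open>\<mu>\<close> makes \<open>q\<close> an admissible pressure for inf-sup.\<close>

lemma saddle_point_velocity:
  assumes w: "w \<in> carrier_vec (nVI d + nG)"
  obtains q v where "q \<in> carrier_vec nQ" "v \<in> carrier_vec (nVI d + nG)" "mean_vec \<bullet> q = 0"
    "A_mat d *\<^sub>v v = transpose_mat (B_mat d) *\<^sub>v q" "B_mat d *\<^sub>v v = B_mat d *\<^sub>v w"
proof (rule saddle_point_solution[where A = "A_mat d" and B = "B_mat d" and e = one_vec and \<mu> = mean_vec])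
  show "A_mat d \<in> carrier_mat (nVI d + nG) (nVI d + nG)" by (rule A_mat_carrier)
  show "0 \<le> v \<bullet> (A_mat d *\<^sub>v v)" if "v \<in> carrier_vec (nVI d + nG)" for v
    by (rule A_mat_positive(1)[OF that])
  show "v = 0\<^sub>v (nVI d + nG)" if "v \<in> carrier_vec (nVI d + nG)" "v \<bullet> (A_mat d *\<^sub>v v) = 0" for v
    by (rule A_mat_positive(2)[OF that])
  show "B_mat d \<in> carrier_mat nQ (nVI d + nG)" by (rule B_mat_carrier)
  show "one_vec \<in> carrier_vec nQ" by simp
  show "transpose_mat (B_mat d) *\<^sub>v one_vec = 0\<^sub>v (nVI d + nG)"
  proof -
    have "one_vec = 1 \<cdot>\<^sub>v one_vec" by (intro eq_vecI) simp_all
    then show ?thesis using B_mat_kernel[OF vec_carrier] by blast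
  qed
  show "\<exists>c. q = c \<cdot>\<^sub>v one_vec" if "q \<in> carrier_vec nQ" "transpose_mat (B_mat d) *\<^sub>v q = 0\<^sub>v (nVI d + nG)" for q
    using B_mat_kernel[OF that(1)] that(2) by blast
  show "mean_vec \<in> carrier_vec nQ" by simp
  show "mean_vec \<bullet> one_vec \<noteq> 0" by (rule mean_vec_one)
  show "w \<in> carrier_vec (nVI d + nG)" by (rule w)
qed (rule that)

lemma lower_estimate:
  assumes inf_sup: "inf_sup d \<beta>" "0 < \<beta>" and w0: "w0 \<in> W_tilde0 d"
  shows "\<exists>w\<in>W_tilde0 d. B_C d *\<^sub>v w = B_C d *\<^sub>v w0 \<and>
    w \<bullet> (A_tilde d *\<^sub>v w) \<le> (12 + 4 / cZ) / \<beta>\<^sup>2 * ((B_C d *\<^sub>v w0) \<bullet> (M_inv d *\<^sub>v (B_C d *\<^sub>v w0)))"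
proof -
  have w0c: "w0 \<in> carrier_vec (nW d)" and div0: "\<And>r. r < nPI d \<Longrightarrow> div_vec w0 $ r = 0"
    using w0 W_tilde0_iff by auto
  define y where "y = BDelta d *\<^sub>v (R_Delta d *\<^sub>v w0)"
  define g where "g = vec (nPGamma d) (\<lambda>r. div_vec w0 $ (nPI d + r))"
  define w1 where "w1 = dual_lift y"
  define u where "u = w0 + (- 1) \<cdot>\<^sub>v w1"
  have g: "g \<in> carrier_vec (nPGamma d)" unfolding g_def by simp
  have jump_carrier: "BDelta d *\<^sub>v (R_Delta d *\<^sub>v v) \<in> carrier_vec (nLambda d)" if "v \<in> carrier_vec (nW d)" for v
    by (intro mult_mat_vec_carrier[OF BDelta_carrier] mult_mat_vec_carrier[OF R_Delta_carrier that])
  have jump_add: "BDelta d *\<^sub>v (R_Delta d *\<^sub>v (v + t \<cdot>\<^sub>v v')) = BDelta d *\<^sub>v (R_Delta d *\<^sub>v v) + t \<cdot>\<^sub>v (BDelta d *\<^sub>v (R_Delta d *\<^sub>v v'))"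
    if "v \<in> carrier_vec (nW d)" "v' \<in> carrier_vec (nW d)" for v v' t
    using that R_Delta_carrier[of d] BDelta_carrier
    by (simp add: mult_add_distrib_mat_vec[of _ "nDelta d" "nW d"] mult_mat_vec[of _ "nDelta d" "nW d"]
        mult_add_distrib_mat_vec[of _ "nLambda d" "nDelta d"] mult_mat_vec[of _ "nLambda d" "nDelta d"])
  have y: "y \<in> carrier_vec (nLambda d)" unfolding y_def by (rule jump_carrier[OF w0c])
  have w1: "w1 \<in> carrier_vec (nW d)" unfolding w1_def by (rule dual_lift_carrier[OF y])
  have u: "u \<in> carrier_vec (nW d)" unfolding u_def using w0c w1 by simp
  \<comment> \<open>The lift has the same jump as \<open>w0\<close>, so their difference is
    continuous and its divergence is attained by a conforming velocity.\<close>
  have "BDelta d *\<^sub>v (R_Delta d *\<^sub>v u) = y + (- 1) \<cdot>\<^sub>v y"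
    unfolding u_def jump_add[OF w0c w1] y_def[symmetric] unfolding w1_def BDelta_dual_lift[OF y] ..
  also have "\<dots> = 0\<^sub>v (nLambda d)" using y by (intro eq_vecI) simp_all
  finally obtain v where v: "v \<in> carrier_vec (nVI d + nG)" "represents u v"
    by (rule continuous_represents[OF u])
  obtain q v2 where q: "q \<in> carrier_vec nQ" "mean_vec \<bullet> q = 0" and v2: "v2 \<in> carrier_vec (nVI d + nG)"
    and Av2: "A_mat d *\<^sub>v v2 = transpose_mat (B_mat d) *\<^sub>v q" and Bv2: "B_mat d *\<^sub>v v2 = B_mat d *\<^sub>v v"
    by (rule saddle_point_velocity[OF v(1)])
  from represents_exists[OF v2] obtain w2 where w2: "w2 \<in> carrier_vec (nW d)"
    "BDelta d *\<^sub>v (R_Delta d *\<^sub>v w2) = 0\<^sub>v (nLambda d)" "represents w2 v2" by metis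
  define w where "w = w1 + 1 \<cdot>\<^sub>v w2"
  have w: "w \<in> carrier_vec (nW d)" unfolding w_def using w1 w2(1) by simp
  have div2: "div_vec w2 = div_vec w0 + (- 1) \<cdot>\<^sub>v div_vec w1"
    using represents_div_vec[OF v2 w2(3)] represents_div_vec[OF v] Bv2 div_vec_add_smult[OF w0c w1, of "- 1"]
    unfolding u_def by simp
  have divw: "div_vec w = div_vec w0"
    unfolding w_def div_vec_add_smult[OF w1 w2(1)] div2 by (intro eq_vecI) simp_all
  have "w \<in> W_tilde0 d" unfolding W_tilde0_iff divw using w div0 by blast
  have "BDelta d *\<^sub>v (R_Delta d *\<^sub>v w) = y"
    unfolding w_def jump_add[OF w1 w2(1)] w2(2) unfolding w1_def BDelta_dual_lift[OF y]
    using y by (intro eq_vecI) simp_all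
  then have BCw: "B_C d *\<^sub>v w = B_C d *\<^sub>v w0"
    unfolding B_C_mult[OF w] B_C_mult[OF w0c] divw y_def by simp
  define P where "P = (g \<bullet> g) / (hmesh d)\<^sup>2"
  define z where "z = q \<bullet> (Z_mat d *\<^sub>v q)"
  define s where "s = energy w2"
  have Y: "(B_C d *\<^sub>v w0) \<bullet> (M_inv d *\<^sub>v (B_C d *\<^sub>v w0)) = P + energy w1"
    unfolding B_C_mult[OF w0c] y_def[symmetric] g_def[symmetric] M_inv_form[OF g y] P_def w1_def ..
  have P: "0 \<le> P" unfolding P_def using scalar_prod_self_nonneg by simp
  have s1: "0 \<le> energy w1" and s: "0 \<le> s" unfolding s_def by (rule broken_a_nonneg)+
  have z: "0 \<le> z" unfolding z_def by (rule Z_mat_positive(1)[OF q(1)])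
  have s_eq: "s = v2 \<bullet> (A_mat d *\<^sub>v v2)"
    unfolding s_def represents_form_a[OF w2(3)] A_mat_form[OF v2] ..
  have qB: "q \<bullet> (B_mat d *\<^sub>v x) = x \<bullet> (A_mat d *\<^sub>v v2)" if "x \<in> carrier_vec (nVI d + nG)" for x
    unfolding adjoint_scalar_prod[OF B_mat_carrier q(1) that] Av2[symmetric]
    by (rule comm_scalar_prod[OF mult_mat_vec_carrier[OF A_mat_carrier v2] that])
  \<comment> \<open>By the first saddle point equation, pairing \<open>q\<close> with divergences is
    the \<open>A_mat\<close> product with \<open>v2\<close>; Cauchy-Schwarz bounds the inf-sup
    quotients by the energy of \<open>v2\<close>.\<close>
  have "\<beta>\<^sup>2 * z \<le> s"
    unfolding z_def
  proof (rule inf_sup_bounded[OF inf_sup(1) q _ s])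
    fix x :: "real vec" assume x: "x \<in> carrier_vec (nVI d + nG)"
    have "(x \<bullet> (A_mat d *\<^sub>v v2))\<^sup>2 \<le> (x \<bullet> (A_mat d *\<^sub>v x)) * (v2 \<bullet> (A_mat d *\<^sub>v v2))"
      using x v2 by (intro form_Cauchy_Schwarz[OF A_mat_carrier A_mat_symmetric x v2] A_mat_positive(1)) simp_all
    then show "(q \<bullet> (B_mat d *\<^sub>v x))\<^sup>2 \<le> s * (x \<bullet> (A_mat d *\<^sub>v x))"
      unfolding qB[OF x] s_eq by (simp add: mult.commute)
  qed
  define \<alpha> where "\<alpha> = q \<bullet> div_vec w0"
  define \<gamma> where "\<gamma> = q \<bullet> div_vec w1"
  \<comment> \<open>The same equation tested with \<open>v2\<close>. The divergence of
    \<open>w2\<close> is then split into that of \<open>w0\<close>, a bare interface vector, and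
    that of the lift, bounded by its energy.\<close>
  have "s = q \<bullet> div_vec w2"
    unfolding s_eq represents_div_vec[OF v2 w2(3)] by (rule qB[OF v2, symmetric])
  also have "\<dots> = \<alpha> - \<gamma>"
    unfolding div2 \<alpha>_def \<gamma>_def using q(1) by (simp add: scalar_prod_add_distrib[of _ nQ])
  finally have s_split: "s = \<alpha> - \<gamma>" .
  have "div_vec w0 \<bullet> div_vec w0 = g \<bullet> g"
  proof -
    have "g \<bullet> g = (\<Sum>r<nPGamma d. div_vec w0 $ (nPI d + r) * div_vec w0 $ (nPI d + r))"
      unfolding scalar_prod_sum[OF g] by (simp add: g_def)
    then show ?thesis using div0 by (simp add: scalar_prod_sum[of _ nQ] sum_lessThan_add)
  qed
  then have "\<alpha>\<^sup>2 \<le> (q \<bullet> q) * (g \<bullet> g)"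
    using form_Cauchy_Schwarz[of "1\<^sub>m nQ" nQ q "div_vec w0"] q(1) scalar_prod_self_nonneg
    unfolding \<alpha>_def by simp
  \<comment> \<open>The weight \<open>h\<^sup>-\<^sup>2\<close> in the preconditioner exactly
    compensates the scaling of the mass matrix.\<close>
  also have "\<dots> = (cZ * (hmesh d)\<^sup>2 * (q \<bullet> q)) * (P / cZ)"
    unfolding P_def using hmesh_pos cZ_pos by simp
  also have "\<dots> \<le> z * (P / cZ)"
    unfolding z_def using mass_bounds(1)[OF q(1)] P cZ_pos by (intro mult_right_mono) simp_all
  finally have \<alpha>: "\<alpha>\<^sup>2 \<le> z * (P / cZ)" .
  have \<gamma>: "\<gamma>\<^sup>2 \<le> 2 * energy w1 * z"
    unfolding \<gamma>_def z_def by (rule scalar_prod_div_vec_square_le[OF q(1)])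
  define D where "D = 2 * (P / cZ) + 4 * energy w1"
  have D: "0 \<le> D" unfolding D_def using P s1 cZ_pos by simp
  \<comment> \<open>Equivalent to \<open>(\<alpha> - \<gamma>)\<^sup>2 \<le> 2 * \<alpha>\<^sup>2 +
    2 * \<gamma>\<^sup>2\<close>.\<close>
  have "0 \<le> (\<alpha> + \<gamma>)\<^sup>2" by simp
  then have "s\<^sup>2 \<le> 2 * \<alpha>\<^sup>2 + 2 * \<gamma>\<^sup>2" unfolding s_split by (simp add: power2_eq_square algebra_simps)
  also have "\<dots> \<le> 2 * (z * (P / cZ)) + 2 * (2 * energy w1 * z)" using \<alpha> \<gamma> by linarith
  also have "\<dots> = z * D" unfolding D_def by (simp add: algebra_simps)
  finally have "\<beta>\<^sup>2 * s\<^sup>2 \<le> \<beta>\<^sup>2 * (z * D)" by (rule mult_left_mono) simp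
  \<comment> \<open>The inf-sup bound replaces the multiplier norm by \<open>s\<close>, after which
    one factor \<open>s\<close> cancels.\<close>
  also have "\<dots> \<le> s * D" using mult_right_mono[OF \<open>\<beta>\<^sup>2 * z \<le> s\<close> D] by (simp add: mult_ac)
  finally have "s * (\<beta>\<^sup>2 * s) \<le> s * D" by (simp add: power2_eq_square mult_ac)
  then have "\<beta>\<^sup>2 * s \<le> D"
    using s D by (cases "s = 0") (simp_all add: mult_le_cancel_left)
  moreover have "\<beta>\<^sup>2 * energy w1 \<le> 2 * energy w1"
    using mult_right_mono[OF inf_sup_constant_le[OF inf_sup(1)] s1] .
  ultimately have "\<beta>\<^sup>2 * (2 * energy w1 + 2 * s) \<le> 4 * energy w1 + 2 * D"
    by (simp add: algebra_simps)
  \<comment> \<open>The lift enters with 4 directly and 8 through \<open>2 * D\<close>, and the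
    interface divergence with \<open>4 / cZ\<close>.\<close>
  also have "\<dots> \<le> (12 + 4 / cZ) * (P + energy w1)"
  proof -
    have "0 \<le> 12 * P + 4 / cZ * energy w1" using P s1 cZ_pos by simp
    then show ?thesis unfolding D_def by (simp add: algebra_simps)
  qed
  finally have "2 * energy w1 + 2 * s \<le> (12 + 4 / cZ) / \<beta>\<^sup>2 * (P + energy w1)"
    using inf_sup(2) by (simp add: field_simps)
  moreover have "energy w \<le> 2 * energy w1 + 2 * s"
    unfolding w_def s_def by (rule energy_add_le[OF w1 w2(1)])
  ultimately show ?thesis
    using \<open>w \<in> W_tilde0 d\<close> BCw Y W_tilde0_form[of w w] by (intro bexI[of _ w]) simp_all
qed

lemma M_inv_G_bounds:
  assumes "inf_sup d \<beta>" "0 < \<beta>" "jump_estimate d \<Phi>" "0 \<le> \<Phi>" "x \<in> range_MinvG d"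
  shows "0 \<le> (M_mat d *\<^sub>v x) \<bullet> x"
    and "\<beta>\<^sup>2 / (12 + 4 / cZ) * ((M_mat d *\<^sub>v x) \<bullet> x) \<le> (G_mat d *\<^sub>v x) \<bullet> x"
    and "(G_mat d *\<^sub>v x) \<bullet> x \<le> (2 * CZ + \<Phi>) * ((M_mat d *\<^sub>v x) \<bullet> x)"
proof -
  obtain z where z: "z \<in> carrier_vec (nX d)" "x = (M_inv d * G_mat d) *\<^sub>v z"
    using assms(5) unfolding range_MinvG_def by blast
  have c: "0 < 12 + 4 / cZ" using cZ_pos by (simp add: add_pos_pos)
  have K: "0 \<le> 2 * CZ + \<Phi>" and D: "0 \<le> (12 + 4 / cZ) / \<beta>\<^sup>2" using CZ_pos assms(4) c by simp_all
  have bounds: "0 \<le> (M_mat d *\<^sub>v x) \<bullet> x \<and>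
    (M_mat d *\<^sub>v x) \<bullet> x \<le> (12 + 4 / cZ) / \<beta>\<^sup>2 * ((G_mat d *\<^sub>v x) \<bullet> x) \<and>
    (G_mat d *\<^sub>v x) \<bullet> x \<le> (2 * CZ + \<Phi>) * ((M_mat d *\<^sub>v x) \<bullet> x)"
    unfolding M_mat_def G_mat_def
  proof (rule preconditioned_bounds[where A = "A_tilde d" and B = "B_C d" and P = "M_inv d"
        and n = "nW d" and m = "nX d" and V = "W_tilde0 d" and z = z])
    show "A_tilde d \<in> carrier_mat (nW d) (nW d)" by (rule A_tilde_carrier)
    show "invertible_mat (A_tilde d)" by (rule A_tilde_invertible)
    show "transpose_mat (A_tilde d) = A_tilde d" by (rule A_tilde_symmetric)
    show "B_C d \<in> carrier_mat (nX d) (nW d)" by (rule B_C_carrier')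
    show "M_inv d \<in> carrier_mat (nX d) (nX d)" by (rule M_inv_carrier)
    show "transpose_mat (M_inv d) = M_inv d" by (rule M_inv_symmetric)
    show "W_tilde0 d \<subseteq> carrier_vec (nW d)" using W_tilde0_iff by blast
    show "0 \<le> v \<bullet> (A_tilde d *\<^sub>v v)" if "v \<in> W_tilde0 d" for v
      unfolding W_tilde0_form[OF that that] by (rule broken_a_nonneg)
    show "x = (M_inv d * (B_C d * the (mat_inverse (A_tilde d)) * transpose_mat (B_C d))) *\<^sub>v z"
      using z(2) unfolding G_mat_def .
    show "0 \<le> y \<bullet> (M_inv d *\<^sub>v y)" if "y \<in> carrier_vec (nX d)" for y
      by (rule M_inv_positive(1)[OF that])
    show "y = 0\<^sub>v (nX d)" if "y \<in> carrier_vec (nX d)" "y \<bullet> (M_inv d *\<^sub>v y) = 0" for y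
      by (rule M_inv_positive(2)[OF that])
    show "v + t \<cdot>\<^sub>v w \<in> W_tilde0 d" if "v \<in> W_tilde0 d" "w \<in> W_tilde0 d" for v w t
      by (rule W_tilde0_add_smult[OF that])
    show "v \<in> W_tilde0 d" if "v \<in> carrier_vec (nW d)" "y \<in> carrier_vec (nX d)"
        "A_tilde d *\<^sub>v v = transpose_mat (B_C d) *\<^sub>v y" for v y
      by (rule solution_in_W_tilde0[OF that])
  qed (rule K D z(1) upper_estimate[OF assms(3)] lower_estimate[OF assms(1,2)], assumption?)+
  then show "0 \<le> (M_mat d *\<^sub>v x) \<bullet> x"
    "(G_mat d *\<^sub>v x) \<bullet> x \<le> (2 * CZ + \<Phi>) * ((M_mat d *\<^sub>v x) \<bullet> x)"
    by blast+
  have "\<beta>\<^sup>2 / (12 + 4 / cZ) * ((M_mat d *\<^sub>v x) \<bullet> x) \<le>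
      \<beta>\<^sup>2 / (12 + 4 / cZ) * ((12 + 4 / cZ) / \<beta>\<^sup>2 * ((G_mat d *\<^sub>v x) \<bullet> x))"
    using bounds c by (intro mult_left_mono) simp_all
  also have "\<dots> = (G_mat d *\<^sub>v x) \<bullet> x"
  proof -
    have "b / k * (k / b * e) = e" if "0 < b" "0 < k" for b k e :: real using that by simp
    from this[OF zero_less_power[OF assms(2)] c] show ?thesis .
  qed
  finally show "\<beta>\<^sup>2 / (12 + 4 / cZ) * ((M_mat d *\<^sub>v x) \<bullet> x) \<le> (G_mat d *\<^sub>v x) \<bullet> x" .
qed

end

text \<open>\<open>\<Phi>\<close> is fixed up to a generic constant, hence the factor
  \<open>K\<close>. Both constants are chosen before \<open>\<beta>\<close> and \<open>d\<close>, so
  they are uniform in the mesh and the decomposition.\<close>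

theorem theorem4:
  fixes \<Omega> :: "pt set" and \<sigma> \<kappa> cZ CZ \<phi> :: real and \<Phi> :: "real \<Rightarrow> real"
  assumes "polygonal_domain \<Omega>"
    and "0 < \<sigma>" "0 < \<kappa>" "0 < cZ" "0 < CZ"
    and "0 < \<phi>" "\<And>t. 1 \<le> t \<Longrightarrow> \<phi> \<le> \<Phi> t"
  shows "\<exists>C>0. \<exists>K\<ge>1. \<forall>\<beta>>0. \<forall>d :: fetidp.
    fetidp_setting \<Omega> \<sigma> \<kappa> cZ CZ d \<and> inf_sup d \<beta> \<and> jump_estimate d (\<Phi> (Hsub d / hmesh d)) \<longrightarrow>
    (\<forall>x\<in>range_MinvG d.
       C * \<beta>\<^sup>2 * ((M_mat d *\<^sub>v x) \<bullet> x) \<le> (G_mat d *\<^sub>v x) \<bullet> x \<and>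
       (G_mat d *\<^sub>v x) \<bullet> x \<le> K * \<Phi> (Hsub d / hmesh d) * ((M_mat d *\<^sub>v x) \<bullet> x))"
proof -
  define C where "C = 1 / (12 + 4 / cZ)"
  \<comment> \<open>The divergence contribution \<open>2 * CZ\<close> is at most
    \<open>2 * CZ / \<phi>\<close> times \<open>\<Phi>\<close>, since \<open>\<phi>\<close> bounds
    \<open>\<Phi>\<close> below on ratios at least 1.\<close>
  define K where "K = 1 + 2 * CZ / \<phi>"
  have C: "0 < C" unfolding C_def using assms(4) by (simp add: add_pos_pos)
  have K: "1 \<le> K" unfolding K_def using assms(5,6) by simp
  have main: "C * \<beta>\<^sup>2 * ((M_mat d *\<^sub>v x) \<bullet> x) \<le> (G_mat d *\<^sub>v x) \<bullet> x \<and>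
      (G_mat d *\<^sub>v x) \<bullet> x \<le> K * \<Phi> (Hsub d / hmesh d) * ((M_mat d *\<^sub>v x) \<bullet> x)"
    if \<beta>: "0 < \<beta>" and FS: "fetidp_setting \<Omega> \<sigma> \<kappa> cZ CZ d"
      and IS: "inf_sup d \<beta>" and JE: "jump_estimate d (\<Phi> (Hsub d / hmesh d))" and x: "x \<in> range_MinvG d"
    for \<beta> d x
  proof -
    interpret fetidp_discretization \<Omega> \<sigma> \<kappa> cZ CZ d
      by (rule fetidp_discretization.intro) (fact assms(1,4,5) FS)+
    let ?\<Phi> = "\<Phi> (Hsub d / hmesh d)"
    have "1 \<le> Hsub d / hmesh d"
      using FS unfolding fetidp_setting_def by simp
    then have \<Phi>: "\<phi> \<le> ?\<Phi>" by (rule assms(7))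
    then have \<Phi>0: "0 \<le> ?\<Phi>" using assms(6) by simp
    note bounds = M_inv_G_bounds[OF IS \<beta> JE \<Phi>0 x]
    have "2 * CZ / \<phi> * \<phi> \<le> 2 * CZ / \<phi> * ?\<Phi>"
      using \<Phi> assms(5,6) by (intro mult_left_mono) simp_all
    then have "2 * CZ + ?\<Phi> \<le> K * ?\<Phi>" unfolding K_def using assms(6) by (simp add: algebra_simps)
    from order_trans[OF bounds(3) mult_right_mono[OF this bounds(1)]] bounds(2)
    show ?thesis unfolding C_def by simp
  qed
  show ?thesis
    by (rule exI[of _ C], rule conjI[OF C], rule exI[of _ K], rule conjI[OF K], intro allI impI ballI, elim conjE, rule main)
qed

end
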